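(* Let $n\ge 1$ and $c_n:=\dfrac{4^{n}(n!)^2}{(2n-1)!}$. 1) For any closed complex Euclidean ball $\mathbb{B}\subset\mathbb{C}^n$ and any Borel subset $K\subset\mathbb{B}$, $$\frac{\lambda_{2n}(K)}{\lambda_{2n}(\mathbb{B})}\le c_n\,T_{\mathbb{B}}(K)^{2}.$$ 2) Let $\mathbb{G}\subset\mathbb{C}^n$ be a generic real subspace of complex dimension $m$, $0\le m\le n-1$. Then for any real Euclidean closed ball $B\subset\mathbb{G}$ and any Borel subset $K\subset B$, $$\frac{\lambda_{n+m}(K)}{\lambda_{n+m}(B)}\le 8(n+m)\,T_{B}(K).$$
   Context: A real linear subspace $\mathbb{G}\subset\mathbb{C}^n$ is generic if $\mathbb{G}+J\mathbb{G}=\mathbb{C}^n$, where $J$ is the complex structure (multiplication by $i$). Its complex dimension is $m:=\dim_{\mathbb{C}}(\mathbb{G}\cap J\mathbb{G})$, so $\dim_{\mathbb{R}}\mathbb{G}=n+m$. $\mathbb{G}$ carries the induced Euclidean structure, and $\lambda_{n+m}$ is the corresponding Lebesgue measure; $\lambda_{2n}$ is Lebesgue measure on $\mathbb{C}^n$. Balls have positive radius; a ball in $\mathbb{G}$ is a ball of the Euclidean space $\mathbb{G}$. Lelong class: $\mathcal{L}(\mathbb{C}^n)$ is the set of plurisubharmonic functions $u$ on $\mathbb{C}^n$ (not identically $-\infty$) with $\sup_{z\in\mathbb{C}^n}\{u(z)-\log^+|z|\}<+\infty$. For a bounded Borel set $K\subset\mathbb{C}^n$, $V_K(z):=\sup\{u(z):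 u\in\mathcal{L}(\mathbb{C}^n),\ u|_K\le 0\}$, and $V_K^*$ is its upper semicontinuous regularization in $\mathbb{C}^n$. The relative logarithmic capacity of $K$ with respect to a compact set $B\subset \mathbb{C}^n$ is $T_B(K):=\exp(-\max_B V_K^* )$; it equals $0$ when $K$ is pluripolar (in which case $V_K^*\equiv+\infty$). *)

theory Defs
  imports "HOL-Analysis.Analysis"
begin

section \<open>Plurisubharmonic functions and the Lelong class\<close>

definition usc :: "('a::topological_space \<Rightarrow> ereal) \<Rightarrow> bool" where
  "usc u \<longleftrightarrow> (\<forall>c. open {z. u z < c})"

text \<open>
  The Lebesgue integral of \<open>f\<close> over \<open>S\<close>, as positive part minus negative part
  (\<open>e2ennreal\<close> sends negative values to 0). It is only meaningful if the integral of the positive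
  part is finite, which is the case below: upper semicontinuous functions with values in
  \<open>[-\<infinity>, \<infinity>)\<close> are bounded above on circles. The value may be \<open>-\<infinity>\<close>.
\<close>
definition ereal_integral :: "'a::euclidean_space set \<Rightarrow> ('a \<Rightarrow> ereal) \<Rightarrow> ereal" where
  "ereal_integral S f =
     enn2ereal (\<integral>\<^sup>+t\<in>S. e2ennreal (f t) \<partial>lborel) - enn2ereal (\<integral>\<^sup>+t\<in>S. e2ennreal (- f t) \<partial>lborel)"

text \<open>
  \<open>u\<close> is upper semicontinuous and satisfies the sub-mean value inequality on every circle in every
  complex line; the radius is absorbed in the direction \<open>b\<close>. The constant \<open>-\<infinity>\<close> is allowed here.
\<close>
definition plurisubharmonic :: "(complex^'n \<Rightarrow> ereal) \<Rightarrow> bool" where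
  "plurisubharmonic u \<longleftrightarrow>
     (\<forall>z. u z < \<infinity>) \<and> usc u \<and>
     (\<forall>a b. u a \<le> ereal_integral {0..2 * pi} (\<lambda>t. u (a + cis t *s b)) / ereal (2 * pi))"

definition log_plus :: "real \<Rightarrow> real" where
  "log_plus x = (if x \<le> 1 then 0 else ln x)"

definition lelong_class :: "(complex^'n \<Rightarrow> ereal) set" where
  "lelong_class =
     {u. plurisubharmonic u \<and> (\<exists>z. u z \<noteq> -\<infinity>) \<and> (SUP z. u z - ereal (log_plus (norm z))) < \<infinity>}"

section \<open>Extremal function and relative logarithmic capacity\<close>

definition extremal_fun :: "(complex^'n) set \<Rightarrow> complex^'n \<Rightarrow> ereal" where
  "extremal_fun K z = (SUP u \<in> {u \<in> lelong_class. \<forall>x\<in>K. u x \<le> 0}. u z)"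

text \<open>\<open>nhds z\<close> includes \<open>z\<close> itself, so this is the smallest upper semicontinuous majorant.\<close>
definition usc_regularization :: "('a::topological_space \<Rightarrow> ereal) \<Rightarrow> 'a \<Rightarrow> ereal" where
  "usc_regularization f z = Limsup (nhds z) f"

text \<open>
  \<open>exp (- max V)\<close>, where \<open>V\<close> is the regularized extremal function of \<open>K\<close> and the maximum is over
  \<open>B\<close>. For compact nonempty \<open>B\<close> the supremum is attained, as \<open>V\<close> is upper semicontinuous. Since
  the zero function is in the Lelong class, \<open>V \<ge> 0\<close>, so \<open>MInfty\<close> only occurs for empty \<open>B\<close>.
\<close>
definition rel_log_capacity :: "(complex^'n) set \<Rightarrow> (complex^'n) set \<Rightarrow> real" where
  "rel_log_capacity B K =
     (case SUP z\<in>B. usc_regularization (extremal_fun K) z of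
        ereal r \<Rightarrow> exp (- r) | PInfty \<Rightarrow> 0 | MInfty \<Rightarrow> undefined)"

section \<open>Generic real subspaces\<close>

definition J :: "complex^'n \<Rightarrow> complex^'n" where
  "J z = \<i> *s z"

definition generic_subspace :: "(complex^'n) set \<Rightarrow> bool" where
  "generic_subspace G \<longleftrightarrow> subspace G \<and> {x + y | x y. x \<in> G \<and> y \<in> J ` G} = UNIV"

text \<open>\<open>vec.dim\<close> is the dimension over the scalar field \<open>complex\<close>, \<open>dim\<close> would be the real one.\<close>
definition complex_dim :: "(complex^'n) set \<Rightarrow> nat" where
  "complex_dim G = vec.dim (G \<inter> J ` G)"

definition orthonormal_basis :: "'a::euclidean_space set \<Rightarrow> 'a set \<Rightarrow> bool" where
  "orthonormal_basis G E \<longleftrightarrow> pairwise orthogonal E \<and> (\<forall>e\<in>E. norm e = 1) \<and> span E = G"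

text \<open>
  Lebesgue measure of the dimension of \<open>G\<close>, carried by the real subspace \<open>G\<close> with its induced
  Euclidean structure and regarded as a Borel measure on the ambient space. The definition parallels
  \<open>lborel_def\<close>, with an orthonormal basis of \<open>G\<close> in place of \<open>Basis\<close>; by orthogonal invariance of
  Lebesgue measure the choice of the basis is immaterial.
\<close>
definition subspace_lborel :: "'a::euclidean_space set \<Rightarrow> 'a measure" where
  "subspace_lborel G =
     (let E = (SOME E. orthonormal_basis G E)
      in distr (\<Pi>\<^sub>M e\<in>E. lborel) borel (\<lambda>f. \<Sum>e\<in>E. f e *\<^sub>R e))"

end

theory Submission
  imports Defs "HOL-Complex_Analysis.Complex_Analysis" "HOL-Real_Asymp.Real_Asymp"
begin

text \<open>
  The positive part of a Lelong function, restricted to a complex line, is subharmonic with logarithmic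
  growth. Such a function \<open>U\<close> that vanishes on a compact set \<open>K\<close> of points at distance at most \<open>L\<close>
  from \<open>z\<close> satisfies \<open>U z \<le> ln (L / \<rho>)\<close>, where \<open>\<rho>\<close> bounds the transfinite diameter of \<open>K\<close> from
  below. For a subset of the real line of measure \<open>s\<close>, quantile points give \<open>\<rho> = s / (2 e)\<close>; for a
  planar set of area \<open>A\<close>, the Ahlfors-Beurling bound for the Cauchy transform gives \<open>\<rho> = sqrt (A / \<pi>)\<close>.
  Integrating these estimates over the complex (respectively real) lines through a point of the ball
  bounds Lelong functions there. The regularization only costs a slightly larger ball, and in a
  subspace also the step from \<open>G\<close> to nearby points of the whole space, made by a harmonic majorant in a half-disc
  and absorbed in the difference between \<open>2 e\<close> and 8.
\<close>

text \<open>Every bound is proved for a single Lelong function and is uniform in it, so it passes to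
  the supremum and to the regularization. The constant \<open>c_n\<close> comes from comparing a
  section with the disc that the ball cuts from a complex line through \<open>z\<close>. If
  \<open>D\<close> is the largest distance from \<open>z\<close> in that disc, the disc contains one
  of diameter \<open>D\<close> with \<open>z\<close> on its boundary. The density on the line is the
  power \<open>2 * n - 2\<close> of the distance to \<open>z\<close>, and \<open>c_n\<close> is the
  ratio of \<open>pi * D ^ (2 * n)\<close> to its integral over the smaller disc. On a real line the
  same comparison gives \<open>2 * e\<close> times the dimension. The obstacle in a subspace is that
  the regularization sees all points of the whole space near \<open>B\<close>, while the estimate
  holds on \<open>G\<close> only. Genericity writes such a point as \<open>x + \<i> *s y\<close>
  with \<open>x\<close> and \<open>y\<close> in \<open>G\<close> and \<open>y\<close> small. It is
  the point with parameter \<i> on a complex line whose real points lie in \<open>G\<close>, and a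
  long segment of these stays in a slightly larger ball.\<close>

section \<open>Subharmonic functions of logarithmic growth\<close>

text \<open>Subharmonic and of logarithmic growth; not to be confused with subharmonicity of the logarithm.\<close>
definition log_subharmonic :: "(complex \<Rightarrow> real) \<Rightarrow> bool" where
  "log_subharmonic U \<longleftrightarrow>
     (\<forall>c. open {z. U z < c}) \<and> (\<forall>z. 0 \<le> U z) \<and> (\<exists>C. \<forall>z. U z \<le> C + ln (1 + norm z)) \<and>
     (\<forall>a b. ennreal (2 * pi * U a) \<le> (\<integral>\<^sup>+t\<in>{0..2 * pi}. ennreal (U (a + cis t * b)) \<partial>lborel))"

lemma circle_mean_holomorphic:
  fixes g :: "complex \<Rightarrow> complex"
  assumes "g holomorphic_on ball a R" "0 < r" "r < R"
  shows "((\<lambda>t. g (a + cis t * of_real r)) has_integral 2 * pi * g a) {0..2 * pi}"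
proof -
  have "cball a r \<subseteq> ball a R" using assms by auto
  then have "g holomorphic_on cball a r" using assms(1) holomorphic_on_subset by blast
  then have "((\<lambda>u. g u / (u - a)) has_contour_integral 2 * of_real pi * \<i> * g a) (circlepath a r)"
    using Cauchy_integral_circlepath_simple[of g a r a] assms by auto
  then have "((\<lambda>t. g (a + r * cis t) / (a + r * cis t - a) * r * \<i> * cis t)
      has_integral 2 * of_real pi * \<i> * g a) {0..2 * pi}"
    unfolding circlepath_def by (subst (asm) has_contour_integral_part_circlepath_iff) auto
  moreover have "g (a + r * cis t) / (a + r * cis t - a) * r * \<i> * cis t
      = \<i> * g (a + cis t * of_real r)" for t
    using assms by (simp add: field_simps)
  ultimately have "((\<lambda>t. \<i> * g (a + cis t * of_real r)) has_integral 2 * of_real pi * \<i> * g a) {0..2 * pi}"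
    by (simp only:)
  from has_integral_mult_right[OF this, of "-\<i>"] show ?thesis
    by (simp add: algebra_simps)
qed

text \<open>\<open>U\<close> is never integrated exactly: its circle integral is only compared with
  that of \<open>Re (g z)\<close>, which is nonnegative on the circle because \<open>U\<close> is,
  and whose mean is known from Cauchy's formula.\<close>

lemma log_subharmonic_le_center:
  assumes U: "log_subharmonic U" and g: "g holomorphic_on ball a R" and r: "0 < r" "r < R"
    and le: "\<And>z. norm (z - a) = r \<Longrightarrow> U z \<le> Re (g z)"
  shows "U a \<le> Re (g a)"
proof -
  let ?H = "\<lambda>t. Re (g (a + cis t * of_real r))"
  have pt: "norm ((a + cis t * of_real r) - a) = r" for t using r by (simp add: norm_mult)
  have pos: "0 \<le> ?H t" for t
    using le[OF pt] U unfolding log_subharmonic_def by (meson order_trans)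
  have i: "(?H has_integral 2 * pi * Re (g a)) {0..2 * pi}"
    using has_integral_Re[OF circle_mean_holomorphic[OF g r]] by simp
  have "ennreal (2 * pi * U a) \<le> (\<integral>\<^sup>+t\<in>{0..2 * pi}. ennreal (U (a + cis t * of_real r)) \<partial>lborel)"
    using U unfolding log_subharmonic_def by blast
  also have "\<dots> \<le> (\<integral>\<^sup>+t\<in>{0..2 * pi}. ennreal (?H t) \<partial>lborel)"
    by (intro nn_integral_mono mult_right_mono ennreal_leI le pt) auto
  also have "\<dots> = ennreal (2 * pi * Re (g a))"
  proof -
    have "continuous_on {0..2 * pi} ?H"
      by (rule continuous_on_Re, rule continuous_on_compose2[OF holomorphic_on_imp_continuous_on[OF g]])
         (use r in \<open>auto intro!: continuous_intros simp: dist_norm norm_mult\<close>)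
    then have "(\<lambda>t. indicator {0..2 * pi} t *\<^sub>R ?H t) \<in> borel_measurable borel"
      by (rule borel_measurable_continuous_on_indicator[rotated]) simp
    then have "(\<lambda>t. ?H t * indicator {0..2 * pi} t) \<in> borel_measurable borel"
      by (simp add: mult.commute)
    moreover have "((\<lambda>t. ?H t * indicator {0..2 * pi} t) has_integral 2 * pi * Re (g a)) UNIV"
      using i by (subst (asm) has_integral_restrict_UNIV[symmetric])
        (auto elim!: has_integral_eq[rotated] simp: indicator_def)
    ultimately have "(\<integral>\<^sup>+t. ennreal (?H t * indicator {0..2 * pi} t) \<partial>lborel) = ennreal (2 * pi * Re (g a))"
      using pos by (intro nn_integral_has_integral_lborel) auto
    then show ?thesis by (simp add: nn_integral_set_ennreal)
  qed
  finally have "2 * pi * U a \<le> 2 * pi * Re (g a)"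
    using has_integral_nonneg[OF i] pos by (subst (asm) ennreal_le_iff) auto
  then show ?thesis by simp
qed

text \<open>Otherwise the sets where \<open>f x < f b\<close>, for \<open>b\<close> in
  \<open>X\<close>, cover \<open>X\<close>; a finite subcover misses the point with the largest of
  the finitely many values \<open>f b\<close>.\<close>

lemma usc_attains_sup:
  fixes f :: "'a::topological_space \<Rightarrow> real"
  assumes X: "compact X" "X \<noteq> {}" and op: "\<And>c. openin (top_of_set X) {x \<in> X. f x < c}"
  shows "\<exists>a\<in>X. \<forall>x\<in>X. f x \<le> f a"
proof (rule ccontr)
  assume "\<not> ?thesis"
  then have ex: "\<forall>a\<in>X. \<exists>b\<in>X. f a < f b" by force
  from op have "\<forall>c. \<exists>T. open T \<and> {x \<in> X. f x < c} = X \<inter> T" by (simp add: openin_open)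
  then obtain T where T: "\<And>c. open (T c)" "\<And>c. {x \<in> X. f x < c} = X \<inter> T c" by metis
  have cov: "X \<subseteq> (\<Union>b\<in>X. T (f b))" using ex T(2) by fastforce
  obtain D where D: "D \<subseteq> X" "finite D" "X \<subseteq> (\<Union>b\<in>D. T (f b))"
    using compactE_image[OF X(1) _ cov] T(1) by (metis (no_types, lifting))
  have "D \<noteq> {}" using D X by auto
  then obtain m where m: "m \<in> D" "\<forall>b\<in>D. f b \<le> f m"
    using arg_min_if_finite[of D "\<lambda>x. - f x"] D(2) by (meson neg_less_iff_less not_less)
  then obtain b where b: "b \<in> D" "m \<in> T (f b)" using D by blast
  then have "f m < f b" using T(2)[of "f b"] m D(1) by blast
  with m b show False by force
qed

text \<open>The alternative in \<open>loc\<close> stands in for the frontier of \<open>X\<close>,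
  where only the inequality is possible. A small multiple of the squared norm makes the
  subharmonicity strict, so that a maximum is contradicted at once, instead of propagating equality
  along a connected set.\<close>

lemma log_subharmonic_maximum_principle:
  assumes U: "log_subharmonic U" and X: "compact X" and h: "continuous_on X h"
    and loc: "\<And>a. a \<in> X \<Longrightarrow> U a \<le> h a \<or>
      (\<exists>R>0. \<exists>g. ball a R \<subseteq> X \<and> g holomorphic_on ball a R \<and> (\<forall>z\<in>ball a R. h z = Re (g z)))"
    and z0: "z0 \<in> X"
  shows "U z0 \<le> h z0"
proof (rule ccontr)
  assume neg: "\<not> ?thesis"
  define \<gamma> where "\<gamma> = U z0 - h z0"
  have \<gamma>: "\<gamma> > 0" using neg by (simp add: \<gamma>_def)
  obtain B where B: "\<And>z. z \<in> X \<Longrightarrow> norm z \<le> B" using compact_imp_bounded[OF X] by (auto simp: bounded_iff)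
  \<comment> \<open>The perturbation is below \<open>\<gamma>\<close> on all of \<open>X\<close>, so
    a maximum point of \<open>\<Phi>\<close> still satisfies \<open>U a > h a\<close>.\<close>
  define e where "e = \<gamma> / (B\<^sup>2 + 1)"
  have e: "e > 0" using \<gamma> by (simp add: e_def add_nonneg_pos)
  have "e * (B\<^sup>2 + 1) = \<gamma>" unfolding e_def by (simp add: add_nonneg_pos less_imp_neq[symmetric])
  then have eB: "e * B\<^sup>2 < \<gamma>" using e by (simp add: distrib_left)
  define \<Phi> where "\<Phi> z = U z - h z + e * (norm z)\<^sup>2" for z
  have "openin (top_of_set X) {x \<in> X. \<Phi> x < c}" for c
  proof -
    have "{x \<in> X. \<Phi> x < c} = (\<Union>q. (X \<inter> {x. U x < q}) \<inter> {x \<in> X. q < c + h x - e * (norm x)\<^sup>2})"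
      unfolding \<Phi>_def
    proof safe
      fix x assume x: "x \<in> X" "U x - h x + e * (norm x)\<^sup>2 < c"
      then have "U x < c + h x - e * (norm x)\<^sup>2" by simp
      then obtain q where "U x < q" "q < c + h x - e * (norm x)\<^sup>2" using dense by blast
      then show "x \<in> (\<Union>q. X \<inter> {x. U x < q} \<inter> {x \<in> X. q < c + h x - e * (norm x)\<^sup>2})"
        using x by blast
    qed auto
    moreover have "openin (top_of_set X) ((X \<inter> {x. U x < q}) \<inter> {x \<in> X. q < c + h x - e * (norm x)\<^sup>2})" for q
    proof (rule openin_Int)
      show "openin (top_of_set X) (X \<inter> {x. U x < q})"
        using U by (auto simp: log_subharmonic_def openin_open)
      have "continuous_on X (\<lambda>x. c + h x - e * (norm x)\<^sup>2)" by (intro continuous_intros h)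
      from continuous_openin_preimage_gen[OF this, of "{q<..}"]
      show "openin (top_of_set X) {x \<in> X. q < c + h x - e * (norm x)\<^sup>2}"
        by (simp add: vimage_def Int_def)
    qed
    ultimately show ?thesis by (metis (no_types, lifting) openin_Union imageE)
  qed
  from usc_attains_sup[OF X _ this] z0 obtain a where a: "a \<in> X" "\<And>x. x \<in> X \<Longrightarrow> \<Phi> x \<le> \<Phi> a" by blast
  have na: "(norm a)\<^sup>2 \<le> B\<^sup>2" using B[OF a(1)] by (intro power_mono) auto
  have "\<gamma> \<le> \<Phi> z0" using e by (simp add: \<Phi>_def \<gamma>_def)
  also have "\<dots> \<le> \<Phi> a" using a z0 by blast
  finally have "U a - h a > 0" using eB mult_left_mono[OF na less_imp_le[OF e]] unfolding \<Phi>_def by linarith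
  then obtain R g where R: "R > 0" "ball a R \<subseteq> X" and g: "g holomorphic_on ball a R"
      and hg: "\<And>z. z \<in> ball a R \<Longrightarrow> h z = Re (g z)"
    using loc[OF a(1)] by auto
  define r where "r = R / 2"
  have r: "0 < r" "r < R" using R by (auto simp: r_def)
  \<comment> \<open>On the circle of radius \<open>r\<close> about \<open>a\<close> the squared norm
    agrees with an affine function, the real part of a holomorphic one. The majorant of
    \<open>U\<close> given by maximality thus becomes \<open>Re (G z)\<close>, and at the center it
    falls short of \<open>U a\<close> by \<open>e * r\<^sup>2\<close>.\<close>
  define G where "G z = g z + of_real (\<Phi> a + e * (norm a)\<^sup>2 - e * r\<^sup>2) - 2 * of_real e * (cnj a * z)" for z
  have "G holomorphic_on ball a R" unfolding G_def by (intro holomorphic_intros g)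
  moreover have "U z \<le> Re (G z)" if z: "norm (z - a) = r" for z
  proof -
    have zb: "z \<in> ball a R" using z r by (simp add: dist_norm norm_minus_commute)
    have "U z \<le> \<Phi> a + h z - e * (norm z)\<^sup>2" using a(2)[of z] zb R by (auto simp: \<Phi>_def)
    moreover have "(norm z)\<^sup>2 = 2 * Re (cnj a * z) - (norm a)\<^sup>2 + r\<^sup>2"
      unfolding z[symmetric] cmod_power2 by (simp add: power2_eq_square algebra_simps)
    ultimately show ?thesis by (simp add: G_def hg[OF zb] algebra_simps)
  qed
  ultimately have "U a \<le> Re (G a)" using log_subharmonic_le_center[OF U _ r] by blast
  also have "\<dots> = h a + \<Phi> a - e * (norm a)\<^sup>2 - e * r\<^sup>2"
  proof -
    have "cnj a * a = of_real ((norm a)\<^sup>2)" by (metis complex_norm_square mult.commute)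
    then show ?thesis using hg[of a] R by (simp add: G_def del: of_real_power)
  qed
  also have "\<dots> = U a - e * r\<^sup>2" by (simp add: \<Phi>_def)
  finally have "e * r\<^sup>2 \<le> 0" by simp
  then show False using mult_pos_pos[OF e zero_less_power[OF r(1), of 2]] by linarith
qed

section \<open>A majorant from almost Fekete points\<close>

text \<open>The sum minus 1 is a polynomial in \<open>z\<close> of degree below
  \<open>card F\<close> that vanishes on \<open>F\<close>.\<close>

lemma sum_lagrange_basis:
  fixes F :: "complex set"
  assumes F: "finite F" "F \<noteq> {}"
  shows "(\<Sum>w\<in>F. \<Prod>y\<in>F - {w}. (z - y) / (w - y)) = 1"
proof -
  define L where "L w = (\<Prod>y\<in>F - {w}. smult (1 / (w - y)) [:- y, 1:])" for w
  define q where "q = (\<Sum>w\<in>F. L w) - 1"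
  have pL: "poly (L w) x = (\<Prod>y\<in>F - {w}. (x - y) / (w - y))" for w x
    unfolding L_def poly_prod by (rule prod.cong) (auto simp flip: diff_divide_distrib)
  have dL: "degree (L w) \<le> card F - 1" if "w \<in> F" for w
  proof -
    have "degree (L w) \<le> (\<Sum>y\<in>F - {w}. degree (smult (1 / (w - y)) [:- y, 1:]))"
      unfolding L_def by (rule order_trans[OF degree_prod_sum_le]) (use F in auto)
    also have "\<dots> \<le> (\<Sum>y\<in>F - {w}. 1)" by (rule sum_mono) (auto intro: order_trans[OF degree_smult_le])
    finally show ?thesis using that F by simp
  qed
  have dq: "degree q \<le> card F - 1"
    unfolding q_def by (intro degree_diff_le degree_sum_le F dL) auto
  have "poly q x = 0" if x: "x \<in> F" for x
  proof -
    have "poly (L w) x = (if w = x then 1 else 0)" if "w \<in> F" for w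
      using F x that unfolding pL by (auto intro!: prod.neutral)
    then have "(\<Sum>w\<in>F. poly (L w) x) = 1" using F x by simp
    then show ?thesis by (simp add: q_def poly_sum)
  qed
  then have sub: "F \<subseteq> {x. poly q x = 0}" by auto
  have "q = 0"
  proof (rule ccontr)
    assume q: "q \<noteq> 0"
    have "card F \<le> card {x. poly q x = 0}"
      using sub poly_roots_finite[OF q] by (rule card_mono[rotated])
    also have "\<dots> \<le> degree q" using q by (rule card_poly_roots_bound)
    moreover have "card F > 0" using F by (simp add: card_gt_0_iff)
    ultimately show False using dq by linarith
  qed
  then have "poly (\<Sum>w\<in>F. L w) z = 1" by (simp add: q_def)
  then show ?thesis by (simp add: poly_sum pL)
qed

text \<open>Let \<open>p\<close> be the monic polynomial with zeros \<open>F\<close>. Interpolating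
  the constant 1 expresses it as the sum of \<open>p z / ((z - w) * p' w)\<close> over
  \<open>F\<close>, and \<open>sep\<close> and \<open>far\<close> bound both denominators from
  below. So separation of the zeros keeps \<open>p\<close> from being small at distance
  \<open>\<delta>\<close>.\<close>

lemma prod_norm_diff_ge:
  fixes F :: "complex set"
  assumes F: "finite F" "F \<noteq> {}" and c: "c > 0" and d: "\<delta> > 0"
    and sep: "\<And>w. w \<in> F \<Longrightarrow> c \<le> (\<Prod>y\<in>F - {w}. norm (w - y))"
    and far: "\<And>w. w \<in> F \<Longrightarrow> \<delta> \<le> norm (z - w)"
  shows "c * \<delta> / card F \<le> (\<Prod>w\<in>F. norm (z - w))"
proof -
  let ?P = "\<Prod>w\<in>F. norm (z - w)"
  have "1 = norm (\<Sum>w\<in>F. \<Prod>y\<in>F - {w}. (z - y) / (w - y))"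
    using sum_lagrange_basis[OF F] by simp
  also have "\<dots> \<le> (\<Sum>w\<in>F. norm (\<Prod>y\<in>F - {w}. (z - y) / (w - y)))" by (rule norm_sum)
  also have "\<dots> \<le> (\<Sum>w\<in>F. ?P / (\<delta> * c))"
  proof (rule sum_mono)
    fix w assume w: "w \<in> F"
    have "norm (\<Prod>y\<in>F - {w}. (z - y) / (w - y)) =
        (\<Prod>y\<in>F - {w}. norm (z - y)) / (\<Prod>y\<in>F - {w}. norm (w - y))"
      by (simp add: prod_norm[symmetric] norm_divide prod_dividef)
    also have "\<dots> \<le> (\<Prod>y\<in>F - {w}. norm (z - y)) / c"
      using sep[OF w] c by (intro divide_left_mono mult_pos_pos prod_nonneg) auto
    also have "(\<Prod>y\<in>F - {w}. norm (z - y)) = ?P / norm (z - w)"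
      using prod.remove[OF F(1) w, of "\<lambda>y. norm (z - y)"] far[OF w] d by auto
    also have "?P / norm (z - w) / c \<le> ?P / \<delta> / c"
      using far[OF w] d c by (intro divide_right_mono divide_left_mono mult_pos_pos prod_nonneg) auto
    finally show "norm (\<Prod>y\<in>F - {w}. (z - y) / (w - y)) \<le> ?P / (\<delta> * c)" by simp
  qed
  also have "\<dots> = card F * ?P / (c * \<delta>)" by (simp add: mult.commute)
  finally show ?thesis using F c d by (simp add: field_simps card_gt_0_iff)
qed

text \<open>Comparison in the style of Bernstein and Walsh: \<open>p\<close> is scaled so that its
  modulus is at least 1 off the \<open>\<delta>\<close>-neighborhood of \<open>K\<close>, and the
  logarithm of the modulus divided by the degree grows at infinity like \<open>U\<close>, up to a
  constant. The factor \<open>1 + \<eta>\<close> makes it dominate on a large circle, and then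
  \<open>\<eta>\<close> tends to 0.\<close>

lemma log_subharmonic_le_log_prod:
  assumes U: "log_subharmonic U" and K: "compact K" "K \<noteq> {}"
    and F: "finite F" "F \<noteq> {}" "F \<subseteq> K" and c0: "c0 > 0" and d: "\<delta> > 0" and M: "M \<ge> 0"
    and P: "\<And>x. \<delta> \<le> infdist x K \<Longrightarrow> c0 \<le> (\<Prod>w\<in>F. norm (x - w))"
    and UK: "\<And>x. infdist x K \<le> \<delta> \<Longrightarrow> U x \<le> M" and z: "\<delta> \<le> infdist z K"
  shows "U z \<le> M + ln ((\<Prod>w\<in>F. norm (z - w)) / c0) / card F"
proof -
  define N where "N = real (card F)"
  have N: "N > 0" using F by (simp add: N_def card_gt_0_iff)
  define p where "p x = (\<Prod>w\<in>F. x - w) / of_real c0" for x :: complex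
  have np: "norm (p x) = (\<Prod>w\<in>F. norm (x - w)) / c0" for x
    using c0 by (simp add: p_def norm_divide prod_norm)
  have p1: "1 \<le> norm (p x)" if "\<delta> \<le> infdist x K" for x
    using P[OF that] c0 by (simp add: np)
  obtain C where C: "\<And>x. U x \<le> C + ln (1 + norm x)" using U by (auto simp: log_subharmonic_def)
  obtain B where B: "B > 0" "\<And>x. x \<in> K \<Longrightarrow> norm x \<le> B"
    using compact_imp_bounded[OF K(1)] by (auto simp: bounded_pos)
  have main: "U z \<le> M + (1 + \<eta>) / N * ln (norm (p z))" if \<eta>: "\<eta> > 0" for \<eta>
  proof -
    define Q where "Q = C + ln 2 + (1 + \<eta>) / N * ln c0"
    \<comment> \<open>With \<open>R = B + t\<close>, points of the circle of radius \<open>R\<close>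
      have distance at least \<open>t\<close> from \<open>K\<close>. The three terms of the maximum
      give \<open>1 + R \<le> 2 * t\<close>, let \<open>\<eta> * ln t\<close> absorb the constants
      in \<open>Q\<close>, and put \<open>z\<close> inside.\<close>
    define t where "t = max (max (B + 1) (exp (Q / \<eta>))) (norm z)"
    define R where "R = B + t"
    have t: "t \<ge> B + 1" "t \<ge> exp (Q / \<eta>)" "t \<ge> norm z" by (auto simp: t_def)
    have t0: "t > 0" using t B by linarith
    have "Q / \<eta> \<le> ln t" using t(2) t0 by (metis exp_gt_zero ln_exp ln_mono)
    then have Qt: "Q \<le> \<eta> * ln t" using \<eta> by (simp add: field_simps)
    define X where "X = cball 0 R \<inter> {x. \<delta> \<le> infdist x K}"
    have "closed {x. \<delta> \<le> infdist x K}" by (intro closed_Collect_le continuous_intros)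
    then have X: "compact X" unfolding X_def by (intro compact_Int_closed) auto
    define h where "h x = M + (1 + \<eta>) / N * ln (norm (p x))" for x
    have cp: "continuous_on A p" for A unfolding p_def using c0 by (intro continuous_intros) auto
    have "p x \<noteq> 0" if "x \<in> X" for x using p1[of x] that by (auto simp: X_def)
    then have h: "continuous_on X h"
      unfolding h_def using N by (intro continuous_intros cp) auto
    have "U z \<le> h z"
    proof (rule log_subharmonic_maximum_principle[OF U X h])
      show "z \<in> X" using z t B by (auto simp: X_def R_def)
    next
      fix a assume a: "a \<in> X"
      have da: "\<delta> \<le> infdist a K" using a by (simp add: X_def)
      have hM: "M \<le> h a" using p1[OF da] N \<eta> by (simp add: h_def)
      have "norm a \<le> R" using a by (simp add: X_def)
      with da consider "infdist a K = \<delta>" | "norm a = R" | "norm a < R" "\<delta> < infdist a K"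
        by linarith
      then show "U a \<le> h a \<or> (\<exists>r>0. \<exists>g. ball a r \<subseteq> X \<and> g holomorphic_on ball a r \<and>
          (\<forall>z\<in>ball a r. h z = Re (g z)))"
      proof cases
        case 1
        then have "U a \<le> h a" using UK[of a] hM by simp
        then show ?thesis ..
      next
        case 2
        have "t ^ card F \<le> (\<Prod>w\<in>F. norm (a - w))"
        proof -
          have "(\<Prod>w\<in>F. t) \<le> (\<Prod>w\<in>F. norm (a - w))"
          proof (rule prod_mono)
            fix w assume "w \<in> F"
            then have "norm w \<le> B" using B F by auto
            then show "0 \<le> t \<and> t \<le> norm (a - w)"
              using t0 norm_triangle_ineq2[of a w] 2 by (simp add: R_def)
          qed
          then show ?thesis by simp
        qed
        then have "t ^ card F / c0 \<le> norm (p a)" using c0 by (simp add: np divide_right_mono)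
        then have "ln (t ^ card F / c0) \<le> ln (norm (p a))"
          using t0 c0 by (intro ln_mono) auto
        then have "N * ln t - ln c0 \<le> ln (norm (p a))"
          using t0 c0 by (simp add: ln_div ln_realpow N_def)
        then have "(1 + \<eta>) / N * (N * ln t - ln c0) \<le> (1 + \<eta>) / N * ln (norm (p a))"
          using \<eta> N by (intro mult_left_mono) auto
        moreover have "(1 + \<eta>) / N * (N * ln t - ln c0) = (1 + \<eta>) * ln t - (1 + \<eta>) / N * ln c0"
          using N by (simp add: field_simps)
        ultimately have "C + ln 2 + ln t \<le> h a"
          using Qt M unfolding h_def Q_def by (simp add: algebra_simps)
        moreover have "ln (1 + norm a) \<le> ln (2 * t)"
          using 2 t t0 B by (intro ln_mono) (auto simp: R_def)
        ultimately have "U a \<le> h a" using C[of a] t0 by (simp add: ln_mult)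
        then show ?thesis ..
      next
        case 3
        have "open (ball 0 R \<inter> {x. \<delta> < infdist x K})"
          by (intro open_Int open_ball open_Collect_less continuous_intros)
        moreover have "a \<in> ball 0 R \<inter> {x. \<delta> < infdist x K}" using 3 by simp
        ultimately obtain r where r: "r > 0" "ball a r \<subseteq> ball 0 R \<inter> {x. \<delta> < infdist x K}"
          by (meson open_contains_ball)
        then have rX: "ball a r \<subseteq> X" by (force simp: X_def)
        have nz: "p x \<noteq> 0" if "x \<in> ball a r" for x
          using p1[of x] that rX by (auto simp: X_def)
        have "p holomorphic_on ball a r" unfolding p_def using c0 by (intro holomorphic_intros) auto
        then obtain g where g: "g holomorphic_on ball a r" "\<And>x. x \<in> ball a r \<Longrightarrow> p x = exp (g x)"
          using contractible_imp_holomorphic_log[OF _ convex_imp_contractible[OF convex_ball], of p a r] nz by metis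
        have "(\<lambda>x. of_real M + of_real ((1 + \<eta>) / N) * g x) holomorphic_on ball a r"
          by (intro holomorphic_intros g)
        moreover have "h x = Re (of_real M + of_real ((1 + \<eta>) / N) * g x)" if "x \<in> ball a r" for x
          unfolding h_def g(2)[OF that] by simp
        ultimately show ?thesis using r(1) rX by blast
      qed
    qed
    then show ?thesis by (simp add: h_def)
  qed
  have lim: "((\<lambda>\<eta>. M + (1 + \<eta>) / N * ln (norm (p z))) \<longlongrightarrow> M + (1 + 0) / N * ln (norm (p z))) (at_right 0)"
    using N by (intro tendsto_intros) auto
  have "U z \<le> M + (1 + 0) / N * ln (norm (p z))"
    by (rule tendsto_lowerbound[OF lim]) (intro eventually_at_rightI[of 0 1] main, auto)
  then show ?thesis by (simp add: np N_def)
qed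

text \<open>The separated sets \<open>F\<close> play the part of Fekete points: by Lagrange interpolation, the
  logarithm of the polynomial with zeros \<open>F\<close> is an almost optimal harmonic majorant off \<open>K\<close>.\<close>
lemma log_subharmonic_le_transfinite:
  assumes U: "log_subharmonic U" and K: "compact K" "K \<noteq> {}" and c: "c > 0" and \<rho>: "\<rho> > 0"
    and F: "\<And>k. \<exists>F\<subseteq>K. finite F \<and> card F = Suc k \<and> (\<forall>w\<in>F. c * \<rho> ^ k \<le> (\<Prod>y\<in>F - {w}. norm (w - y)))"
    and UK: "\<And>w. w \<in> K \<Longrightarrow> U w \<le> M" and L: "\<And>w. w \<in> K \<Longrightarrow> norm (z - w) \<le> L" "\<rho> \<le> L"
  shows "U z \<le> M + ln (L / \<rho>)"
proof (rule field_le_epsilon)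
  fix e :: real assume e: "e > 0"
  have M: "M \<ge> 0" using K(2) UK U unfolding log_subharmonic_def by (meson equals0I order_trans)
  have L0: "L > 0" using \<rho> L by linarith
  have "open {w. U w < M + e}" using U by (simp add: log_subharmonic_def)
  moreover have "K \<subseteq> {w. U w < M + e}" using UK e by force
  ultimately obtain \<delta> where \<delta>: "\<delta> > 0" "{x. infdist x K \<le> \<delta>} \<subseteq> {w. U w < M + e}"
    using compact_in_open_separated[OF K(2,1)] by blast
  show "U z \<le> M + ln (L / \<rho>) + e"
  proof (cases "infdist z K \<le> \<delta>")
    case True
    moreover have "0 \<le> ln (L / \<rho>)" using L \<rho> by simp
    ultimately show ?thesis using \<delta>(2) by force
  next
    case False
    have "U z \<le> M + e + ln (L / \<rho>) + (ln (real k + 1) + (ln \<rho> - ln c - ln \<delta>)) / (real k + 1)" for k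
    proof -
      obtain F where F: "F \<subseteq> K" "finite F" "card F = Suc k"
        "\<And>w. w \<in> F \<Longrightarrow> c * \<rho> ^ k \<le> (\<Prod>y\<in>F - {w}. norm (w - y))"
        using F[of k] by blast
      define c0 where "c0 = c * \<rho> ^ k * \<delta> / card F"
      have c0: "c0 > 0" using c \<rho> \<delta> F by (simp add: c0_def)
      have ne: "F \<noteq> {}" using F by auto
      have P: "c0 \<le> (\<Prod>w\<in>F. norm (x - w))" if x: "\<delta> \<le> infdist x K" for x
        unfolding c0_def
      proof (rule prod_norm_diff_ge[OF F(2) ne _ \<delta>(1) F(4)])
        show "0 < c * \<rho> ^ k" using c \<rho> by simp
        show "\<delta> \<le> norm (x - w)" if "w \<in> F" for w
          using x infdist_le[of w K x] F(1) that by (auto simp: dist_norm)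
      qed
      have "U z \<le> M + e + ln ((\<Prod>w\<in>F. norm (z - w)) / c0) / card F"
      proof (rule log_subharmonic_le_log_prod[OF U K F(2) ne F(1) c0 \<delta>(1) _ P])
        show "U x \<le> M + e" if "infdist x K \<le> \<delta>" for x
          using \<delta>(2) that by (auto intro: less_imp_le)
      qed (use M e False in auto)
      also have "\<dots> \<le> M + e + ln (L ^ card F / c0) / card F"
      proof -
        have "(\<Prod>w\<in>F. norm (z - w)) \<le> (\<Prod>w\<in>F. L)" by (rule prod_mono) (use L F in auto)
        moreover have "0 < (\<Prod>w\<in>F. norm (z - w))" using P[of z] False c0 by linarith
        ultimately show ?thesis
          using c0 by (intro add_left_mono divide_right_mono ln_mono) (auto simp: divide_right_mono)
      qed
      \<comment> \<open>There are \<open>k + 1\<close> factors \<open>L\<close> but only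
        \<open>k\<close> factors \<open>\<rho>\<close> in \<open>c0\<close>. This mismatch, together
        with \<open>c\<close>, \<open>\<delta>\<close> and \<open>card F\<close>, leaves an error of
        order \<open>ln n / n\<close>.\<close>
      also have "ln (L ^ card F / c0) / card F
          = ln (L / \<rho>) + (ln (real k + 1) + (ln \<rho> - ln c - ln \<delta>)) / (real k + 1)"
      proof -
        define n where "n = real k + 1"
        have n: "n > 0" "real (card F) = n" "real k = n - 1" by (auto simp: n_def F(3))
        have "ln c0 = ln (c * \<rho> ^ k * \<delta>) - ln n"
          unfolding c0_def n(2) using c \<rho> \<delta> n(1) by (subst ln_div) auto
        also have "ln (c * \<rho> ^ k * \<delta>) = ln c + real k * ln \<rho> + ln \<delta>"
          using c \<rho> \<delta> by (simp add: ln_mult ln_realpow)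
        finally have "ln (L ^ card F / c0) = n * ln L - (ln c + (n - 1) * ln \<rho> + ln \<delta> - ln n)"
          using L0 c0 by (simp add: ln_div ln_realpow n)
        also have "\<dots> = n * (ln L - ln \<rho>) + (ln n + (ln \<rho> - ln c - ln \<delta>))"
          by (simp add: algebra_simps)
        also have "\<dots> / n = (ln L - ln \<rho>) + (ln n + (ln \<rho> - ln c - ln \<delta>)) / n"
          using n(1) by (simp add: add_divide_distrib)
        finally show ?thesis using L0 \<rho> by (simp add: n(2) ln_div flip: n_def)
      qed
      finally show ?thesis by simp
    qed
    moreover have "(\<lambda>k::nat. M + e + ln (L / \<rho>) + (ln (real k + 1) + (ln \<rho> - ln c - ln \<delta>)) / (real k + 1))
        \<longlonglongrightarrow> M + e + ln (L / \<rho>) + 0"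
      by (rule tendsto_add[OF tendsto_const]) real_asymp
    ultimately have "U z \<le> M + e + ln (L / \<rho>) + 0" by (intro LIMSEQ_le_const) auto
    then show ?thesis by simp
  qed
qed

section \<open>Sections of real lines\<close>

text \<open>Inner regularity by closed sets, which are compact here. It carries the estimates for
  compact sets over to Borel sections.\<close>

lemma emeasure_le_if_compact_le:
  fixes E :: "'a::euclidean_space set"
  assumes E: "E \<in> sets borel" "bounded E" and le: "\<And>K. compact K \<Longrightarrow> K \<subseteq> E \<Longrightarrow> emeasure lborel K \<le> c"
  shows "emeasure lborel E \<le> c"
proof (rule ennreal_le_epsilon)
  fix e :: real assume e: "e > 0"
  have "E \<in> sets lebesgue" using E by auto
  then obtain T where T: "closed T" "T \<subseteq> E" "E - T \<in> lmeasurable" "emeasure lebesgue (E - T) < ennreal e"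
    using sets_lebesgue_inner_closed[OF _ e] by metis
  have cT: "compact T" using T E bounded_subset compact_eq_bounded_closed by blast
  have "emeasure lborel E \<le> emeasure lborel T + emeasure lborel (E - T)"
    using T E by (metis Diff_partition emeasure_subadditive borel_closed sets.Diff sets_lborel)
  also have "emeasure lborel (E - T) \<le> ennreal e"
    using T E by (simp add: less_imp_le emeasure_completion)
  finally show "emeasure lborel E \<le> c + ennreal e"
    using le[OF cT T(2)] by (meson add_mono order_refl order_trans)
qed

lemma fmeasurable_bounded_borel:
  assumes "A \<in> sets borel" "bounded A"
  shows "A \<in> fmeasurable lborel"
  using assms emeasure_bounded_finite by (intro fmeasurableI) auto

text \<open>\<open>k ^ k / k!\<close> is one term of the exponential series at
  \<open>k\<close>.\<close>

lemma fact_ge_power_exp: "(real k / exp 1) ^ k \<le> fact k"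
proof -
  have "real k ^ k / fact k \<le> exp (real k)"
  proof -
    have s: "(\<lambda>n. real k ^ n / fact n) sums exp (real k)"
      using exp_converges[of "real k"] by (simp add: divide_inverse mult.commute)
    have "(\<Sum>n\<in>{k}. real k ^ n / fact n) \<le> (\<Sum>n. real k ^ n / fact n)"
      by (rule sum_le_suminf) (use s in \<open>auto intro: sums_summable\<close>)
    then show ?thesis using s by (simp add: sums_iff)
  qed
  then show ?thesis by (simp add: power_divide field_simps flip: exp_of_nat_mult)
qed

lemma prod_abs_diff_nat:
  assumes "i \<le> (k::nat)"
  shows "(\<Prod>j\<in>{..k} - {i}. \<bar>real i - real j\<bar>) = fact i * fact (k - i)"
proof -
  have s: "{..k} - {i} = {..<i} \<union> {i<..k}" using assms by auto
  have a: "(\<Prod>j\<in>{..<i}. \<bar>real i - real j\<bar>) = fact i"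
  proof -
    have "(\<Prod>j\<in>{..<i}. \<bar>real i - real j\<bar>) = (\<Prod>j\<in>{1..i}. real j)"
      by (rule prod.reindex_bij_witness[of _ "\<lambda>j. i - j" "\<lambda>j. i - j"]) auto
    then show ?thesis by (simp add: fact_prod)
  qed
  have b: "(\<Prod>j\<in>{i<..k}. \<bar>real i - real j\<bar>) = fact (k - i)"
  proof -
    have "(\<Prod>j\<in>{i<..k}. \<bar>real i - real j\<bar>) = (\<Prod>j\<in>{1..k-i}. real j)"
      by (rule prod.reindex_bij_witness[of _ "\<lambda>j. j + i" "\<lambda>j. j - i"]) auto
    then show ?thesis by (simp add: fact_prod)
  qed
  show ?thesis unfolding s by (subst prod.union_disjoint) (simp, simp, force, simp only: a b)
qed

text \<open>The product is \<open>k!\<close> divided by the binomial coefficient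
  \<open>k choose i\<close>. The bounds \<open>(k / e) ^ k\<close> for the former and
  \<open>2 ^ k\<close> for the latter are the origin of the constant \<open>2 * e\<close>.\<close>

lemma prod_abs_diff_nat_ge:
  assumes "i \<le> (k::nat)"
  shows "(real k / (2 * exp 1)) ^ k \<le> (\<Prod>j\<in>{..k} - {i}. \<bar>real i - real j\<bar>)"
proof -
  have "fact k = real (k choose i) * (fact i * fact (k - i))"
    using binomial_fact[OF assms, where ?'a = real] by (simp add: field_simps)
  also have "real (k choose i) \<le> 2 ^ k"
    using binomial_le_pow2[of k i] by (metis of_nat_le_iff of_nat_numeral of_nat_power)
  then have "real (k choose i) * (fact i * fact (k - i)) \<le> 2 ^ k * (fact i * fact (k - i))"
    by (intro mult_right_mono) auto
  finally have "(real k / exp 1) ^ k \<le> 2 ^ k * (fact i * fact (k - i))"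
    using fact_ge_power_exp[of k] by linarith
  then show ?thesis unfolding prod_abs_diff_nat[OF assms]
    by (simp add: power_divide power_mult_distrib field_simps)
qed

section \<open>Quantile points of a compact subset of the real line\<close>

lemma measure_Int_atMost_lipschitz:
  fixes E :: "real set"
  assumes E: "compact E"
  shows "\<bar>measure lborel (E \<inter> {..x}) - measure lborel (E \<inter> {..y})\<bar> \<le> \<bar>x - y\<bar>"
proof (induction x y rule: linorder_wlog)
  case (le x y)
  have fin: "E \<inter> {..x} \<in> fmeasurable lborel" for x
    by (rule fmeasurable_compact) (use E in \<open>auto intro: compact_Int_closed\<close>)
  have "measure lborel (E \<inter> {..x}) \<le> measure lborel (E \<inter> {..y})"
    using le by (intro measure_mono_fmeasurable fin) (auto intro: borel_compact E)
  moreover have "measure lborel (E \<inter> {..y}) \<le> measure lborel ((E \<inter> {..x}) \<union> {x<..y})"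
    using E by (intro measure_mono_fmeasurable fmeasurable.Un fin)
      (auto intro: borel_compact fmeasurable_bounded_borel)
  moreover have "measure lborel ((E \<inter> {..x}) \<union> {x<..y}) \<le> measure lborel (E \<inter> {..x}) + measure lborel {x<..y}"
    using E by (intro measure_Un_le) (auto intro: borel_compact)
  ultimately show ?case using le by simp
next
  case (sym x y)
  then show ?case by (simp add: abs_minus_commute)
qed

text \<open>The intermediate value theorem yields a point \<open>x\<close> that may lie outside
  \<open>E\<close>. Replacing it by the largest point of \<open>E\<close> below it changes nothing;
  if there is none, then \<open>t = 0\<close> and the least point of \<open>E\<close> will
  do.\<close>

lemma compact_real_quantile:
  fixes E :: "real set"
  assumes E: "compact E" "E \<noteq> {}" and t: "0 \<le> t" "t \<le> measure lborel E"
  shows "\<exists>w\<in>E. measure lborel (E \<inter> {..w}) = t"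
proof -
  define \<phi> where "\<phi> x = measure lborel (E \<inter> {..x})" for x
  obtain b where b: "\<And>x. x \<in> E \<Longrightarrow> \<bar>x\<bar> \<le> b" using compact_imp_bounded[OF E(1)] by (auto simp: bounded_iff)
  have b0: "b \<ge> 0" using E(2) b by fastforce
  have cont: "continuous_on {-b-1..b} \<phi>"
  proof (rule lipschitz_on_continuous_on[of 1], rule lipschitz_onI)
    fix x y show "dist (\<phi> x) (\<phi> y) \<le> 1 * dist x y"
      using measure_Int_atMost_lipschitz[OF E(1), of x y] by (simp add: \<phi>_def dist_real_def)
  qed simp
  have "E \<inter> {..-b-1} = {}" "E \<inter> {..b} = E" using b b0 by (force simp: abs_le_iff)+
  then have "\<phi> (-b-1) = 0" "\<phi> b = measure lborel E" by (simp_all only: \<phi>_def measure_empty)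
  then obtain x where x: "\<phi> x = t" using IVT'[of \<phi> "-b-1" t b] cont t b0 by auto
  show ?thesis
  proof (cases "E \<inter> {..x} = {}")
    case True
    then have t0: "t = 0" using x by (simp add: \<phi>_def)
    obtain w where w: "w \<in> E" "\<forall>y\<in>E. w \<le> y" using compact_attains_inf[OF E] by blast
    then have "E \<inter> {..w} = {w}" by (auto intro: antisym)
    then show ?thesis using w t0 by (intro bexI[of _ w]) auto
  next
    case False
    have "compact (E \<inter> {..x})" using E by (intro compact_Int_closed) auto
    then obtain w where w: "w \<in> E \<inter> {..x}" "\<forall>y\<in>E \<inter> {..x}. y \<le> w"
      using compact_attains_sup[OF _ False] by blast
    then have "E \<inter> {..w} = E \<inter> {..x}" by auto
    then show ?thesis using w x by (intro bexI[of _ w]) (auto simp: \<phi>_def)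
  qed
qed

text \<open>The distribution function of \<open>E\<close> is 1-Lipschitz, so the points where it
  takes the values \<open>j * s / k\<close> are at least as far apart as equally spaced points with
  step \<open>s / k\<close>.\<close>

lemma compact_real_separated:
  fixes E :: "real set"
  assumes E: "compact E" "measure lborel E > 0"
  shows "\<exists>F\<subseteq>E. finite F \<and> card F = Suc k \<and>
    (\<forall>w\<in>F. (measure lborel E / (2 * exp 1)) ^ k \<le> (\<Prod>y\<in>F - {w}. \<bar>w - y\<bar>))"
proof -
  define s where "s = measure lborel E"
  have s: "s > 0" using E by (simp add: s_def)
  have ne: "E \<noteq> {}" using E(2) by auto
  show ?thesis
  proof (cases "k = 0")
    case True
    obtain x where "x \<in> E" using ne by auto
    then show ?thesis using True by (intro exI[of _ "{x}"]) auto
  next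
    case False
    have "\<exists>w\<in>E. measure lborel (E \<inter> {..w}) = real j * s / k" if "j \<le> k" for j
    proof (rule compact_real_quantile[OF E(1) ne])
      have "real j * s \<le> real k * s" using that s by (intro mult_right_mono) auto
      then show "real j * s / k \<le> measure lborel E" using False by (simp add: field_simps flip: s_def)
    qed (use s in simp)
    then obtain w where w: "\<And>j. j \<le> k \<Longrightarrow> w j \<in> E" "\<And>j. j \<le> k \<Longrightarrow> measure lborel (E \<inter> {..w j}) = real j * s / k"
      by metis
    have gap: "\<bar>real i - real j\<bar> * (s / k) \<le> \<bar>w i - w j\<bar>" if "i \<le> k" "j \<le> k" for i j
    proof -
      have "\<bar>real i - real j\<bar> * (s / k) = \<bar>real i * s / k - real j * s / k\<bar>"
        using s False by (simp add: abs_mult abs_divide flip: diff_divide_distrib left_diff_distrib)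
      then show ?thesis using measure_Int_atMost_lipschitz[OF E(1), of "w i" "w j"] w(2) that by simp
    qed
    have inj: "inj_on w {..k}"
    proof (rule inj_onI)
      fix i j assume ij: "i \<in> {..k}" "j \<in> {..k}" "w i = w j"
      then have "\<bar>real i - real j\<bar> * (s / k) \<le> 0" using gap[of i j] by simp
      then have "\<bar>real i - real j\<bar> \<le> 0" using s False by (simp add: mult_le_0_iff divide_le_0_iff)
      then show "i = j" by simp
    qed
    have "(s / (2 * exp 1)) ^ k \<le> (\<Prod>y\<in>w ` {..k} - {w i}. \<bar>w i - y\<bar>)" if i: "i \<le> k" for i
    proof -
      have "(s / (2 * exp 1)) ^ k = (real k / (2 * exp 1)) ^ k * (s / k) ^ k"
        using False by (simp add: power_mult_distrib[symmetric])
      also have "\<dots> \<le> (\<Prod>j\<in>{..k} - {i}. \<bar>real i - real j\<bar>) * (s / k) ^ k"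
        using s by (intro mult_right_mono prod_abs_diff_nat_ge i) auto
      also have "\<dots> = (\<Prod>j\<in>{..k} - {i}. \<bar>real i - real j\<bar> * (s / k))"
        unfolding prod.distrib using i by (simp add: card_Diff_singleton)
      also have "\<dots> \<le> (\<Prod>j\<in>{..k} - {i}. \<bar>w i - w j\<bar>)"
        using gap i s by (intro prod_mono) auto
      also have "\<dots> = (\<Prod>y\<in>w ` ({..k} - {i}). \<bar>w i - y\<bar>)"
        by (subst prod.reindex) (auto intro: inj_on_subset[OF inj])
      also have "w ` ({..k} - {i}) = w ` {..k} - {w i}"
        using inj_on_image_set_diff[OF inj, of "{..k}" "{i}"] i by auto
      finally show ?thesis .
    qed
    moreover have "card (w ` {..k}) = Suc k" using card_image[OF inj] by simp
    ultimately show ?thesis using w(1) unfolding s_def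
      by (intro exI[of _ "w ` {..k}"]) auto
  qed
qed

text \<open>The majorant with \<open>\<rho> = s / (2 * e)\<close> is solved for the measure
  \<open>s\<close>. That \<open>z\<close> may lie off the real axis is essential for the bound on a
  full disc in \<open>log_subharmonic_le_off_segment\<close>.\<close>

lemma emeasure_real_section_le:
  assumes U: "log_subharmonic U" and E: "E \<in> sets borel" and L: "L \<ge> 0"
    and UE: "\<And>t. t \<in> E \<Longrightarrow> U (of_real t) \<le> M" and dist: "\<And>t. t \<in> E \<Longrightarrow> norm (z - of_real t) \<le> L"
  shows "emeasure lborel E \<le> ennreal (2 * exp 1 * L * exp (M - U z))"
proof (rule emeasure_le_if_compact_le[OF E])
  have sub: "E \<subseteq> {Re z - L..Re z + L}"
  proof
    fix t assume "t \<in> E"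
    from dist[OF this] have "\<bar>Re z - t\<bar> \<le> L" using abs_Re_le_cmod[of "z - of_real t"] by simp
    then show "t \<in> {Re z - L..Re z + L}" by auto
  qed
  then show "bounded E" using bounded_closed_interval bounded_subset by blast
  fix K assume K: "compact K" "K \<subseteq> E"
  have fin: "K \<in> fmeasurable lborel" by (rule fmeasurable_compact[OF K(1)])
  define s where "s = measure lborel K"
  have eq: "emeasure lborel K = ennreal s"
    using fin by (simp add: s_def emeasure_eq_measure2)
  show "emeasure lborel K \<le> ennreal (2 * exp 1 * L * exp (M - U z))"
  proof (cases "s > 0")
    case False
    then show ?thesis by (simp add: eq ennreal_neg)
  next
    case True
    define \<rho> where "\<rho> = s / (2 * exp 1)"
    have \<rho>: "\<rho> > 0" using True by (simp add: \<rho>_def)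
    have "s \<le> measure lborel {Re z - L..Re z + L}"
      unfolding s_def using K sub by (intro measure_mono_fmeasurable fmeasurable_bounded_borel) (auto intro: borel_compact)
    then have "s \<le> 2 * L" using L by simp
    moreover have "2 * L \<le> 2 * L * exp 1" using L mult_left_mono[of 1 "exp 1 :: real" "2 * L"] by simp
    ultimately have \<rho>L: "\<rho> \<le> L" by (simp add: \<rho>_def field_simps)
    have "U z \<le> M + ln (L / \<rho>)"
    proof (rule log_subharmonic_le_transfinite[OF U, of "of_real ` K" 1])
      show "compact (of_real ` K :: complex set)" using K(1) by (intro compact_continuous_image continuous_intros)
      show "of_real ` K \<noteq> ({} :: complex set)" using True by (auto simp: s_def)
      fix k
      obtain F where F: "F \<subseteq> K" "finite F" "card F = Suc k" "\<And>w. w \<in> F \<Longrightarrow> \<rho> ^ k \<le> (\<Prod>y\<in>F - {w}. \<bar>w - y\<bar>)"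
        using compact_real_separated[OF K(1), of k] True unfolding \<rho>_def s_def by blast
      have "1 * \<rho> ^ k \<le> (\<Prod>y\<in>of_real ` F - {of_real w}. norm (of_real w - y :: complex))" if "w \<in> F" for w
      proof -
        have "of_real ` F - {of_real w} = (of_real ` (F - {w}) :: complex set)" by auto
        then have "(\<Prod>y\<in>of_real ` F - {of_real w}. norm (of_real w - y :: complex)) = (\<Prod>y\<in>F - {w}. \<bar>w - y\<bar>)"
          by (simp add: prod.reindex inj_on_def norm_of_real flip: of_real_diff)
        then show ?thesis using F(4)[OF that] by simp
      qed
      then show "\<exists>F\<subseteq>of_real ` K. finite F \<and> card F = Suc k \<and>
          (\<forall>w\<in>F. 1 * \<rho> ^ k \<le> (\<Prod>y\<in>F - {w}. norm (w - y :: complex)))"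
        using F by (intro exI[of _ "of_real ` F"]) (auto simp: card_image inj_on_def)
    qed (use UE dist K \<rho> \<rho>L in auto)
    then have "exp (U z - M) \<le> L / \<rho>"
      using \<rho> \<rho>L by (metis diff_le_eq add.commute divide_pos_pos exp_le_cancel_iff exp_ln order_less_le_trans)
    then have "exp (U z - M) * s \<le> 2 * exp 1 * L" using True by (simp add: \<rho>_def field_simps)
    then have "s \<le> 2 * exp 1 * L * exp (M - U z)" by (simp add: exp_diff field_simps)
    then show ?thesis unfolding eq by (rule ennreal_leI)
  qed
qed

section \<open>The Ahlfors-Beurling estimate and sections of complex lines\<close>

text \<open>Layer-cake integration over the level \<open>t\<close>: the superlevel set has area at
  most \<open>A\<close>, and at most that of a disc of radius \<open>1 / (2 * t)\<close>. The first
  bound is used below the level \<open>c\<close>, the second above it.\<close>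

lemma nn_integral_inverse_part_le:
  fixes K :: "complex set"
  assumes K: "K \<in> sets borel" "emeasure lborel K = ennreal A" "A \<ge> 0" and \<omega>: "norm \<omega> = 1" and c: "c > 0"
  shows "(\<integral>\<^sup>+w\<in>K. ennreal (Re (\<omega> / (z - w))) \<partial>lborel) \<le> ennreal (c * A + pi / (4 * c))"
proof -
  note [measurable] = K(1)
  let ?g = "\<lambda>w. Re (\<omega> / (z - w))"
  let ?A = "{p. fst p \<in> K \<and> 0 < snd p \<and> snd p < ?g (fst p)}"
  have sub: "{w. t < ?g w} \<subseteq> ball (z - \<omega> / of_real (2 * t)) (1 / (2 * t))" if t: "t > 0" for t
  proof
    fix w assume "w \<in> {w. t < ?g w}"
    then have g: "t < Re (\<omega> / (z - w))" by simp
    define v where "v = z - w"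
    have v: "v \<noteq> 0" using g t by (auto simp: v_def)
    have "Re (\<omega> / v) = Re (\<omega> * cnj v) / (norm v)\<^sup>2"
      by (subst complex_div_cnj) (simp only: of_real_power[symmetric] Re_divide_of_real)
    moreover have "(norm v)\<^sup>2 > 0" using v by simp
    ultimately have *: "t * (norm v)\<^sup>2 < Re (\<omega> * cnj v)" using g by (simp add: v_def pos_less_divide_eq)
    have expand: "(norm (v - of_real s * \<omega>))\<^sup>2 = (norm v)\<^sup>2 - 2 * s * Re (\<omega> * cnj v) + s\<^sup>2 * (norm \<omega>)\<^sup>2" for s
      unfolding cmod_power2 by (simp add: power2_eq_square algebra_simps)
    define s where "s = 1 / (2 * t)"
    have s: "s > 0" "2 * s * t = 1" using t by (auto simp: s_def)
    have "2 * s * (t * (norm v)\<^sup>2) < 2 * s * Re (\<omega> * cnj v)" using * s by (intro mult_strict_left_mono) auto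
    moreover have "2 * s * (t * (norm v)\<^sup>2) = (norm v)\<^sup>2" using s(2) by (metis mult.assoc mult_1)
    ultimately have "(norm (v - of_real s * \<omega>))\<^sup>2 < s\<^sup>2" unfolding expand \<omega> by simp
    then have "norm (v - of_real s * \<omega>) < s" using s(1) by (simp add: power2_less_imp_less)
    moreover have "of_real s * \<omega> = \<omega> / of_real (2 * t)" by (simp add: s_def)
    ultimately have "norm (v - \<omega> / of_real (2 * t)) < 1 / (2 * t)" by (simp add: s_def)
    then show "w \<in> ball (z - \<omega> / of_real (2 * t)) (1 / (2 * t))"
      by (simp add: dist_norm v_def algebra_simps)
  qed
  have disc: "emeasure lborel (K \<inter> {w. t < ?g w}) \<le> ennreal (pi / (4 * t\<^sup>2))" if t: "t > 0" for t
  proof -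
    have "emeasure lborel (K \<inter> {w. t < ?g w}) \<le> emeasure lborel (ball (z - \<omega> / of_real (2 * t)) (1 / (2 * t)))"
      using sub[OF t] by (intro emeasure_mono) auto
    also have "\<dots> = ennreal (pi / (4 * t\<^sup>2))"
      using t by (simp add: emeasure_ball unit_ball_vol_2 power_divide power_mult_distrib flip: ennreal_mult')
    finally show ?thesis .
  qed
  have "(\<integral>\<^sup>+w\<in>K. ennreal (?g w) \<partial>lborel)
      = (\<integral>\<^sup>+w. \<integral>\<^sup>+t. indicator ?A (w, t) \<partial>lborel \<partial>lborel)"
  proof (rule nn_integral_cong)
    fix w :: complex
    have "(\<integral>\<^sup>+t. indicator ?A (w, t) \<partial>lborel)
        = (\<integral>\<^sup>+t. indicator K w * indicator {0<..<?g w} t \<partial>lborel)"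
      by (rule nn_integral_cong) (auto simp: indicator_def)
    also have "\<dots> = indicator K w * emeasure lborel {0<..<?g w}"
      by (subst nn_integral_cmult) auto
    also have "\<dots> = ennreal (?g w) * indicator K w"
      by (cases "0 \<le> ?g w") (simp_all add: mult.commute ennreal_neg)
    finally show "ennreal (?g w) * indicator K w
        = (\<integral>\<^sup>+t. indicator ?A (w, t) \<partial>lborel)" by simp
  qed
  also have "\<dots> = (\<integral>\<^sup>+t. \<integral>\<^sup>+w. indicator ?A (w, t) \<partial>lborel \<partial>lborel)"
    by (rule lborel_pair.Fubini'[symmetric]) measurable
  also have "\<dots> \<le> (\<integral>\<^sup>+t. ennreal A * indicator {0..c} t + ennreal (pi / (4 * t\<^sup>2)) * indicator {c..} t \<partial>lborel)"
  proof (rule nn_integral_mono)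
    fix t :: real
    have "(\<integral>\<^sup>+w. indicator ?A (w, t) \<partial>lborel)
        = (\<integral>\<^sup>+w. indicator {0<..} t * indicator (K \<inter> {w. t < ?g w}) w \<partial>lborel)"
      by (rule nn_integral_cong) (auto simp: indicator_def)
    also have "\<dots> = indicator {0<..} t * emeasure lborel (K \<inter> {w. t < ?g w})"
      by (subst nn_integral_cmult) auto
    also have "\<dots> \<le> ennreal A * indicator {0..c} t + ennreal (pi / (4 * t\<^sup>2)) * indicator {c..} t"
    proof (cases "t \<le> c")
      case True
      have "emeasure lborel (K \<inter> {w. t < ?g w}) \<le> ennreal A"
        unfolding K(2)[symmetric] by (intro emeasure_mono) auto
      then show ?thesis using True by (auto simp: indicator_def intro: add_increasing2)
    next
      case False
      then show ?thesis using disc[of t] c by (auto simp: indicator_def)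
    qed
    finally show "(\<integral>\<^sup>+w. indicator ?A (w, t) \<partial>lborel)
      \<le> ennreal A * indicator {0..c} t + ennreal (pi / (4 * t\<^sup>2)) * indicator {c..} t" .
  qed
  also have "\<dots> = ennreal A * ennreal c + ennreal (pi / (4 * c))"
  proof -
    have "(\<integral>\<^sup>+t. ennreal (pi / (4 * t\<^sup>2)) * indicator {c..} t \<partial>lborel) = ennreal (0 - (- (pi / (4 * c))))"
    proof (rule nn_integral_FTC_atLeast)
      show "DERIV (\<lambda>t. - (pi / (4 * t))) t :> pi / (4 * t\<^sup>2)" if "c \<le> t" for t
        using that c by (auto intro!: derivative_eq_intros simp: power2_eq_square field_simps)
      show "((\<lambda>t. - (pi / (4 * t))) \<longlongrightarrow> 0) at_top" by real_asymp
    qed auto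
    then show ?thesis using c
      by (subst nn_integral_add) (auto simp: nn_integral_cmult)
  qed
  also have "\<dots> = ennreal (c * A + pi / (4 * c))"
    using K c by (simp add: ennreal_plus ennreal_mult mult.commute)
  finally show ?thesis .
qed

section \<open>The Cauchy transform of a compact planar set\<close>

definition cauchy_transform :: "complex set \<Rightarrow> complex \<Rightarrow> complex" where
  "cauchy_transform K z = (LINT w:K|lborel. 1 / (z - w))"

lemma set_integrable_cauchy_kernel:
  assumes "compact K" "z \<notin> K"
  shows "set_integrable lborel K (\<lambda>w. (c::complex) / (z - w))"
  unfolding set_integrable_def using assms
  by (intro borel_integrable_compact continuous_intros) auto

text \<open>Bathtub principle: the superlevel sets of
  \<open>w \<mapsto> Re (\<omega> / (z - w))\<close> are discs.\<close>
lemma norm_cauchy_transform_le: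
  assumes K: "compact K" "measure lborel K = A" and z: "z \<notin> K"
  shows "norm (cauchy_transform K z) \<le> sqrt (pi * A)"
proof (cases "A = 0")
  case True
  have "emeasure lborel K = 0"
    using K True fmeasurable_compact[OF K(1)] by (simp add: emeasure_eq_measure2)
  then have "AE w in lborel. indicator K w *\<^sub>R (1 / (z - w)) = 0"
    using K by (intro AE_I[of _ _ K]) (auto simp: borel_compact indicator_def)
  then show ?thesis unfolding cauchy_transform_def set_lebesgue_integral_def
    using integral_cong_AE[of "\<lambda>w. indicator K w *\<^sub>R (1 / (z - w))" lborel "\<lambda>_. 0"]
      set_integrable_cauchy_kernel[OF K(1) z, of 1] True
    by (simp add: set_integrable_def borel_measurable_integrable)
next
  case False
  let ?f = "cauchy_transform K z"
  have A: "A > 0" using False K(2) by (metis measure_nonneg order_le_less)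
  obtain \<omega> where \<omega>: "norm \<omega> = 1" "\<omega> * ?f = of_real (norm ?f)"
  proof (cases "?f = 0")
    case True then show ?thesis using that[of 1] by simp
  next
    case False
    then show ?thesis using that[of "of_real (norm ?f) / ?f"] by (simp add: norm_divide)
  qed
  \<comment> \<open>This level minimizes \<open>c * A + pi / (4 * c)\<close>; both terms become half
    of \<open>sqrt (pi * A)\<close>.\<close>
  define c where "c = sqrt (pi / A) / 2"
  have c: "c > 0" using A by (simp add: c_def)
  have int: "set_integrable lborel K (\<lambda>w. \<omega> / (z - w))" by (rule set_integrable_cauchy_kernel[OF K(1) z])
  have "norm ?f = Re (LINT w:K|lborel. \<omega> * (1 / (z - w)))"
    using \<omega>(2) by (metis Re_complex_of_real cauchy_transform_def set_integral_mult_right)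
  also have "\<dots> = (LINT w:K|lborel. Re (\<omega> / (z - w)))"
    using int unfolding set_lebesgue_integral_def set_integrable_def
    by (subst integral_Re[symmetric]) auto
  also have "\<dots> \<le> c * A + pi / (4 * c)"
  proof -
    have eA: "emeasure lborel K = ennreal A"
      using fmeasurable_compact[OF K(1)] K(2) by (simp add: emeasure_eq_measure2)
    have i: "integrable lborel (\<lambda>w. indicator K w * Re (\<omega> / (z - w)))"
      using integrable_Re[OF int[unfolded set_integrable_def]] by simp
    have "ennreal (LINT w:K|lborel. Re (\<omega> / (z - w))) \<le> (\<integral>\<^sup>+w. ennreal (indicator K w * Re (\<omega> / (z - w))) \<partial>lborel)"
    proof -
      have "(LINT w|lborel. indicator K w * Re (\<omega> / (z - w))) \<le> (LINT w|lborel. max 0 (indicator K w * Re (\<omega> / (z - w))))"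
        using i by (intro integral_mono integrable_max) auto
      moreover have "(\<integral>\<^sup>+w. ennreal (max 0 (indicator K w * Re (\<omega> / (z - w)))) \<partial>lborel)
          = ennreal (LINT w|lborel. max 0 (indicator K w * Re (\<omega> / (z - w))))"
        using i by (intro nn_integral_eq_integral integrable_max) auto
      ultimately show ?thesis unfolding set_lebesgue_integral_def by (simp add: ennreal_max_0 ennreal_leI)
    qed
    also have "\<dots> = (\<integral>\<^sup>+w\<in>K. ennreal (Re (\<omega> / (z - w))) \<partial>lborel)"
      by (intro nn_integral_cong) (auto simp: indicator_def)
    also have "\<dots> \<le> ennreal (c * A + pi / (4 * c))"
      by (rule nn_integral_inverse_part_le[OF _ eA _ \<omega>(1) c]) (use A K in \<open>auto intro: borel_compact\<close>)
    finally show ?thesis using A c by (subst (asm) ennreal_le_iff) auto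
  qed
  also have "\<dots> = sqrt (pi * A)"
  proof -
    have "c\<^sup>2 = pi / (4 * A)" using A by (simp add: c_def power_divide real_sqrt_pow2)
    then have "pi / (4 * c) = c * A" using c A by (simp add: field_simps power2_eq_square)
    moreover have "pi * A = pi / A * A\<^sup>2" using A by (simp add: power2_eq_square)
    then have "sqrt (pi * A) = sqrt (pi / A) * sqrt (A\<^sup>2)" by (simp only: real_sqrt_mult)
    then have "sqrt (pi * A) = sqrt (pi / A) * A" using A by (simp only: real_sqrt_abs abs_of_pos)
    ultimately show ?thesis by (simp add: c_def)
  qed
  finally show ?thesis .
qed

text \<open>Differentiation under the integral with an explicit remainder: the difference quotient
  of the kernel minus its derivative is \<open>h / ((z + h - w) * (z - w)\<^sup>2)\<close>. As
  \<open>d\<close> is half the distance from \<open>z\<close> to \<open>K\<close>, the point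
  \<open>z + h\<close> keeps distance \<open>d\<close>.\<close>

lemma cauchy_transform_has_derivative:
  assumes K: "compact K" and z: "z \<notin> K"
  shows "(cauchy_transform K has_field_derivative (LINT w:K|lborel. - 1 / (z - w)\<^sup>2)) (at z)"
proof (cases "K = {}")
  case True
  have "cauchy_transform {} = (\<lambda>_. 0)"
    by (simp add: cauchy_transform_def set_lebesgue_integral_def fun_eq_iff)
  with True show ?thesis by (simp add: set_lebesgue_integral_def)
next
  case False
  define d where "d = infdist z K / 2"
  have "infdist z K > 0"
    using in_closed_iff_infdist_zero[OF compact_imp_closed[OF K] False] z infdist_nonneg[of z K] by (simp add: order_less_le)
  then have d: "d > 0" by (simp add: d_def)
  define A where "A = measure lborel K"
  let ?D = "LINT w:K|lborel. - 1 / (z - w)\<^sup>2"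
  have far: "2 * d \<le> norm (z - w)" if "w \<in> K" for w
    using infdist_le[OF that, of z] by (simp add: d_def dist_norm)
  have intD: "set_integrable lborel K (\<lambda>w. - 1 / (z - w)\<^sup>2)"
    unfolding set_integrable_def using K z by (intro borel_integrable_compact continuous_intros) auto
  have est: "norm ((cauchy_transform K (z + h) - cauchy_transform K z) / h - ?D) \<le> norm h * (A / d ^ 3)"
    if h: "h \<noteq> 0" "norm h < d" for h
  proof -
    have far2: "d \<le> norm (z + h - w)" if "w \<in> K" for w
      using far[OF that] norm_triangle_ineq4[of "z + h - w" h] h by simp
    then have zh: "z + h \<notin> K" using d by force
    have i1: "set_integrable lborel K (\<lambda>w. 1 / (z + h - w))"
      and i2: "set_integrable lborel K (\<lambda>w. 1 / (z - w))"
      using set_integrable_cauchy_kernel[OF K] z zh by auto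
    have i3: "set_integrable lborel K (\<lambda>w. (1 / (z + h - w) - 1 / (z - w)) / h - (- 1 / (z - w)\<^sup>2))"
      by (intro set_integral_diff intD set_integrable_divide) (use i1 i2 in auto)
    have "(cauchy_transform K (z + h) - cauchy_transform K z) / h - ?D
        = (LINT w:K|lborel. (1 / (z + h - w) - 1 / (z - w)) / h - (- 1 / (z - w)\<^sup>2))"
    proof -
      have "(LINT w:K|lborel. (1 / (z + h - w) - 1 / (z - w)) / h - (- 1 / (z - w)\<^sup>2))
          = (LINT w:K|lborel. (1 / (z + h - w) - 1 / (z - w)) / h) - ?D"
        by (rule set_integral_diff(2)[OF set_integrable_divide intD]) (use i1 i2 in auto)
      also have "(LINT w:K|lborel. (1 / (z + h - w) - 1 / (z - w)) / h)
          = (LINT w:K|lborel. 1 / (z + h - w) - 1 / (z - w)) / h"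
        by (rule set_integral_divide_zero)
      also have "(LINT w:K|lborel. 1 / (z + h - w) - 1 / (z - w)) = cauchy_transform K (z + h) - cauchy_transform K z"
        unfolding cauchy_transform_def by (rule set_integral_diff(2)[OF i1 i2])
      finally show ?thesis by simp
    qed
    also have "norm \<dots> \<le> (LINT w:K|lborel. norm h / d ^ 3)"
      unfolding set_lebesgue_integral_def
    proof (rule order_trans[OF integral_norm_bound integral_mono])
      show "integrable lborel (\<lambda>w. norm (indicator K w *\<^sub>R ((1 / (z + h - w) - 1 / (z - w)) / h - (- 1 / (z - w)\<^sup>2))))"
        using i3 unfolding set_integrable_def by (rule integrable_norm)
      show "integrable lborel (\<lambda>w. indicator K w *\<^sub>R (norm h / d ^ 3))"
        by (rule borel_integrable_compact[OF K]) auto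
      fix w
      show "norm (indicator K w *\<^sub>R ((1 / (z + h - w) - 1 / (z - w)) / h - (- 1 / (z - w)\<^sup>2)))
          \<le> indicator K w *\<^sub>R (norm h / d ^ 3)"
      proof (cases "w \<in> K")
        case True
        have nz: "z - w \<noteq> 0" "z + h - w \<noteq> 0" using far[OF True] far2[OF True] d by auto
        have "(1 / (z + h - w) - 1 / (z - w)) / h - (- 1 / (z - w)\<^sup>2) = h / ((z + h - w) * (z - w)\<^sup>2)"
          using nz h(1) by (simp add: divide_simps) (simp add: algebra_simps power2_eq_square)
        also have "norm \<dots> = norm h / (norm (z + h - w) * (norm (z - w))\<^sup>2)"
          by (simp add: norm_divide norm_mult norm_power)
        also have "\<dots> \<le> norm h / (d * d\<^sup>2)"
        proof (intro divide_left_mono mult_mono power_mono)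
          show "d \<le> norm (z - w)" using far[OF True] d by linarith
        qed (use far2[OF True] d nz in auto)
        finally show ?thesis using True by (simp add: power3_eq_cube power2_eq_square)
      qed simp
    qed
    also have "\<dots> = norm h * (A / d ^ 3)"
      using K d by (simp add: A_def set_lebesgue_integral_def borel_compact)
    finally show ?thesis .
  qed
  have "((\<lambda>h. (cauchy_transform K (z + h) - cauchy_transform K z) / h - ?D) \<longlongrightarrow> 0) (at 0)"
  proof (rule Lim_null_comparison)
    show "\<forall>\<^sub>F h in at 0. norm ((cauchy_transform K (z + h) - cauchy_transform K z) / h - ?D) \<le> norm h * (A / d ^ 3)"
      using est d by (auto simp: eventually_at intro!: exI[of _ d])
    show "((\<lambda>h. norm h * (A / d ^ 3)) \<longlongrightarrow> 0) (at 0)" using d by (auto intro!: tendsto_eq_intros)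
  qed
  then show ?thesis unfolding DERIV_def by (simp add: LIM_zero_iff)
qed

lemma cauchy_transform_at_infinity:
  assumes K: "compact K"
  shows "((\<lambda>z. z * cauchy_transform K z) \<longlongrightarrow> of_real (measure lborel K)) at_infinity"
proof -
  define A where "A = measure lborel K"
  obtain B where B: "B > 0" "\<And>x. x \<in> K \<Longrightarrow> norm x \<le> B"
    using compact_imp_bounded[OF K] by (auto simp: bounded_pos)
  have est: "norm (z * cauchy_transform K z - of_real A) \<le> B / (norm z - B) * A" if z: "norm z > B" for z
  proof -
    have zK: "z \<notin> K" using B(2)[of z] z by force
    have "z * cauchy_transform K z - of_real A = (LINT w:K|lborel. z * (1 / (z - w))) - (LINT w:K|lborel. 1)"
    proof -
      have "(LINT w:K|lborel. 1) = complex_of_real A"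
        using K by (simp add: A_def set_lebesgue_integral_def borel_compact scaleR_conv_of_real integral_complex_of_real)
      then show ?thesis unfolding cauchy_transform_def set_integral_mult_right by simp
    qed
    also have "\<dots> = (LINT w:K|lborel. z * (1 / (z - w)) - 1)"
      using set_integrable_cauchy_kernel[OF K zK, of z]
      by (subst set_integral_diff) (auto simp: set_integrable_def intro!: borel_integrable_compact[OF K])
    also have "norm \<dots> \<le> (LINT w:K|lborel. B / (norm z - B))"
      unfolding set_lebesgue_integral_def
    proof (rule order_trans[OF integral_norm_bound integral_mono])
      show "integrable lborel (\<lambda>w. norm (indicator K w *\<^sub>R (z * (1 / (z - w)) - 1)))"
        using zK by (intro integrable_norm borel_integrable_compact[OF K] continuous_intros) auto
      show "integrable lborel (\<lambda>w. indicator K w *\<^sub>R (B / (norm z - B)))"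
        by (rule borel_integrable_compact[OF K]) auto
      fix w
      show "norm (indicator K w *\<^sub>R (z * (1 / (z - w)) - 1)) \<le> indicator K w *\<^sub>R (B / (norm z - B))"
      proof (cases "w \<in> K")
        case True
        then have "z - w \<noteq> 0" using zK by auto
        then have "z * (1 / (z - w)) - 1 = w / (z - w)" by (simp add: field_simps)
        moreover have "norm (w / (z - w)) \<le> B / (norm z - B)"
          unfolding norm_divide using B(2)[OF True] z norm_triangle_ineq2[of z w] B(1)
          by (intro frac_le) auto
        ultimately show ?thesis using True by simp
      qed simp
    qed
    also have "\<dots> = B / (norm z - B) * A"
      using K by (simp add: A_def set_lebesgue_integral_def borel_compact)
    finally show ?thesis .
  qed
  have "((\<lambda>z. z * cauchy_transform K z - of_real A) \<longlongrightarrow> 0) at_infinity"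
  proof (rule Lim_null_comparison)
    show "\<forall>\<^sub>F z in at_infinity. norm (z * cauchy_transform K z - of_real A) \<le> B / (norm z - B) * A"
      unfolding eventually_at_infinity using est by (intro exI[of _ "B + 1"]) auto
    have "((\<lambda>x. B / (x - B) * A) \<longlongrightarrow> 0) at_top" by real_asymp
    then show "((\<lambda>z::complex. B / (norm z - B) * A) \<longlongrightarrow> 0) at_infinity"
      by (rule filterlim_compose) (rule filterlim_norm_at_top)
  qed
  then show ?thesis by (simp add: LIM_zero_iff A_def)
qed

text \<open>The transform behaves like area over \<open>z\<close>, so its power
  \<open>card H\<close> exactly compensates the growth of a monic polynomial of that degree. The
  limit is positive if the area is.\<close>

lemma prod_cauchy_transform_at_infinity:
  assumes K: "compact K" and H: "finite H"
  shows "((\<lambda>z. (\<Prod>y\<in>H. z - y) * cauchy_transform K z ^ card H)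
    \<longlongrightarrow> of_real (measure lborel K) ^ card H) at_infinity"
    and "(cauchy_transform K \<longlongrightarrow> 0) at_infinity"
proof -
  let ?f = "cauchy_transform K"
  have "((\<lambda>z. inverse z * (z * ?f z)) \<longlongrightarrow> 0 * of_real (measure lborel K)) at_infinity"
    by (intro tendsto_mult cauchy_transform_at_infinity[OF K] tendsto_inverse_0)
  moreover have "\<forall>\<^sub>F z in at_infinity. inverse z * (z * ?f z) = ?f z"
    unfolding eventually_at_infinity
  proof (intro exI[of _ 1] allI impI)
    fix z :: complex assume "1 \<le> norm z"
    then have "z \<noteq> 0" by auto
    then show "inverse z * (z * ?f z) = ?f z" by simp
  qed
  ultimately show f0: "(?f \<longlongrightarrow> 0) at_infinity" by (simp add: tendsto_cong)
  have "((\<lambda>z. \<Prod>y\<in>H. z * ?f z - y * ?f z) \<longlongrightarrow> (\<Prod>y\<in>H. of_real (measure lborel K) - y * 0)) at_infinity"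
    by (intro tendsto_prod tendsto_diff tendsto_mult tendsto_const cauchy_transform_at_infinity K f0)
  moreover have "(\<Prod>y\<in>H. z * ?f z - y * ?f z) = (\<Prod>y\<in>H. z - y) * ?f z ^ card H" for z
    unfolding left_diff_distrib[symmetric] by (simp add: prod.distrib)
  ultimately show "((\<lambda>z. (\<Prod>y\<in>H. z - y) * ?f z ^ card H) \<longlongrightarrow> of_real (measure lborel K) ^ card H) at_infinity"
    by simp
qed

text \<open>Let \<open>p\<close> be the polynomial and \<open>f\<close> the Cauchy transform. With
  \<open>A = pi * \<rho>\<^sup>2\<close> the Ahlfors-Beurling bound reads
  \<open>norm (f x) \<le> pi * \<rho>\<close>. If \<open>p\<close> were smaller than
  \<open>\<rho> ^ k\<close> on \<open>K\<close>, then \<open>q = p * f ^ k\<close> would be bounded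
  near \<open>K\<close> by some \<open>C < A ^ k\<close>, although it is holomorphic off
  \<open>K\<close> and tends to \<open>A ^ k\<close> at infinity.\<close>

lemma monic_polynomial_sup_ge:
  fixes K :: "complex set"
  assumes K: "compact K" "measure lborel K = A" "A > 0" and H: "finite H"
  shows "\<exists>x\<in>K. sqrt (A / pi) ^ card H \<le> (\<Prod>y\<in>H. norm (x - y))"
proof (rule ccontr)
  assume neg: "\<not> ?thesis"
  let ?f = "cauchy_transform K"
  define k where "k = card H"
  define \<rho> where "\<rho> = sqrt (A / pi)"
  have \<rho>: "\<rho> > 0" "A = pi * \<rho>\<^sup>2" using K by (auto simp: \<rho>_def)
  have ne: "K \<noteq> {}" using K by auto
  define p where "p x = (\<Prod>y\<in>H. x - y)" for x :: complex
  have cp: "continuous_on S p" for S unfolding p_def by (intro continuous_intros)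
  have hp: "p holomorphic_on S" for S unfolding p_def by (intro holomorphic_intros)
  have small: "norm (p x) < \<rho> ^ k" if "x \<in> K" for x
    using neg that by (force simp: p_def prod_norm \<rho>_def k_def not_le)
  obtain x0 where x0: "x0 \<in> K" "\<And>x. x \<in> K \<Longrightarrow> norm (p x) \<le> norm (p x0)"
    using continuous_attains_sup[OF K(1) ne continuous_on_norm[OF cp]] by blast
  obtain b where b: "norm (p x0) < b" "b < \<rho> ^ k" using dense[OF small[OF x0(1)]] by blast
  have b0: "b > 0" using b(1) norm_ge_zero[of "p x0"] by linarith
  have "open {x. norm (p x) < b}" by (intro open_Collect_less continuous_intros cp)
  moreover have "K \<subseteq> {x. norm (p x) < b}" using x0 b by (auto intro: order_le_less_trans)
  ultimately obtain \<delta> where \<delta>: "\<delta> > 0" "{x. infdist x K \<le> \<delta>} \<subseteq> {x. norm (p x) < b}"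
    using compact_in_open_separated[OF ne K(1)] by blast
  have far: "x \<notin> K" if "\<delta> \<le> infdist x K" for x using that \<delta>(1) by auto
  have fle: "norm (?f x) \<le> pi * \<rho>" if "\<delta> \<le> infdist x K" for x
  proof -
    have "pi * A = (pi * \<rho>)\<^sup>2" by (simp add: \<rho>(2) power2_eq_square)
    then show ?thesis using norm_cauchy_transform_le[OF K(1,2) far[OF that]] \<rho> by simp
  qed
  have hf: "?f holomorphic_on S" if "S \<subseteq> {x. \<delta> \<le> infdist x K}" for S
    unfolding holomorphic_on_def
  proof
    fix x assume "x \<in> S"
    then have "x \<notin> K" using far that by auto
    then show "?f field_differentiable at x within S"
      using cauchy_transform_has_derivative[OF K(1)] field_differentiable_at_within
      unfolding field_differentiable_def by (blast intro: has_field_derivative_at_within)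
  qed
  define C where "C = b * (pi * \<rho>) ^ k"
  have C: "C > 0" using b0 \<rho> by (simp add: C_def)
  define q where "q x = p x * ?f x ^ k" for x
  have "C < A ^ k"
  proof -
    have "C < \<rho> ^ k * (pi * \<rho>) ^ k" unfolding C_def using b \<rho> by (intro mult_strict_right_mono) auto
    also have "\<dots> = A ^ k" by (simp add: \<rho>(2) power2_eq_square power_mult_distrib)
    finally show ?thesis .
  qed
  moreover have "(q \<longlongrightarrow> of_real A ^ k) at_infinity"
    unfolding q_def p_def k_def using prod_cauchy_transform_at_infinity(1)[OF K(1) H] K(2) by simp
  then have q: "((\<lambda>x. norm (q x)) \<longlongrightarrow> A ^ k) at_infinity"
    using tendsto_norm[of q "of_real A ^ k"] K(3) by (simp add: norm_power)
  ultimately have ev1: "\<forall>\<^sub>F x in at_infinity. C < norm (q x)"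
    by (intro order_tendstoD)
  have "((\<lambda>x. norm (x * ?f x)) \<longlongrightarrow> A) at_infinity"
    using tendsto_norm[OF cauchy_transform_at_infinity[OF K(1)]] K by simp
  then have "\<forall>\<^sub>F x in at_infinity. 0 < norm (x * ?f x)" using K(3) by (intro order_tendstoD)
  then have ev2: "\<forall>\<^sub>F x in at_infinity. ?f x \<noteq> 0" by eventually_elim auto
  obtain B where B: "\<And>x. x \<in> K \<Longrightarrow> norm x \<le> B" using compact_imp_bounded[OF K(1)] by (auto simp: bounded_iff)
  have ev3: "\<forall>\<^sub>F x in at_infinity. \<delta> < infdist x K"
    unfolding eventually_at_infinity
  proof (intro exI[of _ "B + \<delta> + 1"] allI impI)
    fix x :: complex assume x: "B + \<delta> + 1 \<le> norm x"
    have "\<delta> + 1 \<le> infdist x K" unfolding infdist_notempty[OF ne]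
    proof (rule cINF_greatest[OF ne])
      fix y assume "y \<in> K"
      then show "\<delta> + 1 \<le> dist x y" using B[of y] x norm_triangle_ineq2[of x y] by (simp add: dist_norm)
    qed
    then show "\<delta> < infdist x K" by simp
  qed
  obtain z where z: "C < norm (q z)" "?f z \<noteq> 0" "\<delta> < infdist z K"
    using eventually_happens[OF eventually_conj[OF ev1 eventually_conj[OF ev2 ev3]]]
      trivial_limit_at_infinity by blast
  have "1 < norm (q z) / C" using z C by simp
  then obtain N where N: "pi * \<rho> / norm (?f z) < (norm (q z) / C) ^ N"
    using real_arch_pow by blast
  \<comment> \<open>The extra factor makes \<open>g\<close> vanish at infinity, so the maximum
    modulus principle on a large bounded region suffices. A large \<open>N\<close> makes the excess
    of \<open>norm (q z)\<close> over \<open>C\<close> outweigh this factor.\<close>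
  define g where "g x = q x ^ N * ?f x" for x
  have gz: "C ^ N * (pi * \<rho>) < norm (g z)"
    using N z C by (simp add: g_def norm_mult norm_power power_divide field_simps)
  have "(g \<longlongrightarrow> (of_real A ^ k) ^ N * 0) at_infinity"
    unfolding g_def using \<open>(q \<longlongrightarrow> of_real A ^ k) at_infinity\<close>
    by (intro tendsto_mult tendsto_power prod_cauchy_transform_at_infinity(2)[OF K(1) H])
  then have "((\<lambda>x. norm (g x)) \<longlongrightarrow> 0) at_infinity" by (simp add: tendsto_norm_zero)
  moreover have "0 < C ^ N * (pi * \<rho>)" using C \<rho> by simp
  ultimately have "\<forall>\<^sub>F x in at_infinity. norm (g x) < C ^ N * (pi * \<rho>)" by (intro order_tendstoD)
  then obtain R0 where R0: "\<And>x. R0 \<le> norm x \<Longrightarrow> norm (g x) < C ^ N * (pi * \<rho>)"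
    unfolding eventually_at_infinity by blast
  define R where "R = max R0 (norm z + 1)"
  define S where "S = ball 0 R \<inter> {x. \<delta> < infdist x K}"
  have oS: "open S" unfolding S_def by (intro open_Int open_ball open_Collect_less continuous_intros)
  have "closed (cball 0 R \<inter> {x. \<delta> \<le> infdist x K})"
    by (intro closed_Int closed_cball closed_Collect_le continuous_intros)
  then have cS: "closure S \<subseteq> cball 0 R \<inter> {x. \<delta> \<le> infdist x K}"
    by (intro closure_minimal) (auto simp: S_def)
  have hg: "g holomorphic_on closure S"
    unfolding g_def q_def using cS by (intro holomorphic_intros hp hf) auto
  have "norm (g z) \<le> C ^ N * (pi * \<rho>)"
  proof (rule maximum_modulus_frontier[of g S])
    show "g holomorphic_on interior S"
      by (rule holomorphic_on_subset[OF hg subset_trans[OF interior_subset closure_subset]])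
    show "continuous_on (closure S) g" using hg by (rule holomorphic_on_imp_continuous_on)
    show "bounded S" unfolding S_def by (auto intro: bounded_Int)
    show "z \<in> S" using z by (simp add: S_def R_def)
    fix x assume "x \<in> frontier S"
    then have x: "x \<in> closure S" "x \<notin> S" using oS by (auto simp: frontier_def interior_open)
    have dx: "\<delta> \<le> infdist x K" using x cS by auto
    show "norm (g x) \<le> C ^ N * (pi * \<rho>)"
    proof (cases "R \<le> norm x")
      case True
      then show ?thesis using R0[of x] by (simp add: R_def)
    next
      case False
      then have "infdist x K = \<delta>" using x dx by (auto simp: S_def)
      then have "norm (p x) \<le> b" using \<delta>(2) by auto
      then have "norm (q x) \<le> C" unfolding q_def C_def norm_mult norm_power
        using b0 by (intro mult_mono power_mono fle dx) auto
      then show ?thesis unfolding g_def norm_mult norm_power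
        using C by (intro mult_mono power_mono fle dx) auto
    qed
  qed
  with gz show False by simp
qed

section \<open>Almost Fekete points of a compact planar set\<close>

definition vandermonde_sq :: "complex set \<Rightarrow> real" where
  "vandermonde_sq F = (\<Prod>x\<in>F. \<Prod>y\<in>F - {x}. norm (x - y))"

lemma vandermonde_sq_insert:
  assumes "finite H" "w \<notin> H"
  shows "vandermonde_sq (insert w H) = vandermonde_sq H * (\<Prod>y\<in>H. norm (w - y))\<^sup>2"
proof -
  have "(\<Prod>x\<in>H. \<Prod>y\<in>insert w H - {x}. norm (x - y)) = (\<Prod>x\<in>H. norm (w - x) * (\<Prod>y\<in>H - {x}. norm (x - y)))"
  proof (rule prod.cong[OF refl])
    fix x assume x: "x \<in> H"
    then have "insert w H - {x} = insert w (H - {x})" using assms by auto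
    then show "(\<Prod>y\<in>insert w H - {x}. norm (x - y)) = norm (w - x) * (\<Prod>y\<in>H - {x}. norm (x - y))"
      using assms by (simp add: norm_minus_commute)
  qed
  moreover have "insert w H - {w} = H" using assms by auto
  ultimately show ?thesis using assms
    by (simp add: vandermonde_sq_def prod.distrib power2_eq_square)
qed

lemma vandermonde_sq_pos: "finite F \<Longrightarrow> vandermonde_sq F > 0"
  unfolding vandermonde_sq_def by (intro prod_pos ballI) auto

text \<open>Almost Fekete points suffice, which saves a compactness argument.\<close>
lemma compact_complex_separated:
  fixes K :: "complex set"
  assumes K: "compact K" "measure lborel K = A" "A > 0"
  shows "\<exists>F\<subseteq>K. finite F \<and> card F = Suc k \<and>
    (\<forall>w\<in>F. 1 / 2 * sqrt (A / pi) ^ k \<le> (\<Prod>y\<in>F - {w}. norm (w - y)))"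
proof -
  define \<F> where "\<F> = {F. F \<subseteq> K \<and> finite F \<and> card F = Suc k}"
  have "infinite K"
  proof
    assume "finite K"
    then have "emeasure lborel K = 0" by (simp add: finite_imp_null_set_lborel null_setsD1)
    then show False using K by (simp add: measure_def)
  qed
  then have ne: "\<F> \<noteq> {}" using infinite_arbitrarily_large[of K "Suc k"] by (auto simp: \<F>_def)
  obtain B where B: "B > 0" "\<And>x. x \<in> K \<Longrightarrow> norm x \<le> B"
    using compact_imp_bounded[OF K(1)] by (auto simp: bounded_pos)
  have bdd: "bdd_above (vandermonde_sq ` \<F>)"
  proof (rule bdd_aboveI2)
    fix F assume F: "F \<in> \<F>"
    have "vandermonde_sq F \<le> (\<Prod>x\<in>F. \<Prod>y\<in>F - {x}. 2 * B)"
      unfolding vandermonde_sq_def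
    proof (intro prod_mono conjI prod_nonneg)
      fix x y assume "x \<in> F" "y \<in> F - {x}"
      then have "norm x \<le> B" "norm y \<le> B" using F B by (auto simp: \<F>_def)
      then show "norm (x - y) \<le> 2 * B" using norm_triangle_ineq4[of x y] by linarith
    qed auto
    also have "\<dots> = ((2 * B) ^ k) ^ Suc k"
      using F by (simp add: \<F>_def card_Diff_singleton)
    also have "\<dots> = (2 * B) ^ (k * Suc k)" by (rule power_mult[symmetric])
    finally show "vandermonde_sq F \<le> (2 * B) ^ (k * Suc k)" .
  qed
  define S where "S = (SUP F\<in>\<F>. vandermonde_sq F)"
  have leS: "vandermonde_sq F \<le> S" if "F \<in> \<F>" for F
    unfolding S_def using bdd that by (rule cSUP_upper[rotated])
  obtain F0 where F0: "F0 \<in> \<F>" using ne by auto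
  then have "S > 0" using leS[OF F0] vandermonde_sq_pos[of F0] by (auto simp: \<F>_def)
  then have "S / 4 < S" by simp
  then obtain F where F: "F \<in> \<F>" "S / 4 < vandermonde_sq F"
    using less_cSUP_iff[OF ne bdd, of "S / 4"] unfolding S_def by blast
  have fin: "finite F" using F by (simp add: \<F>_def)
  have "1 / 2 * sqrt (A / pi) ^ k \<le> (\<Prod>y\<in>F - {w}. norm (w - y))" if w: "w \<in> F" for w
  proof -
    define H where "H = F - {w}"
    have H: "finite H" "card H = k" "w \<notin> H" "F = insert w H" using F w by (auto simp: H_def \<F>_def)
    \<comment> \<open>Exchanging \<open>w\<close> for a point \<open>x\<close> where the polynomial
      with zeros \<open>H\<close> is large raises \<open>vandermonde_sq\<close> by less than the
      factor 4, because \<open>F\<close> comes within that factor of the supremum. The polynomial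
      enters squared, so the loss at \<open>w\<close> is less than a factor 2.\<close>
    obtain x where x: "x \<in> K" "sqrt (A / pi) ^ k \<le> (\<Prod>y\<in>H. norm (x - y))"
      using monic_polynomial_sup_ge[OF K H(1)] H(2) by auto
    let ?px = "\<Prod>y\<in>H. norm (x - y)" and ?pw = "\<Prod>y\<in>H. norm (w - y)"
    have "sqrt (A / pi) ^ k > 0" using K by simp
    then have "?px \<noteq> 0" using x(2) by linarith
    then have xH: "x \<notin> H" using H(1) by auto
    have "insert x H \<in> \<F>" using F H x xH by (auto simp: \<F>_def)
    then have "vandermonde_sq (insert x H) < 4 * vandermonde_sq (insert w H)"
      using leS[of "insert x H"] F(2) H(4) by simp
    then have "vandermonde_sq H * ?px\<^sup>2 < vandermonde_sq H * (4 * ?pw\<^sup>2)"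
      using vandermonde_sq_insert[OF H(1) xH] vandermonde_sq_insert[OF H(1,3)] by simp
    then have "?px\<^sup>2 < (2 * ?pw)\<^sup>2"
      using vandermonde_sq_pos[OF H(1)] by (simp add: power_mult_distrib)
    then have "?px < 2 * ?pw" by (rule power2_less_imp_less) (simp add: prod_nonneg)
    then show ?thesis using x(2) by (simp add: H_def)
  qed
  then show ?thesis using F by (auto simp: \<F>_def)
qed

text \<open>Planar counterpart of \<open>emeasure_real_section_le\<close>. The square of the
  capacity for complex balls originates here, since the area is
  \<open>pi * \<rho>\<^sup>2\<close>.\<close>

lemma emeasure_complex_section_le:
  assumes U: "log_subharmonic U" and E: "E \<in> sets borel" and D: "D \<ge> 0"
    and UE: "\<And>w. w \<in> E \<Longrightarrow> U w \<le> M" and dist: "\<And>w. w \<in> E \<Longrightarrow> norm (z - w) \<le> D"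
  shows "emeasure lborel E \<le> ennreal (pi * D\<^sup>2 * exp (2 * (M - U z)))"
proof (rule emeasure_le_if_compact_le[OF E])
  have sub: "E \<subseteq> cball z D" using dist by (auto simp: dist_norm)
  then show "bounded E" using bounded_cball bounded_subset by blast
  fix K assume K: "compact K" "K \<subseteq> E"
  define A where "A = measure lborel K"
  have eq: "emeasure lborel K = ennreal A"
    using fmeasurable_compact[OF K(1)] by (simp add: A_def emeasure_eq_measure2)
  show "emeasure lborel K \<le> ennreal (pi * D\<^sup>2 * exp (2 * (M - U z)))"
  proof (cases "A > 0")
    case False
    then show ?thesis by (simp add: eq ennreal_neg)
  next
    case True
    define \<rho> where "\<rho> = sqrt (A / pi)"
    have \<rho>: "\<rho> > 0" "A = pi * \<rho>\<^sup>2" using True by (auto simp: \<rho>_def)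
    have "ennreal A \<le> emeasure lborel (cball z D)"
      unfolding eq[symmetric] using K sub by (intro emeasure_mono) auto
    also have "\<dots> = ennreal (pi * D\<^sup>2)" using D by (simp add: emeasure_cball unit_ball_vol_2)
    finally have "\<rho>\<^sup>2 \<le> D\<^sup>2" using D by (simp add: \<rho>(2))
    then have \<rho>D: "\<rho> \<le> D" using D by (rule power2_le_imp_le)
    have "U z \<le> M + ln (D / \<rho>)"
    proof (rule log_subharmonic_le_transfinite[OF U K(1), of "1 / 2"])
      show "K \<noteq> {}" using True by (auto simp: A_def)
      show "\<exists>F\<subseteq>K. finite F \<and> card F = Suc k \<and> (\<forall>w\<in>F. 1 / 2 * \<rho> ^ k \<le> (\<Prod>y\<in>F - {w}. norm (w - y)))" for k
        unfolding \<rho>_def by (rule compact_complex_separated[OF K(1) A_def[symmetric] True])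
    qed (use UE dist K \<rho> \<rho>D in auto)
    then have "exp (U z - M) \<le> exp (ln (D / \<rho>))" by simp
    then have "exp (U z - M) * \<rho> \<le> D" using \<rho>(1) \<rho>D by (simp add: pos_le_divide_eq)
    then have "(exp (U z - M) * \<rho>)\<^sup>2 \<le> D\<^sup>2" using \<rho> by (intro power_mono) auto
    then have "\<rho>\<^sup>2 * exp (2 * (U z - M)) \<le> D\<^sup>2"
      by (simp add: power_mult_distrib mult.commute flip: exp_double)
    then have "\<rho>\<^sup>2 * exp (2 * (U z - M)) * exp (2 * (M - U z)) \<le> D\<^sup>2 * exp (2 * (M - U z))"
      by (intro mult_right_mono) auto
    then have "\<rho>\<^sup>2 \<le> D\<^sup>2 * exp (2 * (M - U z))"
      by (simp add: mult.assoc exp_add[symmetric])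
    then have "A \<le> pi * D\<^sup>2 * exp (2 * (M - U z))" by (simp add: \<rho>(2))
    then show ?thesis unfolding eq by (rule ennreal_leI)
  qed
qed

section \<open>Decomposition of a homogeneous measure along lines through the origin\<close>

lemma nn_integral_lborel_scaleR:
  fixes f :: "'a::euclidean_space \<Rightarrow> ennreal"
  assumes [measurable]: "f \<in> borel_measurable borel" and c: "c \<noteq> 0"
  shows "(\<integral>\<^sup>+x. f (c *\<^sub>R x) \<partial>lborel) = ennreal (1 / \<bar>c\<bar> ^ DIM('a)) * (\<integral>\<^sup>+x. f x \<partial>lborel)"
proof -
  have "(\<integral>\<^sup>+x. f x \<partial>lborel) = (\<integral>\<^sup>+x. f x \<partial>density (distr lborel borel (\<lambda>x. 0 + c *\<^sub>R x)) (\<lambda>_. ennreal (\<bar>c\<bar> ^ DIM('a))))"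
    using lborel_affine[OF c, of "0::'a"] by simp
  also have "\<dots> = ennreal (\<bar>c\<bar> ^ DIM('a)) * (\<integral>\<^sup>+x. f (c *\<^sub>R x) \<partial>lborel)"
    by (simp add: nn_integral_density nn_integral_distr nn_integral_cmult)
  finally have "ennreal (1 / \<bar>c\<bar> ^ DIM('a)) * (\<integral>\<^sup>+x. f x \<partial>lborel)
      = (ennreal (1 / \<bar>c\<bar> ^ DIM('a)) * ennreal (\<bar>c\<bar> ^ DIM('a))) * (\<integral>\<^sup>+x. f (c *\<^sub>R x) \<partial>lborel)"
    by (simp add: mult.assoc)
  also have "ennreal (1 / \<bar>c\<bar> ^ DIM('a)) * ennreal (\<bar>c\<bar> ^ DIM('a)) = 1"
    using c by (simp flip: ennreal_mult')
  finally show ?thesis by simp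
qed

text \<open>Covers both cases of the theorem: complex scalars acting on Lebesgue measure of the
  whole space, with \<open>D\<close> twice the complex dimension, and real scalars acting on the
  measure of a subspace, with \<open>D\<close> its real dimension.\<close>

locale homogeneous_measure = sigma_finite_measure \<mu>
  for \<mu> :: "'a::euclidean_space measure" +
  fixes act :: "'f::{real_normed_field, euclidean_space} \<Rightarrow> 'a \<Rightarrow> 'a" and D :: nat
  assumes sets_eq [measurable_cong]: "sets \<mu> = sets borel"
    and act_measurable [measurable]: "(\<lambda>p. act (fst p) (snd p)) \<in> borel_measurable (borel \<Otimes>\<^sub>M borel)"
    and norm_act: "norm (act c y) = norm c * norm y"
    and null_zero: "emeasure \<mu> {0} = 0"
    and scaling: "\<And>h c. h \<in> borel_measurable borel \<Longrightarrow> c \<noteq> 0 \<Longrightarrow>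
      (\<integral>\<^sup>+y. h (act c y) \<partial>\<mu>) = ennreal (1 / norm c ^ D) * (\<integral>\<^sup>+y. h y \<partial>\<mu>)"
begin

text \<open>The density \<open>norm c ^ (D - DIM('f))\<close>, except at \<open>c = 0\<close>, where it has the value 0.\<close>
definition weight :: "'f \<Rightarrow> ennreal" where
  "weight c = ennreal (norm c ^ D / norm c ^ DIM('f))"

text \<open>The integrand \<open>1 / norm c ^ DIM('f)\<close> is the density of the multiplicative
  Haar measure, so the mass of the shell is unchanged when its radii are scaled; this is
  \<open>shell_const_scale\<close>.\<close>

definition shell_const :: ennreal where
  "shell_const = (\<integral>\<^sup>+(c::'f). indicator {1..<2} (1 / norm c) * ennreal (1 / norm c ^ DIM('f)) \<partial>lborel)"

lemma weight_measurable [measurable]: "weight \<in> borel_measurable borel"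
  unfolding weight_def by measurable

lemma act_measurable' [measurable (raw)]:
  assumes "f \<in> borel_measurable M" "g \<in> borel_measurable M"
  shows "(\<lambda>x. act (f x) (g x)) \<in> borel_measurable M"
  using measurable_compose[OF measurable_Pair[OF assms] act_measurable] by simp

lemma shell_const_scale:
  assumes r: "r > 0"
  shows "(\<integral>\<^sup>+(c::'f). indicator {1..<2} (r / norm c) * ennreal (1 / norm c ^ DIM('f)) \<partial>lborel) = shell_const"
proof -
  let ?F = "\<lambda>c::'f. indicator {1..<2} (r / norm c) * ennreal (1 / norm c ^ DIM('f))"
  have "ennreal (1 / r ^ DIM('f)) * shell_const
      = (\<integral>\<^sup>+(c::'f). ennreal (1 / r ^ DIM('f)) * (indicator {1..<2} (1 / norm c) * ennreal (1 / norm c ^ DIM('f))) \<partial>lborel)"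
    unfolding shell_const_def by (rule nn_integral_cmult[symmetric]) measurable
  also have "\<dots> = (\<integral>\<^sup>+c. ?F (r *\<^sub>R c) \<partial>lborel)"
    using r by (intro nn_integral_cong)
      (auto simp: indicator_def power_mult_distrib simp flip: ennreal_mult')
  also have "\<dots> = ennreal (1 / r ^ DIM('f)) * (\<integral>\<^sup>+c. ?F c \<partial>lborel)"
    using r by (subst nn_integral_lborel_scaleR) auto
  finally show ?thesis using r by (simp add: ennreal_mult_cancel_left)
qed

lemma shell_const_pos: "shell_const > 0" and shell_const_finite: "shell_const < \<infinity>"
proof -
  obtain b :: 'f where b: "b \<in> Basis" using nonempty_Basis by blast
  let ?p = "(3 / 4) *\<^sub>R b"
  let ?k = "\<lambda>c::'f. indicator {1..<2} (1 / norm c) * ennreal (1 / norm c ^ DIM('f)) :: ennreal"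
  have "ennreal (measure lborel (ball ?p (1 / 8))) \<le> shell_const"
  proof -
    have "ennreal (measure lborel (ball ?p (1 / 8))) = (\<integral>\<^sup>+c. indicator (ball ?p (1 / 8)) c \<partial>lborel)"
      by (simp add: emeasure_eq_measure2 fmeasurable_bounded_borel)
    also have "\<dots> \<le> shell_const" unfolding shell_const_def
    proof (rule nn_integral_mono)
      fix c :: 'f
      show "indicator (ball ?p (1 / 8)) c \<le> ?k c"
      proof (cases "c \<in> ball ?p (1 / 8)")
        case True
        then have "norm (c - ?p) < 1 / 8" by (simp add: dist_norm norm_minus_commute)
        moreover have "norm ?p = 3 / 4" using b by simp
        ultimately have n: "1 / 2 < norm c" "norm c < 1" using norm_triangle_ineq3[of c ?p] by linarith+
        have "norm c > 0" using n by linarith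
        then have "1 / norm c \<in> {1..<2}" using n by (auto simp: field_simps)
        moreover have "norm c ^ DIM('f) \<le> 1" "norm c ^ DIM('f) > 0"
          using n \<open>norm c > 0\<close> by (auto intro: power_le_one)
        then have "1 \<le> 1 / norm c ^ DIM('f)" by (simp only: pos_le_divide_eq mult_1)
        then have "1 \<le> ennreal (1 / norm c ^ DIM('f))" using ennreal_leI[of 1] by simp
        ultimately show ?thesis using True by (simp add: indicator_def)
      qed simp
    qed
    finally show ?thesis .
  qed
  moreover have "0 < ennreal (measure lborel (ball ?p (1 / 8)))" using content_ball_pos[of "1/8" ?p] by simp
  ultimately show "shell_const > 0" by (rule order_less_le_trans[rotated])
  have "shell_const \<le> (\<integral>\<^sup>+(c::'f). ennreal (2 ^ DIM('f)) * indicator (cball 0 1) c \<partial>lborel)"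
    unfolding shell_const_def
  proof (rule nn_integral_mono)
    fix c :: 'f
    show "?k c \<le> ennreal (2 ^ DIM('f)) * indicator (cball 0 1) c"
    proof (cases "1 / norm c \<in> {1..<2}")
      case True
      then have c: "norm c \<noteq> 0" by auto
      then have "norm c \<le> 1" using True by (simp add: field_simps)
      moreover have "1 / norm c ^ DIM('f) \<le> 2 ^ DIM('f)"
        using True c power_mono[of "1 / norm c" 2 "DIM('f)"] by (auto simp: power_divide)
      ultimately show ?thesis by (simp add: ennreal_leI indicator_def)
    qed simp
  qed
  also have "\<dots> < \<infinity>"
    using emeasure_lborel_cball_finite[of "0::'f" 1]
    by (subst nn_integral_cmult_indicator) (auto simp: ennreal_mult_less_top)
  finally show "shell_const < \<infinity>" .
qed

text \<open>Polar coordinates without a measure on the set of lines: the direction is averaged over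
  the shell \<open>1 \<le> norm y < 2\<close>, and each \<open>y\<close> contributes the integral
  over its whole line. Fubini and the substitution \<open>x = act c y\<close> leave for each
  \<open>x\<close> the mass of the admissible scalars, which is the same for all \<open>x\<close>
  other than 0.\<close>

lemma disintegration:
  assumes [measurable]: "h \<in> borel_measurable borel"
  shows "(\<integral>\<^sup>+y. indicator {1..<2} (norm y) * (\<integral>\<^sup>+c. h (act c y) * weight c \<partial>lborel) \<partial>\<mu>)
    = shell_const * (\<integral>\<^sup>+x. h x \<partial>\<mu>)"
proof -
  interpret P: pair_sigma_finite \<mu> "lborel :: 'f measure" ..
  have ne0: "AE c in lborel. c \<noteq> (0::'f)" by (rule AE_lborel_singleton)
  have "(\<integral>\<^sup>+y. indicator {1..<2} (norm y) * (\<integral>\<^sup>+c. h (act c y) * weight c \<partial>lborel) \<partial>\<mu>)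
      = (\<integral>\<^sup>+y. \<integral>\<^sup>+c. indicator {1..<2} (norm y) * (h (act c y) * weight c) \<partial>lborel \<partial>\<mu>)"
    by (intro nn_integral_cong nn_integral_cmult[symmetric]) measurable
  also have "\<dots> = (\<integral>\<^sup>+c. \<integral>\<^sup>+y. indicator {1..<2} (norm y) * (h (act c y) * weight c) \<partial>\<mu> \<partial>lborel)"
    by (rule P.Fubini'[symmetric]) measurable
  also have "\<dots> = (\<integral>\<^sup>+(c::'f). \<integral>\<^sup>+x. indicator {1..<2} (norm x / norm c) * ennreal (1 / norm c ^ DIM('f)) * h x \<partial>\<mu> \<partial>lborel)"
  proof (rule nn_integral_cong_AE, rule eventually_mono[OF ne0])
    fix c :: 'f assume c: "c \<noteq> 0"
    let ?g = "\<lambda>x. indicator {1..<2} (norm x / norm c) * h x"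
    have "(\<integral>\<^sup>+y. indicator {1..<2} (norm y) * (h (act c y) * weight c) \<partial>\<mu>)
        = (\<integral>\<^sup>+y. weight c * ?g (act c y) \<partial>\<mu>)"
      using c by (intro nn_integral_cong) (simp add: norm_act mult_ac)
    also have "\<dots> = weight c * (ennreal (1 / norm c ^ D) * (\<integral>\<^sup>+x. ?g x \<partial>\<mu>))"
    proof -
      have "(\<integral>\<^sup>+y. ?g (act c y) \<partial>\<mu>) = ennreal (1 / norm c ^ D) * (\<integral>\<^sup>+x. ?g x \<partial>\<mu>)"
        by (rule scaling[OF _ c]) measurable
      moreover have "(\<integral>\<^sup>+y. weight c * ?g (act c y) \<partial>\<mu>) = weight c * (\<integral>\<^sup>+y. ?g (act c y) \<partial>\<mu>)"
        by (rule nn_integral_cmult) measurable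
      ultimately show ?thesis by (simp only:)
    qed
    also have "\<dots> = ennreal (1 / norm c ^ DIM('f)) * (\<integral>\<^sup>+x. ?g x \<partial>\<mu>)"
      using c by (simp add: weight_def mult.assoc[symmetric] flip: ennreal_mult'')
    also have "\<dots> = (\<integral>\<^sup>+x. ennreal (1 / norm c ^ DIM('f)) * ?g x \<partial>\<mu>)"
      by (rule nn_integral_cmult[symmetric]) measurable
    finally show "(\<integral>\<^sup>+y. indicator {1..<2} (norm y) * (h (act c y) * weight c) \<partial>\<mu>)
        = (\<integral>\<^sup>+x. indicator {1..<2} (norm x / norm c) * ennreal (1 / norm c ^ DIM('f)) * h x \<partial>\<mu>)"
      by (simp add: mult_ac)
  qed
  also have "\<dots> = (\<integral>\<^sup>+x. \<integral>\<^sup>+c. indicator {1..<2} (norm x / norm c) * ennreal (1 / norm (c::'f) ^ DIM('f)) * h x \<partial>lborel \<partial>\<mu>)"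
    by (rule P.Fubini') measurable
  also have "\<dots> = (\<integral>\<^sup>+x. shell_const * h x \<partial>\<mu>)"
  proof (rule nn_integral_cong_AE)
    have "AE x in \<mu>. x \<noteq> 0" by (rule AE_I[of _ _ "{0}"]) (auto simp: null_zero)
    then show "AE x in \<mu>. (\<integral>\<^sup>+c. indicator {1..<2} (norm x / norm c) * ennreal (1 / norm (c::'f) ^ DIM('f)) * h x \<partial>lborel)
        = shell_const * h x"
    proof eventually_elim
      fix x :: 'a assume "x \<noteq> 0"
      then show "(\<integral>\<^sup>+c. indicator {1..<2} (norm x / norm c) * ennreal (1 / norm (c::'f) ^ DIM('f)) * h x \<partial>lborel)
          = shell_const * h x"
        by (subst nn_integral_multc) (auto simp: shell_const_scale)
    qed
  qed
  also have "\<dots> = shell_const * (\<integral>\<^sup>+x. h x \<partial>\<mu>)"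
    by (rule nn_integral_cmult) measurable
  finally show ?thesis .
qed

text \<open>\<open>shell_const\<close> is positive and finite, hence cancels. The set
  \<open>Y\<close> restricts the directions to a subspace that carries the measure.\<close>

lemma emeasure_le_if_sections_le:
  assumes [measurable]: "K \<in> sets borel" "B \<in> sets borel" and Y: "AE y in \<mu>. y \<in> Y"
    and le: "\<And>y. y \<in> Y \<Longrightarrow> y \<noteq> 0 \<Longrightarrow>
      (\<integral>\<^sup>+c. indicator K (act c y) * weight c \<partial>lborel) \<le> C * (\<integral>\<^sup>+c. indicator B (act c y) * weight c \<partial>lborel)"
  shows "emeasure \<mu> K \<le> C * emeasure \<mu> B"
proof -
  have "shell_const * emeasure \<mu> K
      = (\<integral>\<^sup>+y. indicator {1..<2} (norm y) * (\<integral>\<^sup>+c. indicator K (act c y) * weight c \<partial>lborel) \<partial>\<mu>)"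
    by (subst disintegration) (auto simp: sets_eq)
  also have "\<dots> \<le> (\<integral>\<^sup>+y. C * (indicator {1..<2} (norm y) * (\<integral>\<^sup>+c. indicator B (act c y) * weight c \<partial>lborel)) \<partial>\<mu>)"
  proof (rule nn_integral_mono_AE, rule eventually_mono[OF Y])
    fix y assume "y \<in> Y"
    then show "indicator {1..<2} (norm y) * (\<integral>\<^sup>+c. indicator K (act c y) * weight c \<partial>lborel)
        \<le> C * (indicator {1..<2} (norm y) * (\<integral>\<^sup>+c. indicator B (act c y) * weight c \<partial>lborel))"
      using le[of y] by (cases "y = 0") (auto simp: indicator_def)
  qed
  also have "\<dots> = C * (\<integral>\<^sup>+y. indicator {1..<2} (norm y) * (\<integral>\<^sup>+c. indicator B (act c y) * weight c \<partial>lborel) \<partial>\<mu>)"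
    by (rule nn_integral_cmult) measurable
  also have "\<dots> = C * (shell_const * emeasure \<mu> B)"
    by (subst disintegration) (auto simp: sets_eq)
  also have "\<dots> = shell_const * (C * emeasure \<mu> B)" by (simp add: mult_ac)
  finally show ?thesis
    using shell_const_pos shell_const_finite by (simp add: ennreal_mult_le_mult_iff)
qed

end

section \<open>Similarities and the integral of a power over a disc\<close>

lemma nn_integral_lborel_translation:
  fixes f :: "'a::euclidean_space \<Rightarrow> ennreal"
  assumes [measurable]: "f \<in> borel_measurable borel"
  shows "(\<integral>\<^sup>+x. f (x + a) \<partial>lborel) = (\<integral>\<^sup>+x. f x \<partial>lborel)"
proof -
  have "(\<integral>\<^sup>+x. f x \<partial>lborel) = (\<integral>\<^sup>+x. f x \<partial>distr lborel borel ((+) a))" by (simp add: lborel_distr_plus)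
  also have "\<dots> = (\<integral>\<^sup>+x. f (x + a) \<partial>lborel)" by (simp add: nn_integral_distr add.commute)
  finally show ?thesis by simp
qed

text \<open>Uniqueness of Haar measure: the image measure and Lebesgue measure are both translation
  invariant and agree on the unit ball.\<close>
lemma nn_integral_lborel_isometry:
  fixes T :: "'a::euclidean_space \<Rightarrow> 'a"
  assumes T: "linear T" "\<And>x. norm (T x) = norm x" and [measurable]: "g \<in> borel_measurable borel"
  shows "(\<integral>\<^sup>+x. g (T x) \<partial>lborel) = (\<integral>\<^sup>+x. g x \<partial>lborel)"
proof -
  define \<beta> :: "'a \<Rightarrow> ennreal" where "\<beta> = indicator (ball 0 1)"
  have [measurable]: "\<beta> \<in> borel_measurable borel" unfolding \<beta>_def by (intro borel_measurable_indicator) auto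
  have [measurable]: "T \<in> borel_measurable borel"
    using T(1) by (intro borel_measurable_continuous_onI linear_continuous_on linear_conv_bounded_linear[THEN iffD1])
  have "inj T" using T by (simp add: linear_injective_0) (metis norm_eq_zero)
  then have "surj T" using T(1) by (simp add: linear_injective_imp_surjective)
  then obtain S where S: "\<And>y. T (S y) = y" by (metis surj_def)
  define v where "v = emeasure lborel (ball (0::'a) 1)"
  have v: "v = ennreal (measure lborel (ball (0::'a) 1))"
    unfolding v_def by (simp add: emeasure_eq_measure2 fmeasurable_bounded_borel)
  have v0: "0 < v" "v < \<infinity>" unfolding v using content_ball_pos[of 1 "0::'a"] by simp_all
  have \<beta>T: "\<beta> (T x) = \<beta> x" for x by (simp add: \<beta>_def indicator_def T)
  have \<beta>v: "(\<integral>\<^sup>+x. \<beta> x \<partial>lborel) = v" by (simp add: \<beta>_def v_def)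
  \<comment> \<open>The double integral of \<open>\<beta> (T x) * g (y + T x)\<close> is evaluated
    twice: directly in \<open>y\<close>, and, after \<open>x\<close> is shifted by
    \<open>S y\<close>, as the integral of \<open>\<beta> (T x - y) * g (T x)\<close>.\<close>
  have "v * (\<integral>\<^sup>+y. g y \<partial>lborel) = (\<integral>\<^sup>+x. \<beta> (T x) * (\<integral>\<^sup>+y. g y \<partial>lborel) \<partial>lborel)"
    by (subst nn_integral_multc) (simp_all add: \<beta>T \<beta>v)
  also have "\<dots> = (\<integral>\<^sup>+x. \<integral>\<^sup>+y. \<beta> (T x) * g (y + T x) \<partial>lborel \<partial>lborel)"
    by (intro nn_integral_cong, subst nn_integral_cmult) (simp_all add: nn_integral_lborel_translation)
  also have "\<dots> = (\<integral>\<^sup>+y. \<integral>\<^sup>+x. \<beta> (T x) * g (y + T x) \<partial>lborel \<partial>lborel)"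
    by (rule lborel_pair.Fubini') measurable
  also have "\<dots> = (\<integral>\<^sup>+y. \<integral>\<^sup>+x. \<beta> (T (x + - S y)) * g (y + T (x + - S y)) \<partial>lborel \<partial>lborel)"
  proof (rule nn_integral_cong)
    fix y
    show "(\<integral>\<^sup>+x. \<beta> (T x) * g (y + T x) \<partial>lborel) = (\<integral>\<^sup>+x. \<beta> (T (x + - S y)) * g (y + T (x + - S y)) \<partial>lborel)"
      by (rule nn_integral_lborel_translation[of "\<lambda>x. \<beta> (T x) * g (y + T x)" "- S y", symmetric]) measurable
  qed
  also have "\<dots> = (\<integral>\<^sup>+y. \<integral>\<^sup>+x. \<beta> (T x - y) * g (T x) \<partial>lborel \<partial>lborel)"
    by (simp add: linear_diff[OF T(1)] S)
  also have "\<dots> = (\<integral>\<^sup>+x. \<integral>\<^sup>+y. \<beta> (T x - y) * g (T x) \<partial>lborel \<partial>lborel)"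
    by (rule lborel_pair.Fubini') measurable
  also have "\<dots> = (\<integral>\<^sup>+x. v * g (T x) \<partial>lborel)"
  proof (rule nn_integral_cong)
    fix x :: 'a
    have "(\<integral>\<^sup>+y. \<beta> (T x - y) * g (T x) \<partial>lborel) = (\<integral>\<^sup>+y. \<beta> (T x - y) \<partial>lborel) * g (T x)"
      by (rule nn_integral_multc) measurable
    also have "(\<integral>\<^sup>+y. \<beta> (T x - y) \<partial>lborel) = (\<integral>\<^sup>+y. \<beta> (y + - T x) \<partial>lborel)"
      by (intro nn_integral_cong) (simp add: \<beta>_def indicator_def norm_minus_commute)
    also have "\<dots> = v" by (subst nn_integral_lborel_translation) (simp_all add: \<beta>v)
    finally show "(\<integral>\<^sup>+y. \<beta> (T x - y) * g (T x) \<partial>lborel) = v * g (T x)" .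
  qed
  also have "\<dots> = v * (\<integral>\<^sup>+x. g (T x) \<partial>lborel)" by (rule nn_integral_cmult) measurable
  finally show ?thesis using v0 by (auto simp: ennreal_mult_cancel_left)
qed

lemma nn_integral_lborel_similarity:
  fixes T :: "'a::euclidean_space \<Rightarrow> 'a"
  assumes T: "linear T" "\<And>x. norm (T x) = c * norm x" and c: "c > 0" and [measurable]: "g \<in> borel_measurable borel"
  shows "(\<integral>\<^sup>+x. g (T x) \<partial>lborel) = ennreal (1 / c ^ DIM('a)) * (\<integral>\<^sup>+x. g x \<partial>lborel)"
proof -
  have "(\<integral>\<^sup>+x. g (T x) \<partial>lborel) = (\<integral>\<^sup>+x. (\<lambda>x. g (c *\<^sub>R x)) ((1 / c) *\<^sub>R T x) \<partial>lborel)" using c by simp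
  also have "\<dots> = (\<integral>\<^sup>+x. g (c *\<^sub>R x) \<partial>lborel)"
    by (rule nn_integral_lborel_isometry) (use T c in \<open>auto intro: linear_compose_scale_right\<close>)
  also have "\<dots> = ennreal (1 / c ^ DIM('a)) * (\<integral>\<^sup>+x. g x \<partial>lborel)"
    using c by (subst nn_integral_lborel_scaleR) auto
  finally show ?thesis .
qed

lemma norm_vector_smult:
  fixes c :: "'b::real_normed_field"
  shows "norm (c *s (y :: 'b ^ 'n)) = norm c * norm y"
  unfolding norm_vec_def by (simp add: norm_mult L2_set_right_distrib)

lemma linear_vector_smult: "linear (\<lambda>y :: complex ^ 'n. c *s y)"
  by (rule linearI) (simp_all add: vec_eq_iff algebra_simps scaleR_conv_of_real)

lemma continuous_on_vector_smult [continuous_intros]: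
  fixes f :: "'a::topological_space \<Rightarrow> complex" and g :: "'a \<Rightarrow> complex ^ 'n"
  assumes "continuous_on S f" "continuous_on S g"
  shows "continuous_on S (\<lambda>x. f x *s g x)"
  unfolding vector_scalar_mult_def
  by (intro continuous_on_vec_lambda continuous_on_mult continuous_on_component assms)

lemma homogeneous_measure_lborel_complex:
  "homogeneous_measure (lborel :: (complex ^ 'n) measure) (\<lambda>c y. c *s y) (2 * CARD('n))"
proof (unfold_locales)
  show "(\<lambda>p. fst p *s snd p) \<in> borel_measurable (borel \<Otimes>\<^sub>M (borel :: (complex ^ 'n) measure))"
    unfolding borel_prod by (intro borel_measurable_continuous_onI continuous_intros)
next
  fix h :: "complex ^ 'n \<Rightarrow> ennreal" and c :: complex
  assume "h \<in> borel_measurable borel" "c \<noteq> 0"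
  then have "(\<integral>\<^sup>+y. h (c *s y) \<partial>lborel) = ennreal (1 / norm c ^ DIM(complex ^ 'n)) * (\<integral>\<^sup>+y. h y \<partial>lborel)"
    by (intro nn_integral_lborel_similarity linear_vector_smult norm_vector_smult) auto
  then show "(\<integral>\<^sup>+y. h (c *s y) \<partial>lborel) = ennreal (1 / norm c ^ (2 * CARD('n))) * (\<integral>\<^sup>+y. h y \<partial>lborel)"
    by (simp add: mult.commute)
qed (auto simp: norm_vector_smult)

text \<open>Writing the power as an integral of \<open>2 * j * t ^ (2 * j - 1)\<close> up to the
  norm and exchanging integrals leaves annuli of area \<open>pi - pi * t\<^sup>2\<close>. For
  \<open>j = 0\<close> this density vanishes, hence the separate case.\<close>

lemma nn_integral_unit_disc_power:
  "(\<integral>\<^sup>+x\<in>cball 0 1. ennreal (norm (x::complex) ^ (2 * j)) \<partial>lborel) = ennreal (pi / (real j + 1))"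
proof (cases "j = 0")
  case True
  then show ?thesis by (simp add: emeasure_cball unit_ball_vol_2)
next
  case False
  let ?w = "\<lambda>t::real. 2 * real j * t ^ (2 * j - 1)"
  let ?F = "\<lambda>t::real. pi * t ^ (2 * j) - pi * (real j / (real j + 1)) * t ^ (2 * j + 2)"
  let ?A = "{p. 0 \<le> snd p \<and> snd p \<le> norm (fst p) \<and> norm (fst p) \<le> 1}"
  have pw: "ennreal (r ^ (2 * j)) = (\<integral>\<^sup>+t. ennreal (?w t) * indicator {0..r} t \<partial>lborel)" if "0 \<le> r" for r :: real
  proof -
    have "(\<integral>\<^sup>+t. ennreal (?w t) * indicator {0..r} t \<partial>lborel) = ennreal (r ^ (2 * j) - 0 ^ (2 * j))"
      by (rule nn_integral_FTC_Icc) (use that False in \<open>auto intro!: derivative_eq_intros\<close>)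
    then show ?thesis using False by (simp add: power_0_left)
  qed
  have ann: "emeasure lborel {x::complex. t \<le> norm x \<and> norm x \<le> 1} = ennreal (pi - pi * t\<^sup>2)" if "0 \<le> t" "t \<le> 1" for t
  proof -
    have "{x::complex. t \<le> norm x \<and> norm x \<le> 1} = cball 0 1 - ball 0 t" by auto
    then have "emeasure lborel {x::complex. t \<le> norm x \<and> norm x \<le> 1}
        = emeasure lborel (cball (0::complex) 1) - emeasure lborel (ball (0::complex) t)"
    proof (simp only:, intro emeasure_Diff)
      show "emeasure lborel (ball (0::complex) t) \<noteq> \<infinity>" using that by (simp add: emeasure_ball)
      show "ball (0::complex) t \<subseteq> cball 0 1" using that by (intro subsetI) simp
    qed simp_all
    then show ?thesis using that by (simp add: emeasure_ball emeasure_cball unit_ball_vol_2 ennreal_minus)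
  qed
  have "(\<integral>\<^sup>+x\<in>cball 0 1. ennreal (norm (x::complex) ^ (2 * j)) \<partial>lborel)
      = (\<integral>\<^sup>+x. \<integral>\<^sup>+t. ennreal (?w t) * indicator ?A (x::complex, t) \<partial>lborel \<partial>lborel)"
  proof (rule nn_integral_cong)
    fix x :: complex
    have "(\<integral>\<^sup>+t. ennreal (?w t) * indicator ?A (x, t) \<partial>lborel)
        = (\<integral>\<^sup>+t. (ennreal (?w t) * indicator {0..norm x} t) * indicator (cball 0 1) x \<partial>lborel)"
      by (rule nn_integral_cong) (auto simp: indicator_def)
    also have "\<dots> = ennreal (norm x ^ (2 * j)) * indicator (cball 0 1) x"
      unfolding pw[OF norm_ge_zero] by (rule nn_integral_multc) measurable
    finally show "ennreal (norm x ^ (2 * j)) * indicator (cball 0 1) x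
        = (\<integral>\<^sup>+t. ennreal (?w t) * indicator ?A (x, t) \<partial>lborel)" ..
  qed
  also have "\<dots> = (\<integral>\<^sup>+t. \<integral>\<^sup>+x. ennreal (?w t) * indicator ?A (x::complex, t) \<partial>lborel \<partial>lborel)"
    by (rule lborel_pair.Fubini'[symmetric]) measurable
  also have "\<dots> = (\<integral>\<^sup>+t. ennreal (?w t * (pi - pi * t\<^sup>2)) * indicator {0..1} t \<partial>lborel)"
  proof (rule nn_integral_cong)
    fix t :: real
    have "(\<integral>\<^sup>+x. ennreal (?w t) * indicator ?A (x::complex, t) \<partial>lborel)
        = (\<integral>\<^sup>+x. (ennreal (?w t) * indicator {0..1} t) * indicator {x. t \<le> norm x \<and> norm x \<le> 1} (x::complex) \<partial>lborel)"
      by (rule nn_integral_cong) (auto simp: indicator_def)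
    also have "\<dots> = (ennreal (?w t) * indicator {0..1} t) * emeasure lborel {x::complex. t \<le> norm x \<and> norm x \<le> 1}"
      by (subst nn_integral_cmult) (auto simp: nn_integral_indicator)
    also have "\<dots> = ennreal (?w t * (pi - pi * t\<^sup>2)) * indicator {0..1} t"
    proof (cases "t \<in> {0..1}")
      case True
      then have "0 \<le> ?w t" by simp
      with True show ?thesis by (simp add: ann flip: ennreal_mult')
    qed simp
    finally show "(\<integral>\<^sup>+x. ennreal (?w t) * indicator ?A (x::complex, t) \<partial>lborel)
        = ennreal (?w t * (pi - pi * t\<^sup>2)) * indicator {0..1} t" .
  qed
  also have "\<dots> = ennreal ((pi * 1 ^ (2 * j) - pi * (real j / (real j + 1)) * 1 ^ (2 * j + 2))
      - (pi * 0 ^ (2 * j) - pi * (real j / (real j + 1)) * 0 ^ (2 * j + 2)))"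
  proof (rule nn_integral_FTC_Icc[where F = "?F"])
    fix t :: real assume "t \<in> {0..1}"
    then have t: "0 \<le> t" "t \<le> 1" by auto
    have 1: "2 * j + 1 = (2 * j - 1) + 2" using False by simp
    have 2: "(real j / (real j + 1)) * (2 * real j + 2) = 2 * real j" by (simp add: divide_simps)
    have "DERIV (?F) t :>
        pi * (real (2 * j) * t ^ (2 * j - 1)) - pi * (real j / (real j + 1)) * (real (2 * j + 2) * t ^ (2 * j + 1))"
      by (intro DERIV_diff DERIV_cmult) (use DERIV_pow[of "2 * j" t] DERIV_pow[of "2 * j + 2" t] in simp_all)
    also have "pi * (real j / (real j + 1)) * (real (2 * j + 2) * t ^ (2 * j + 1))
        = pi * ((real j / (real j + 1)) * (2 * real j + 2)) * (t ^ (2 * j - 1) * t\<^sup>2)"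
      unfolding 1 power_add by (simp add: mult_ac)
    also have "pi * (real (2 * j) * t ^ (2 * j - 1)) - pi * ((real j / (real j + 1)) * (2 * real j + 2)) * (t ^ (2 * j - 1) * t\<^sup>2)
        = ?w t * (pi - pi * t\<^sup>2)"
      unfolding 2 by (simp add: algebra_simps)
    finally show "DERIV (?F) t :> ?w t * (pi - pi * t\<^sup>2)" .
    show "0 \<le> ?w t * (pi - pi * t\<^sup>2)"
      using t by (intro mult_nonneg_nonneg) (auto simp: power_le_one mult_le_cancel_left2)
  qed auto
  also have "\<dots> = ennreal (pi / (real j + 1))" using False by (simp add: power_0_left divide_simps) (simp add: distrib_left)
  finally show ?thesis .
qed

section \<open>Moments of discs by orthogonality of monomials\<close>

lemma integral_lborel_isometry:
  fixes T :: "'a::euclidean_space \<Rightarrow> 'a" and f :: "'a \<Rightarrow> 'b::{banach, second_countable_topology}"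
  assumes T: "linear T" "\<And>x. norm (T x) = norm x" and f [measurable]: "f \<in> borel_measurable borel"
  shows "(\<integral>x. f (T x) \<partial>lborel) = (\<integral>x. f x \<partial>lborel)"
proof -
  have m [measurable]: "T \<in> borel_measurable borel"
    using T(1) by (intro borel_measurable_continuous_onI linear_continuous_on linear_conv_bounded_linear[THEN iffD1])
  have "distr lborel borel T = lborel"
  proof (rule measure_eqI)
    fix A assume "A \<in> sets (distr lborel borel T)"
    then have A [measurable]: "A \<in> sets borel" by simp
    have "emeasure (distr lborel borel T) A = (\<integral>\<^sup>+x. indicator A x \<partial>distr lborel borel T)" by simp
    also have "\<dots> = (\<integral>\<^sup>+x. indicator A (T x) \<partial>lborel)" by (rule nn_integral_distr) measurable
    also have "\<dots> = (\<integral>\<^sup>+x. indicator A x \<partial>lborel)" by (rule nn_integral_lborel_isometry[OF T]) simp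
    finally show "emeasure (distr lborel borel T) A = emeasure lborel A" by simp
  qed simp
  then have "(\<integral>x. f x \<partial>lborel) = (\<integral>x. f x \<partial>distr lborel borel T)" by simp
  also have "\<dots> = (\<integral>x. f (T x) \<partial>lborel)" by (rule integral_distr) auto
  finally show ?thesis ..
qed

text \<open>For different exponents, rotation by the angle \<open>pi / (j - k)\<close> multiplies
  the integrand by -1 and preserves the disc, so the integral equals its negative.\<close>

lemma integral_unit_disc_monomials:
  "(LINT x:cball 0 1|lborel. x ^ j * cnj x ^ k) = (if j = k then of_real (pi / (real j + 1)) else (0::complex))"
proof (cases "j = k")
  case True
  have eq: "(x::complex) ^ j * cnj x ^ j = of_real (norm x ^ (2 * j))" for x
    by (simp add: power_mult_distrib[symmetric] complex_norm_square[symmetric] power_mult del: of_real_power)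
       (simp only: of_real_power)
  have "has_bochner_integral lborel (\<lambda>x::complex. indicator (cball 0 1) x * norm x ^ (2 * j)) (pi / (real j + 1))"
  proof (rule has_bochner_integral_nn_integral)
    show "(\<integral>\<^sup>+x. ennreal (indicator (cball 0 1) x * norm (x::complex) ^ (2 * j)) \<partial>lborel) = ennreal (pi / (real j + 1))"
      unfolding nn_integral_unit_disc_power[symmetric]
      by (intro nn_integral_cong) (auto simp: indicator_def)
    have [measurable]: "cball (0::complex) 1 \<in> sets borel" by auto
    show "(\<lambda>x::complex. indicator (cball 0 1) x * norm x ^ (2 * j)) \<in> borel_measurable lborel" by measurable
  qed auto
  then have "(\<integral>x. indicator (cball 0 1) x * norm (x::complex) ^ (2 * j) \<partial>lborel) = pi / (real j + 1)"
    by (rule has_bochner_integral_integral_eq)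
  then have "(\<integral>x. of_real (indicator (cball 0 1) x * norm (x::complex) ^ (2 * j)) \<partial>lborel) = complex_of_real (pi / (real j + 1))"
    by (simp only: integral_complex_of_real)
  then show ?thesis unfolding True[symmetric] eq set_lebesgue_integral_def
    by (simp add: scaleR_conv_of_real)
next
  case False
  define I where "I = (LINT x:cball 0 1|lborel. x ^ j * cnj x ^ (k::nat))"
  define \<theta> where "\<theta> = pi / (real j - real k)"
  define \<omega> where "\<omega> = cis \<theta>"
  have "\<omega> ^ j * cnj \<omega> ^ k = cis (real j * \<theta> - real k * \<theta>)"
    by (simp add: \<omega>_def cis_cnj Complex.DeMoivre cis_mult)
  also have "real j * \<theta> - real k * \<theta> = (real j - real k) * \<theta>" by (simp add: left_diff_distrib)
  also have "\<dots> = pi" using False by (simp add: \<theta>_def)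
  finally have w: "\<omega> ^ j * cnj \<omega> ^ k = -1" by simp
  let ?f = "\<lambda>x::complex. indicator (cball 0 1) x *\<^sub>R (x ^ j * cnj x ^ k)"
  have "I = (\<integral>x. ?f (\<omega> * x) \<partial>lborel)"
    unfolding I_def set_lebesgue_integral_def
  proof (rule integral_lborel_isometry[symmetric])
    show "?f \<in> borel_measurable borel"
      by (rule borel_measurable_scaleR, rule borel_measurable_indicator, simp,
          intro borel_measurable_continuous_onI continuous_intros)
  qed (auto simp: \<omega>_def norm_mult intro: bounded_linear.linear bounded_linear_mult_right)
  also have "\<dots> = (\<integral>x. - ?f x \<partial>lborel)"
  proof (intro Bochner_Integration.integral_cong refl)
    fix x :: complex
    have "(\<omega> * x) ^ j * cnj (\<omega> * x) ^ k = (\<omega> ^ j * cnj \<omega> ^ k) * (x ^ j * cnj x ^ k)"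
      by (simp add: power_mult_distrib mult_ac)
    moreover have "indicator (cball 0 1) (\<omega> * x) = (indicator (cball 0 1) x :: real)"
      by (simp add: indicator_def norm_mult \<omega>_def)
    ultimately show "?f (\<omega> * x) = - ?f x" by (simp only: w) simp
  qed
  also have "\<dots> = - I" by (simp add: I_def set_lebesgue_integral_def)
  finally have "I = 0" by simp
  then show ?thesis using False by (simp add: I_def)
qed

text \<open>Absorption turns \<open>(m choose j) / (j + 1)\<close> into
  \<open>(m + 1 choose (m - j)) / (m + 1)\<close>, after which Vandermonde's convolution
  applies.\<close>

lemma sum_binomial_sq_div: "(\<Sum>j\<le>m. real (m choose j) ^ 2 / (real j + 1)) = real (2 * m + 1 choose m) / (real m + 1)"
proof -
  have eq: "real (m choose j) / (real j + 1) = real (m + 1 choose (m - j)) / (real m + 1)" if "j \<le> m" for j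
  proof -
    have "Suc j * (Suc m choose Suc j) = Suc m * (m choose j)" by (rule Suc_times_binomial)
    then have "(real j + 1) * real (Suc m choose Suc j) = (real m + 1) * real (m choose j)"
      by (metis of_nat_Suc of_nat_mult add.commute)
    moreover have "(Suc m choose Suc j) = (m + 1 choose (m - j))"
      using binomial_symmetric[of "Suc j" "Suc m"] that by (simp del: binomial_Suc_Suc)
    ultimately show ?thesis by (simp add: frac_eq_eq mult.commute del: binomial_Suc_Suc)
  qed
  have "(\<Sum>j\<le>m. real (m choose j) ^ 2 / (real j + 1)) = (\<Sum>j\<le>m. real (m choose j) * (real (m + 1 choose (m - j)) / (real m + 1)))"
    by (intro sum.cong refl) (simp only: power2_eq_square times_divide_eq_right[symmetric] eq atMost_iff)
  also have "\<dots> = real (\<Sum>j\<le>m. (m choose j) * (m + 1 choose (m - j))) / (real m + 1)"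
    by (simp add: sum_divide_distrib)
  also have "(\<Sum>j\<le>m. (m choose j) * (m + 1 choose (m - j))) = (m + (m + 1) choose m)"
    by (rule vandermonde)
  finally show ?thesis by (simp add: mult_2 add.assoc)
qed

text \<open>Expanding \<open>(1 + x) ^ m\<close> times its conjugate, orthogonality leaves only the
  diagonal terms.\<close>

lemma nn_integral_unit_disc_shifted_power:
  "(\<integral>\<^sup>+x\<in>cball 0 1. ennreal (norm (1 + x::complex) ^ (2 * m)) \<partial>lborel)
    = ennreal (pi * real (2 * m + 1 choose m) / (real m + 1))"
proof -
  let ?c = "\<lambda>j. of_nat (m choose j) :: complex"
  have ex: "complex_of_real (norm (1 + x) ^ (2 * m)) = (\<Sum>j\<le>m. \<Sum>k\<le>m. ?c j * ?c k * (x ^ j * cnj x ^ k))" for x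
  proof -
    have "complex_of_real (norm (1 + x) ^ (2 * m)) = (x + 1) ^ m * cnj ((x + 1) ^ m)"
    proof -
      have "complex_of_real (norm (1 + x) ^ (2 * m)) = (of_real ((norm (x + 1))\<^sup>2)) ^ m"
        by (simp add: power_mult add.commute)
      also have "\<dots> = ((x + 1) * cnj (x + 1)) ^ m" by (simp only: complex_norm_square)
      finally show ?thesis by (simp only: power_mult_distrib complex_cnj_power)
    qed
    also have "\<dots> = (\<Sum>j\<le>m. ?c j * x ^ j) * (\<Sum>k\<le>m. ?c k * cnj x ^ k)"
      by (simp add: binomial_ring)
    finally show ?thesis by (simp add: sum_product mult_ac)
  qed
  have i: "set_integrable lborel (cball 0 1) (\<lambda>x::complex. c * (x ^ j * cnj x ^ k))" for c j k
    unfolding set_integrable_def by (intro borel_integrable_compact continuous_intros) auto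
  have "complex_of_real (LINT x:cball 0 1|lborel. norm (1 + x::complex) ^ (2 * m))
      = (LINT x:cball 0 1|lborel. \<Sum>j\<le>m. \<Sum>k\<le>m. ?c j * ?c k * (x ^ j * cnj x ^ k))"
    unfolding ex[symmetric] set_lebesgue_integral_def
    by (simp add: scaleR_conv_of_real flip: integral_complex_of_real)
  also have "\<dots> = (\<Sum>j\<le>m. \<Sum>k\<le>m. LINT x:cball 0 1|lborel. ?c j * ?c k * (x ^ j * cnj x ^ k))"
    using i unfolding set_lebesgue_integral_def set_integrable_def scaleR_sum_right
    by (subst Bochner_Integration.integral_sum; (intro Bochner_Integration.integrable_sum sum.cong refl)?;
        (subst Bochner_Integration.integral_sum)?; auto)
  also have "\<dots> = (\<Sum>j\<le>m. \<Sum>k\<le>m. ?c j * ?c k * (if j = k then of_real (pi / (real j + 1)) else 0))"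
    by (intro sum.cong refl) (simp only: set_integral_mult_right integral_unit_disc_monomials)
  also have "\<dots> = complex_of_real (\<Sum>j\<le>m. pi * (real (m choose j) ^ 2 / (real j + 1)))"
    by (simp add: if_distrib power2_eq_square mult_ac cong: if_cong)
  also have "(\<Sum>j\<le>m. pi * (real (m choose j) ^ 2 / (real j + 1))) = pi * real (2 * m + 1 choose m) / (real m + 1)"
    unfolding sum_distrib_left[symmetric] sum_binomial_sq_div by simp
  finally have val: "(LINT x:cball 0 1|lborel. norm (1 + x::complex) ^ (2 * m)) = pi * real (2 * m + 1 choose m) / (real m + 1)"
    by (simp only: of_real_eq_iff)
  have "(\<integral>\<^sup>+x\<in>cball 0 1. ennreal (norm (1 + x::complex) ^ (2 * m)) \<partial>lborel)
      = (\<integral>\<^sup>+x. ennreal (indicator (cball 0 1) x *\<^sub>R norm (1 + x::complex) ^ (2 * m)) \<partial>lborel)"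
    by (intro nn_integral_cong) (auto simp: indicator_def)
  also have "\<dots> = ennreal (LINT x:cball 0 1|lborel. norm (1 + x::complex) ^ (2 * m))"
    unfolding set_lebesgue_integral_def
    by (intro nn_integral_eq_integral borel_integrable_compact continuous_intros AE_I2) auto
  finally show ?thesis unfolding val .
qed

text \<open>The similarity \<open>x \<mapsto> a * x + a\<close> maps the unit disc onto a disc with
  0 on its boundary.\<close>

lemma nn_integral_disc_power:
  assumes a: "(a::complex) \<noteq> 0"
  shows "(\<integral>\<^sup>+x\<in>cball a (norm a). ennreal (norm x ^ (2 * m)) \<partial>lborel)
    = ennreal (norm a ^ (2 * m + 2) * (pi * real (2 * m + 1 choose m) / (real m + 1)))"
proof -
  let ?F = "\<lambda>x. ennreal (norm x ^ (2 * m)) * indicator (cball a (norm a)) x"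
  let ?I = "\<integral>\<^sup>+x. ?F x \<partial>lborel"
  have [measurable]: "cball a (norm a) \<in> sets borel" "cball (0::complex) 1 \<in> sets borel" by auto
  have m [measurable]: "?F \<in> borel_measurable borel" by measurable
  have "?I = (\<integral>\<^sup>+x. ?F (x + a) \<partial>lborel)" by (rule nn_integral_lborel_translation[symmetric]) measurable
  then have "ennreal (1 / norm a ^ DIM(complex)) * ?I = (\<integral>\<^sup>+x. ?F (a * x + a) \<partial>lborel)"
    using a by (subst nn_integral_lborel_similarity[where c = "norm a" and T = "\<lambda>x. a * x" and g = "\<lambda>x. ?F (x + a)"])
      (auto simp: norm_mult intro: bounded_linear.linear bounded_linear_mult_right)
  also have "\<dots> = (\<integral>\<^sup>+x. ennreal (norm a ^ (2 * m)) * (ennreal (norm (1 + x::complex) ^ (2 * m)) * indicator (cball 0 1) x) \<partial>lborel)"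
  proof (rule nn_integral_cong)
    fix x
    have n: "norm (a * x + a) = norm a * norm (1 + x)"
      by (simp add: add.commute flip: norm_mult distrib_left[of a x 1, simplified])
    moreover have "a * x + a \<in> cball a (norm a) \<longleftrightarrow> x \<in> cball 0 1"
      using a by (simp add: dist_norm norm_mult mult_le_cancel_left1)
    ultimately show "?F (a * x + a) = ennreal (norm a ^ (2 * m)) * (ennreal (norm (1 + x) ^ (2 * m)) * indicator (cball 0 1) x)"
      by (simp add: indicator_def power_mult_distrib ennreal_mult')
  qed
  also have "\<dots> = ennreal (norm a ^ (2 * m)) * (\<integral>\<^sup>+x\<in>cball 0 1. ennreal (norm (1 + x::complex) ^ (2 * m)) \<partial>lborel)"
    by (rule nn_integral_cmult) measurable
  finally have e: "ennreal (1 / (norm a)\<^sup>2) * ?I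
      = ennreal (norm a ^ (2 * m)) * ennreal (pi * real (2 * m + 1 choose m) / (real m + 1))"
    unfolding nn_integral_unit_disc_shifted_power by simp
  have "?I = ennreal ((norm a)\<^sup>2) * (ennreal (1 / (norm a)\<^sup>2) * ?I)"
    using a by (simp add: mult.assoc[symmetric] flip: ennreal_mult')
  also have "\<dots> = ennreal (norm a ^ (2 * m + 2) * (pi * real (2 * m + 1 choose m) / (real m + 1)))"
    unfolding e by (simp add: power_add power2_eq_square mult_ac flip: ennreal_mult')
  finally show ?thesis .
qed

section \<open>The Lelong class and the relative capacity\<close>

text \<open>Real valued even where \<open>u\<close> is negative infinity, and nonnegative, so
  nonnegative integrals apply. Nothing is lost, because the zero function already competes in the
  supremum defining the extremal function.\<close>

definition pos_part :: "('a \<Rightarrow> ereal) \<Rightarrow> 'a \<Rightarrow> real" where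
  "pos_part u z = real_of_ereal (max (u z) 0)"

lemma ereal_pos_part: "u z < \<infinity> \<Longrightarrow> ereal (pos_part u z) = max (u z) 0"
  unfolding pos_part_def by (cases "u z") (auto simp: max_def)

lemma pos_part_nonneg: "0 \<le> pos_part u z"
  unfolding pos_part_def by (intro real_of_ereal_pos) simp

lemma pos_part_eq_0: "u z \<le> 0 \<Longrightarrow> pos_part u z = 0"
  unfolding pos_part_def by (simp add: max_def)

lemma e2ennreal_pos_part: "u z < \<infinity> \<Longrightarrow> e2ennreal (u z) = ennreal (pos_part u z)"
  unfolding pos_part_def by (cases "u z") (auto simp: max_def e2ennreal_neg ennreal_neg ennreal.rep_eq e2ennreal_ereal)

lemma lelong_class_growth:
  assumes "u \<in> lelong_class"
  obtains C where "C \<ge> 0" "\<And>z. pos_part u z \<le> C + log_plus (norm z)"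
proof -
  have "(SUP z. u z - ereal (log_plus (norm z))) < \<infinity>" using assms by (simp add: lelong_class_def)
  then obtain n :: nat where n: "(SUP z. u z - ereal (log_plus (norm z))) < ereal (real n)"
    by (auto simp: less_PInf_Ex_of_nat)
  have "pos_part u z \<le> real n + log_plus (norm z)" for z
  proof -
    have lp: "log_plus (norm z) \<ge> 0" by (simp add: log_plus_def)
    have fin: "u z < \<infinity>" using assms by (simp add: lelong_class_def plurisubharmonic_def)
    have "u z - ereal (log_plus (norm z)) \<le> ereal (real n)"
      using n by (meson SUP_upper UNIV_I le_less_trans less_imp_le)
    then show ?thesis using lp fin unfolding pos_part_def
      by (cases "u z") (auto simp: max_def)
  qed
  then show ?thesis using that[of "real n"] by simp
qed

text \<open>Where \<open>u\<close> is at most 0, the mean value inequality for the positive part is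
  trivial; elsewhere it follows from that for \<open>u\<close> by dropping the negative part of the
  circle integral.\<close>

lemma log_subharmonic_line:
  assumes u: "u \<in> lelong_class"
  shows "log_subharmonic (\<lambda>\<zeta>. pos_part u (a + \<zeta> *s b))"
  unfolding log_subharmonic_def
proof (intro conjI allI)
  let ?U = "\<lambda>\<zeta>. pos_part u (a + \<zeta> *s b)"
  have psh: "plurisubharmonic u" using u by (simp add: lelong_class_def)
  then have fin: "u z < \<infinity>" for z by (simp add: plurisubharmonic_def)
  fix c
  show "open {\<zeta>. ?U \<zeta> < c}"
  proof (cases "c \<le> 0")
    case True
    have "\<not> ?U \<zeta> < c" for \<zeta> using pos_part_nonneg[of u "a + \<zeta> *s b"] True by linarith
    then show ?thesis by simp
  next
    case False
    have "open {z. u z < ereal c}" using psh by (simp add: plurisubharmonic_def usc_def)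
    moreover have "continuous_on UNIV (\<lambda>\<zeta>. a + \<zeta> *s b)" by (intro continuous_intros)
    ultimately have "open ((\<lambda>\<zeta>. a + \<zeta> *s b) -` {z. u z < ereal c})"
      by (intro open_vimage)
    moreover have "?U \<zeta> < c \<longleftrightarrow> u (a + \<zeta> *s b) < ereal c" for \<zeta>
    proof -
      have "?U \<zeta> < c \<longleftrightarrow> max (u (a + \<zeta> *s b)) 0 < ereal c"
        using ereal_pos_part[of u "a + \<zeta> *s b", OF fin] by (metis ereal_less_eq(3) not_less)
      moreover have "0 < ereal c" using False by simp
      ultimately show ?thesis by (simp only: max_less_iff_conj simp_thms)
    qed
    ultimately show ?thesis by (simp add: vimage_def)
  qed
next
  show "0 \<le> pos_part u (a + z *s b)" for z by (rule pos_part_nonneg)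
next
  obtain C where C: "C \<ge> 0" "\<And>z. pos_part u z \<le> C + log_plus (norm z)"
    using lelong_class_growth[OF u] by blast
  define A where "A = 1 + norm a + norm b"
  have A: "A \<ge> 1" by (simp add: A_def)
  show "\<exists>C. \<forall>\<zeta>. pos_part u (a + \<zeta> *s b) \<le> C + ln (1 + norm \<zeta>)"
  proof (intro exI allI)
    fix \<zeta>
    let ?r = "norm (a + \<zeta> *s b)"
    have "?r \<le> norm a + norm \<zeta> * norm b" by (metis norm_triangle_ineq norm_vector_smult)
    also have "\<dots> \<le> A * (1 + norm \<zeta>)" by (simp add: A_def algebra_simps)
    finally have r: "?r \<le> A * (1 + norm \<zeta>)" .
    have A1: "1 \<le> A * (1 + norm \<zeta>)" using A mult_mono[of 1 A 1 "1 + norm \<zeta>"] by simp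
    have "log_plus ?r \<le> ln (A * (1 + norm \<zeta>))"
    proof (cases "?r \<le> 1")
      case True then show ?thesis using A1 by (simp add: log_plus_def)
    next
      case False
      then have "ln ?r \<le> ln (A * (1 + norm \<zeta>))" using r by (intro ln_mono) auto
      then show ?thesis using False by (simp add: log_plus_def)
    qed
    also have "\<dots> = ln A + ln (1 + norm \<zeta>)" using A by (intro ln_mult_pos) (auto intro: add_pos_nonneg)
    finally show "pos_part u (a + \<zeta> *s b) \<le> (C + ln A) + ln (1 + norm \<zeta>)" using C(2)[of "a + \<zeta> *s b"] by simp
  qed
next
  fix \<alpha> \<beta>
  let ?U = "\<lambda>\<zeta>. pos_part u (a + \<zeta> *s b)"
  have psh: "plurisubharmonic u" using u by (simp add: lelong_class_def)
  then have fin: "u z < \<infinity>" for z by (simp add: plurisubharmonic_def)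
  let ?c = "a + \<alpha> *s b" and ?d = "\<beta> *s b"
  define P where "P = (\<integral>\<^sup>+t\<in>{0..2 * pi}. e2ennreal (u (?c + cis t *s ?d)) \<partial>lborel)"
  have P: "P = (\<integral>\<^sup>+t\<in>{0..2 * pi}. ennreal (?U (\<alpha> + cis t * \<beta>)) \<partial>lborel)"
    unfolding P_def by (intro nn_integral_cong)
      (simp add: e2ennreal_pos_part[of u, OF fin] vector_sadd_rdistrib vector_smult_assoc add.assoc)
  show "ennreal (2 * pi * ?U \<alpha>) \<le> (\<integral>\<^sup>+t\<in>{0..2 * pi}. ennreal (?U (\<alpha> + cis t * \<beta>)) \<partial>lborel)"
  proof (cases "u ?c \<le> 0")
    case True
    then show ?thesis by (simp add: pos_part_eq_0)
  next
    case False
    then have uc: "u ?c = ereal (?U \<alpha>)" using ereal_pos_part[of u ?c, OF fin] by (simp add: max_def split: if_splits)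
    have "u ?c \<le> ereal_integral {0..2 * pi} (\<lambda>t. u (?c + cis t *s ?d)) / ereal (2 * pi)"
      using psh unfolding plurisubharmonic_def by blast
    also have "\<dots> \<le> enn2ereal P / ereal (2 * pi)"
      unfolding ereal_integral_def P_def[symmetric]
      by (intro ereal_divide_right_mono ereal_diff_le_self) auto
    finally have "ereal (?U \<alpha>) * ereal (2 * pi) \<le> enn2ereal P"
      unfolding uc by (subst (asm) ereal_le_divide_pos) (auto simp: mult.commute)
    then have "e2ennreal (ereal (2 * pi * ?U \<alpha>)) \<le> e2ennreal (enn2ereal P)"
      by (intro e2ennreal_mono) (simp add: mult.commute)
    then show ?thesis unfolding P[symmetric] by (simp add: e2ennreal_ereal)
  qed
qed

lemma zero_in_lelong_class: "(\<lambda>_. 0) \<in> lelong_class"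
proof -
  have "usc (\<lambda>_ :: complex ^ 'n. 0)" by (auto simp: usc_def)
  moreover have "(SUP z :: complex ^ 'n. 0 - ereal (log_plus (norm z))) < \<infinity>"
  proof (rule le_less_trans)
    show "(SUP z :: complex ^ 'n. 0 - ereal (log_plus (norm z))) \<le> 0"
      by (rule SUP_least) (auto simp: log_plus_def zero_ereal_def)
  qed simp
  moreover have "ereal_integral S (\<lambda>_. 0) = 0" for S :: "real set"
    by (simp add: ereal_integral_def e2ennreal_neg)
  ultimately show ?thesis
    unfolding lelong_class_def plurisubharmonic_def by (auto simp: zero_ereal_def[symmetric])
qed

lemma extremal_fun_nonneg: "0 \<le> extremal_fun K z"
  unfolding extremal_fun_def by (rule SUP_upper2[of "\<lambda>_. 0"]) (auto simp: zero_in_lelong_class)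

lemma usc_regularization_extremal_fun_nonneg: "0 \<le> usc_regularization (extremal_fun K) z"
  unfolding usc_regularization_def by (rule le_Limsup) (auto simp: extremal_fun_nonneg)

text \<open>A point of \<open>B\<close> makes the supremum nonnegative, which rules out the branch
  with value \<open>undefined\<close>.\<close>

lemma rel_log_capacity_nonneg:
  assumes "B \<noteq> {}"
  shows "0 \<le> rel_log_capacity B K"
proof -
  obtain z where "z \<in> B" using assms by auto
  then have "0 \<le> (SUP z\<in>B. usc_regularization (extremal_fun K) z)"
    by (rule SUP_upper2) (rule usc_regularization_extremal_fun_nonneg)
  then show ?thesis unfolding rel_log_capacity_def by (auto split: ereal.split)
qed

text \<open>The regularization is taken in the whole space, so the bound is required on a full
  neighborhood of each point of \<open>B\<close>, uniformly in \<open>u\<close>. The supremum then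
  lies between 0 and \<open>M\<close>, hence is finite.\<close>

lemma rel_log_capacity_ge:
  assumes B: "B \<noteq> {}"
    and le: "\<And>z. z \<in> B \<Longrightarrow> \<forall>\<^sub>F w in nhds z. \<forall>u\<in>lelong_class. (\<forall>x\<in>K. u x \<le> 0) \<longrightarrow> pos_part u w \<le> M"
  shows "exp (- M) \<le> rel_log_capacity B K"
proof -
  let ?S = "SUP z\<in>B. usc_regularization (extremal_fun K) z"
  obtain z where "z \<in> B" using B by auto
  then have S0: "0 \<le> ?S"
    by (rule SUP_upper2) (rule usc_regularization_extremal_fun_nonneg)
  have "usc_regularization (extremal_fun K) z \<le> ereal M" if "z \<in> B" for z
    unfolding usc_regularization_def
  proof (rule Limsup_bounded, rule eventually_mono[OF le[OF that]])
    fix w assume w: "\<forall>u\<in>lelong_class. (\<forall>x\<in>K. u x \<le> 0) \<longrightarrow> pos_part u w \<le> M"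
    show "extremal_fun K w \<le> ereal M"
      unfolding extremal_fun_def
    proof (rule SUP_least)
      fix u assume u: "u \<in> {u \<in> lelong_class. \<forall>x\<in>K. u x \<le> 0}"
      then have "u w < \<infinity>" by (simp add: lelong_class_def plurisubharmonic_def)
      then have "u w \<le> ereal (pos_part u w)" by (simp add: ereal_pos_part)
      also have "\<dots> \<le> ereal M" using w u by simp
      finally show "u w \<le> ereal M" .
    qed
  qed
  then have "?S \<le> ereal M" by (rule SUP_least)
  with S0 show ?thesis unfolding rel_log_capacity_def by (cases ?S) auto
qed

section \<open>Complex balls\<close>

lemma power2_norm_vec: "(norm (x :: complex ^ 'n))\<^sup>2 = (\<Sum>i\<in>UNIV. (norm (x $ i))\<^sup>2)"
  unfolding norm_vec_def L2_set_def by (simp add: sum_nonneg)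

text \<open>Completing the square in \<zeta>. The hypothesis on \<open>b\<close> says that 0 belongs
  to the disc, which is the bound on the center.\<close>

lemma complex_line_Int_cball:
  fixes y b :: "complex ^ 'n"
  assumes y: "y \<noteq> 0" and b: "norm b \<le> r"
  obtains \<zeta>0 s where "norm \<zeta>0 \<le> s" "{\<zeta>. norm (\<zeta> *s y - b) \<le> r} = cball \<zeta>0 s"
proof -
  define N where "N = (norm y)\<^sup>2"
  have N: "N > 0" using y by (simp add: N_def)
  define H where "H = (\<Sum>i\<in>UNIV. b $ i * cnj (y $ i))"
  define \<zeta>0 where "\<zeta>0 = H / of_real N"
  define s where "s = sqrt ((r\<^sup>2 - (norm b)\<^sup>2) / N + (norm \<zeta>0)\<^sup>2)"
  have rb: "0 \<le> (r\<^sup>2 - (norm b)\<^sup>2) / N" using b N by (simp add: power_mono)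
  have r: "0 \<le> r" using b norm_ge_zero order_trans by blast
  have expand: "(norm (\<zeta> *s y - b))\<^sup>2 = N * (norm (\<zeta> - \<zeta>0))\<^sup>2 + (norm b)\<^sup>2 - N * (norm \<zeta>0)\<^sup>2" for \<zeta>
  proof -
    have diff: "(norm (p - q))\<^sup>2 = (norm p)\<^sup>2 - 2 * Re (p * cnj q) + (norm q)\<^sup>2" for p q :: complex
      unfolding cmod_power2 by (simp add: power2_eq_square algebra_simps)
    have "(norm (\<zeta> *s y - b))\<^sup>2 = (\<Sum>i\<in>UNIV. (norm \<zeta>)\<^sup>2 * (norm (y $ i))\<^sup>2 - 2 * Re (\<zeta> * cnj (b $ i * cnj (y $ i))) + (norm (b $ i))\<^sup>2)"
      unfolding power2_norm_vec by (intro sum.cong refl) (simp add: diff norm_mult power_mult_distrib mult_ac)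
    also have "\<dots> = (norm \<zeta>)\<^sup>2 * N - 2 * Re (\<zeta> * cnj H) + (norm b)\<^sup>2"
      by (simp add: sum.distrib sum_subtractf N_def H_def power2_norm_vec sum_distrib_left)
    also have "Re (\<zeta> * cnj H) = N * Re (\<zeta> * cnj \<zeta>0)"
    proof -
      have "H = of_real N * \<zeta>0" using N by (simp add: \<zeta>0_def)
      then have "\<zeta> * cnj H = of_real N * (\<zeta> * cnj \<zeta>0)" by (simp add: mult_ac)
      then show ?thesis by (simp only:) simp
    qed
    finally show ?thesis by (simp add: diff algebra_simps)
  qed
  have s2: "s\<^sup>2 = (r\<^sup>2 - (norm b)\<^sup>2) / N + (norm \<zeta>0)\<^sup>2" using rb by (simp add: s_def)
  have s0: "0 \<le> s" using rb by (simp add: s_def)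
  have "norm (\<zeta> *s y - b) \<le> r \<longleftrightarrow> norm (\<zeta> - \<zeta>0) \<le> s" for \<zeta>
  proof -
    have "norm (\<zeta> *s y - b) \<le> r \<longleftrightarrow> (norm (\<zeta> *s y - b))\<^sup>2 \<le> r\<^sup>2"
      using abs_le_square_iff[of "norm (\<zeta> *s y - b)" r] r by simp
    also have "\<dots> \<longleftrightarrow> N * (norm (\<zeta> - \<zeta>0))\<^sup>2 \<le> N * s\<^sup>2"
      unfolding expand s2 using N by (simp add: distrib_left)  linarith
    also have "\<dots> \<longleftrightarrow> (norm (\<zeta> - \<zeta>0))\<^sup>2 \<le> s\<^sup>2" using N by simp
    also have "\<dots> \<longleftrightarrow> norm (\<zeta> - \<zeta>0) \<le> s"
      using abs_le_square_iff[of "norm (\<zeta> - \<zeta>0)" s] s0 by simp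
    finally show ?thesis .
  qed
  then have "{\<zeta>. norm (\<zeta> *s y - b) \<le> r} = cball \<zeta>0 s"
    by (simp only: cball_def dist_norm norm_minus_commute[of \<zeta>0])
  moreover have "norm \<zeta>0 \<le> s" using rb unfolding s_def by (intro real_le_rsqrt) simp
  ultimately show ?thesis by (intro that)
qed

definition ball_const :: "nat \<Rightarrow> real" where
  "ball_const n = 4 ^ n * (fact n)\<^sup>2 / fact (2 * n - 1)"

lemma ball_const_pos: "ball_const n > 0"
  by (simp add: ball_const_def)

text \<open>The second factor is, up to \<open>pi\<close>, the integral in
  \<open>nn_integral_unit_disc_shifted_power\<close>; the power of 4 comes from halving a diameter
  in real dimension \<open>2 * Suc m\<close>.\<close>

lemma ball_const_Suc: "ball_const (Suc m) * (real (2 * m + 1 choose m) / (real m + 1)) = 4 ^ Suc m"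
proof -
  have "real (2 * m + 1 choose m) = fact (2 * m + 1) / (fact m * fact (Suc m))"
    by (subst binomial_fact) (simp_all add: Suc_diff_le)
  moreover have "fact (Suc m) = (real m + 1) * fact m" by simp
  ultimately show ?thesis
    by (simp add: ball_const_def power2_eq_square del: fact_Suc)
qed

text \<open>On the left the density is bounded by its maximum \<open>D ^ (2 * m)\<close> and the
  area by the section estimate. On the right the disc is reduced to one of diameter \<open>D\<close>
  with 0 on its boundary, whose integral is known.\<close>

lemma nn_integral_section_le:
  fixes E :: "complex set"
  assumes U: "log_subharmonic U" and E: "E \<in> sets borel" "E \<subseteq> cball \<zeta>0 s" and s: "norm \<zeta>0 \<le> s"
    and UE: "\<And>w. w \<in> E \<Longrightarrow> U w \<le> 0"
  shows "(\<integral>\<^sup>+c. indicator E c * ennreal (norm c ^ (2 * m)) \<partial>lborel)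
    \<le> ennreal (ball_const (Suc m) * exp (- 2 * U 0)) * (\<integral>\<^sup>+c. indicator (cball \<zeta>0 s) c * ennreal (norm c ^ (2 * m)) \<partial>lborel)"
proof -
  define D where "D = norm \<zeta>0 + s"
  let ?C = "ennreal (ball_const (Suc m) * exp (- 2 * U 0))"
  let ?q = "pi * real (2 * m + 1 choose m) / (real m + 1)"
  let ?I = "\<integral>\<^sup>+c. indicator (cball \<zeta>0 s) c * ennreal (norm c ^ (2 * m)) \<partial>lborel"
  have s0: "0 \<le> s" using s norm_ge_zero order_trans by blast
  have D: "0 \<le> D" using s0 by (simp add: D_def)
  have ED: "norm w \<le> D" if "w \<in> E" for w
  proof -
    have "norm (w - \<zeta>0) \<le> s" using that E(2) by (auto simp: dist_norm norm_minus_commute)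
    then show ?thesis using norm_triangle_ineq[of "w - \<zeta>0" \<zeta>0] by (simp add: D_def)
  qed
  have "(\<integral>\<^sup>+c. indicator E c * ennreal (norm c ^ (2 * m)) \<partial>lborel)
      \<le> (\<integral>\<^sup>+c. ennreal (D ^ (2 * m)) * indicator E c \<partial>lborel)"
    using ED D by (intro nn_integral_mono) (auto simp: indicator_def intro!: ennreal_leI power_mono)
  also have "\<dots> = ennreal (D ^ (2 * m)) * emeasure lborel E"
    using E by (subst nn_integral_cmult_indicator) auto
  also have "\<dots> \<le> ennreal (D ^ (2 * m)) * ennreal (pi * D\<^sup>2 * exp (2 * (0 - U 0)))"
    by (intro mult_left_mono emeasure_complex_section_le[OF U E(1) D]) (use UE ED in auto)
  also have "\<dots> = ennreal (D ^ (2 * m + 2) * pi * exp (- 2 * U 0))"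
    using D by (simp add: power_add power2_eq_square mult_ac flip: ennreal_mult')
  also have "\<dots> \<le> ?C * ?I"
  proof (cases "D = 0")
    case True
    then show ?thesis by simp
  next
    case False
    then have D0: "D > 0" using D by simp
    \<comment> \<open>The midpoint between 0 and a point of the disc farthest from 0. The disc about
      \<open>a\<close> through 0 touches the given circle from inside at that point; if \<zeta>0 is
      0, any direction will do.\<close>
    define a where "a = of_real (D / 2) * (if \<zeta>0 = 0 then 1 else \<zeta>0 / of_real (norm \<zeta>0))"
    have na: "norm a = D / 2" using D by (simp add: a_def norm_mult norm_divide)
    have na0: "norm (a - \<zeta>0) = D / 2 - norm \<zeta>0"
    proof (cases "\<zeta>0 = 0")
      case True then show ?thesis using na by simp
    next
      case False
      then have "a - \<zeta>0 = of_real (D / 2 - norm \<zeta>0) * (\<zeta>0 / of_real (norm \<zeta>0))"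
        by (simp add: a_def algebra_simps)
      then have "norm (a - \<zeta>0) = \<bar>D / 2 - norm \<zeta>0\<bar>"
        using False by (simp only: norm_mult norm_of_real norm_divide) simp
      then show ?thesis using s by (simp add: D_def)
    qed
    have "dist a \<zeta>0 + norm a \<le> s" unfolding dist_norm na0 na D_def by (simp add: field_simps)
    then have sub: "cball a (norm a) \<subseteq> cball \<zeta>0 s" by (simp add: cball_subset_cball_iff)
    have "ennreal (D ^ (2 * m + 2) * pi * exp (- 2 * U 0))
        = ?C * ennreal (norm a ^ (2 * m + 2) * ?q)"
    proof -
      have "norm a ^ (2 * m + 2) * 4 ^ Suc m = D ^ (2 * m + 2)"
      proof -
        have "(4::real) ^ Suc m = 2 ^ (2 * m + 2)" using power_mult[of "2::real" 2 "Suc m"] by simp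
        then show ?thesis unfolding na by (simp only: power_mult_distrib[symmetric]) simp
      qed
      then have e: "4 ^ Suc m * norm a ^ (2 * m + 2) = D ^ (2 * m + 2)" by (simp only: mult.commute)
      have "ball_const (Suc m) * exp (- 2 * U 0) * (norm a ^ (2 * m + 2) * ?q)
        = (ball_const (Suc m) * (real (2 * m + 1 choose m) / (real m + 1))) * norm a ^ (2 * m + 2) * pi * exp (- 2 * U 0)"
        by (simp only: times_divide_eq_right times_divide_eq_left mult_ac)
      also have "\<dots> = D ^ (2 * m + 2) * pi * exp (- 2 * U 0)"
        by (simp only: ball_const_Suc e)
      finally have "ball_const (Suc m) * exp (- 2 * U 0) * (norm a ^ (2 * m + 2) * ?q)
        = D ^ (2 * m + 2) * pi * exp (- 2 * U 0)" .
      then show ?thesis using ball_const_pos[of "Suc m"] by (simp flip: ennreal_mult')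
    qed
    also have "\<dots> \<le> ?C * ?I"
    proof (rule mult_left_mono)
      have "a \<noteq> 0" using na D0 by auto
      from nn_integral_disc_power[OF this, of m]
      have "ennreal (norm a ^ (2 * m + 2) * ?q)
          = (\<integral>\<^sup>+c\<in>cball a (norm a). ennreal (norm c ^ (2 * m)) \<partial>lborel)" ..
      also have "\<dots> \<le> ?I"
        using sub by (intro nn_integral_mono) (auto simp: indicator_def)
      finally show "ennreal (norm a ^ (2 * m + 2) * ?q)
          \<le> ?I" .
    qed simp
    finally show ?thesis .
  qed
  finally show ?thesis .
qed

text \<open>Translation moves \<open>z\<close> to the origin; then \<open>K\<close> and the ball are
  compared on each complex line through it.\<close>

lemma measure_le_lelong_ball:
  fixes K :: "(complex ^ 'n) set"
  assumes u: "u \<in> lelong_class" "\<And>x. x \<in> K \<Longrightarrow> u x \<le> 0"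
    and K: "K \<in> sets borel" "K \<subseteq> cball a r" and z: "z \<in> cball a r"
  shows "measure lborel K \<le> ball_const CARD('n) * exp (- 2 * pos_part u z) * measure lborel (cball a r)"
proof -
  interpret homogeneous_measure "lborel :: (complex ^ 'n) measure" "\<lambda>c y. c *s y" "2 * CARD('n)"
    by (rule homogeneous_measure_lborel_complex)
  obtain m where m: "CARD('n) = Suc m" using not0_implies_Suc[of "CARD('n)"] by auto
  define C where "C = ball_const CARD('n) * exp (- 2 * pos_part u z)"
  have C: "C \<ge> 0" using ball_const_pos[of "CARD('n)"] by (simp add: C_def)
  let ?t = "\<lambda>S. (\<lambda>x. x + z) -` S :: (complex ^ 'n) set"
  have t: "?t S \<in> sets borel" if "S \<in> sets borel" for S
    by (rule measurable_sets_borel[OF _ that]) measurable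
  have et: "emeasure lborel (?t S) = emeasure lborel S" if "S \<in> sets borel" for S
  proof -
    have "emeasure lborel (?t S) = (\<integral>\<^sup>+x. indicator (?t S) x \<partial>lborel)"
      using t[OF that] by simp
    also have "\<dots> = (\<integral>\<^sup>+x. indicator S (x + z) \<partial>lborel)"
      by (intro nn_integral_cong) (simp add: indicator_def)
    also have "\<dots> = (\<integral>\<^sup>+x. indicator S x \<partial>lborel)"
      by (rule nn_integral_lborel_translation) (use that in simp)
    finally show ?thesis using that by simp
  qed
  have w: "AE c in lborel. weight c = ennreal (norm c ^ (2 * m))"
  proof (rule eventually_mono[OF AE_lborel_singleton[of 0]])
    fix c :: complex assume "c \<noteq> 0"
    then show "weight c = ennreal (norm c ^ (2 * m))"
      unfolding weight_def unfolding m by (simp add: power2_eq_square)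
  qed
  have "emeasure lborel (?t K) \<le> ennreal C * emeasure lborel (?t (cball a r))"
  proof (rule emeasure_le_if_sections_le[of _ _ UNIV])
    fix y :: "complex ^ 'n" assume y: "y \<noteq> 0"
    have "norm (a - z) \<le> r" using z by (simp add: dist_norm)
    then obtain \<zeta>0 s where disc: "norm \<zeta>0 \<le> s" "{\<zeta>. norm (\<zeta> *s y - (a - z)) \<le> r} = cball \<zeta>0 s"
      by (rule complex_line_Int_cball[OF y])
    have B: "\<zeta> *s y \<in> ?t (cball a r) \<longleftrightarrow> \<zeta> \<in> cball \<zeta>0 s" for \<zeta>
      unfolding disc(2)[symmetric] by (simp add: dist_norm norm_minus_commute algebra_simps)
    define E where "E = (\<lambda>\<zeta>. z + \<zeta> *s y) -` K"
    have E: "E \<in> sets borel" unfolding E_def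
      by (rule measurable_sets_borel[OF borel_measurable_continuous_onI K(1)]) (intro continuous_intros)
    have EK: "\<zeta> *s y \<in> ?t K \<longleftrightarrow> \<zeta> \<in> E" for \<zeta> by (simp add: E_def add.commute)
    have sub: "E \<subseteq> cball \<zeta>0 s"
    proof
      fix \<zeta> assume "\<zeta> \<in> E"
      then have "\<zeta> *s y \<in> ?t (cball a r)" using EK[of \<zeta>] K(2) by blast
      then show "\<zeta> \<in> cball \<zeta>0 s" using B[of \<zeta>] by simp
    qed
    have "(\<integral>\<^sup>+c. indicator (?t K) (c *s y) * weight c \<partial>lborel) = (\<integral>\<^sup>+c. indicator E c * ennreal (norm c ^ (2 * m)) \<partial>lborel)"
      by (rule nn_integral_cong_AE, rule eventually_mono[OF w]) (simp only: indicator_def EK)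
    also have "\<dots> \<le> ennreal C * (\<integral>\<^sup>+c. indicator (cball \<zeta>0 s) c * ennreal (norm c ^ (2 * m)) \<partial>lborel)"
    proof -
      have "pos_part u (z + w *s y) \<le> 0" if "w \<in> E" for w
        using u(2)[of "z + w *s y"] that by (simp add: E_def pos_part_eq_0)
      from nn_integral_section_le[OF log_subharmonic_line[OF u(1), of z y] E sub disc(1) this, of m]
      show ?thesis unfolding C_def m by simp
    qed
    also have "(\<integral>\<^sup>+c. indicator (cball \<zeta>0 s) c * ennreal (norm c ^ (2 * m)) \<partial>lborel) = (\<integral>\<^sup>+c. indicator (?t (cball a r)) (c *s y) * weight c \<partial>lborel)"
      by (rule nn_integral_cong_AE, rule eventually_mono[OF w]) (simp only: indicator_def B)
    finally show "(\<integral>\<^sup>+c. indicator (?t K) (c *s y) * weight c \<partial>lborel)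
        \<le> ennreal C * (\<integral>\<^sup>+c. indicator (?t (cball a r)) (c *s y) * weight c \<partial>lborel)" .
  qed (use t K in auto)
  then have "emeasure lborel K \<le> ennreal C * emeasure lborel (cball a r)" using K by (simp add: et)
  moreover have "emeasure lborel K = ennreal (measure lborel K)"
    using K by (intro emeasure_eq_measure2 fmeasurable_bounded_borel) (auto intro: bounded_subset)
  moreover have "emeasure lborel (cball a r) = ennreal (measure lborel (cball a r))"
    by (intro emeasure_eq_measure2 fmeasurable_bounded_borel) auto
  ultimately show ?thesis using C by (simp add: C_def flip: ennreal_mult')
qed

text \<open>The estimate in a concentric ball of radius \<open>R > r\<close> provides the
  neighborhoods that the regularization asks for; at the end \<open>R\<close> tends to
  \<open>r\<close>.\<close>

lemma measure_ratio_le_ball: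
  fixes K :: "(complex ^ 'n) set"
  assumes r: "r > 0" and K: "K \<in> sets borel" "K \<subseteq> cball a r"
  shows "measure lborel K / measure lborel (cball a r) \<le> ball_const CARD('n) * (rel_log_capacity (cball a r) K)\<^sup>2"
proof (cases "measure lborel K = 0")
  case True
  then show ?thesis using ball_const_pos[of "CARD('n)"] by simp
next
  case False
  then have k: "measure lborel K > 0" by (simp add: order_less_le)
  let ?T = "rel_log_capacity (cball a r) K"
  let ?c = "ball_const CARD('n)"
  have c: "?c > 0" by (rule ball_const_pos)
  have main: "measure lborel K \<le> ?c * ?T\<^sup>2 * measure lborel (cball a R)" if R: "R > r" for R
  proof -
    let ?V = "measure lborel (cball a R)"
    have V: "?V > 0" using R r by (intro content_cball_pos) simp
    define M where "M = ln (?c * ?V / measure lborel K) / 2"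
    have "exp (- M) \<le> ?T"
    proof (rule rel_log_capacity_ge)
      fix z assume z: "z \<in> cball a r"
      have "\<forall>\<^sub>F w in nhds z. w \<in> ball a R"
        using z R by (intro eventually_nhds_in_open) auto
      then show "\<forall>\<^sub>F w in nhds z. \<forall>u\<in>lelong_class. (\<forall>x\<in>K. u x \<le> 0) \<longrightarrow> pos_part u w \<le> M"
      proof eventually_elim
        case (elim w)
        show ?case
        proof (intro ballI impI)
          fix u assume u: "u \<in> lelong_class" "\<forall>x\<in>K. u x \<le> 0"
          have "measure lborel K \<le> ?c * exp (- 2 * pos_part u w) * ?V"
            by (rule measure_le_lelong_ball[OF u(1)]) (use u K R elim in auto)
          then have "exp (2 * pos_part u w) * measure lborel K \<le> exp (2 * pos_part u w) * (?c * exp (- 2 * pos_part u w) * ?V)"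
            by (intro mult_left_mono) auto
          also have "\<dots> = (exp (2 * pos_part u w) * exp (- 2 * pos_part u w)) * (?c * ?V)"
            by (simp only: mult_ac)
          also have "\<dots> = ?c * ?V" by (simp flip: exp_add)
          finally have "exp (2 * pos_part u w) \<le> ?c * ?V / measure lborel K"
            using k by (simp add: pos_le_divide_eq)
          then have "ln (exp (2 * pos_part u w)) \<le> ln (?c * ?V / measure lborel K)"
            by (intro ln_mono) auto
          then show "pos_part u w \<le> M" by (simp add: M_def)
        qed
      qed
    qed (use r in auto)
    then have "(exp (- M))\<^sup>2 \<le> ?T\<^sup>2" by (intro power_mono) auto
    also have "(exp (- M))\<^sup>2 = exp (- ln (?c * ?V / measure lborel K))" by (simp add: M_def flip: exp_double)
    also have "\<dots> = measure lborel K / (?c * ?V)" using k c V by (simp add: exp_minus)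
    finally show ?thesis using c V by (simp add: pos_divide_le_eq mult_ac)
  qed
  have eq: "measure lborel (cball a R) = unit_ball_vol (real (DIM(complex ^ 'n))) * R ^ DIM(complex ^ 'n)" if "R \<ge> 0" for R
    using that by (rule content_cball)
  let ?g = "\<lambda>R. ?c * ?T\<^sup>2 * (unit_ball_vol (real (DIM(complex ^ 'n))) * R ^ DIM(complex ^ 'n))"
  have "(?g \<longlongrightarrow> ?g r) (at_right r)" by (intro tendsto_intros)
  then have "measure lborel K \<le> ?g r"
  proof (rule tendsto_lowerbound)
    show "\<forall>\<^sub>F R in at_right r. measure lborel K \<le> ?g R"
      using main eq r by (intro eventually_at_rightI[of r "r + 1"]) auto
  qed simp
  then have "measure lborel K \<le> ?c * ?T\<^sup>2 * measure lborel (cball a r)" using eq[of r] r by simp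
  moreover have "measure lborel (cball a r) > 0" using r by (intro content_cball_pos) simp
  ultimately show ?thesis by (simp add: pos_divide_le_eq)
qed

section \<open>Lebesgue measure on a subspace\<close>

text \<open>The product measure is determined by boxes, where the claim factors into one-dimensional
  substitutions.\<close>

lemma nn_integral_PiM_lborel_affine:
  fixes a :: "'i \<Rightarrow> real"
  assumes E: "finite E" and c: "c \<noteq> 0" and [measurable]: "h \<in> borel_measurable (\<Pi>\<^sub>M e\<in>E. lborel)"
  shows "(\<integral>\<^sup>+f. h (\<lambda>e\<in>E. a e + c * f e) \<partial>(\<Pi>\<^sub>M e\<in>E. lborel))
    = ennreal (1 / \<bar>c\<bar> ^ card E) * (\<integral>\<^sup>+f. h f \<partial>(\<Pi>\<^sub>M e\<in>E. lborel))"
proof -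
  interpret product_sigma_finite "\<lambda>_::'i. lborel :: real measure" ..
  let ?M = "\<Pi>\<^sub>M e\<in>E. lborel :: real measure"
  define T where "T f = (\<lambda>e\<in>E. a e + c * f e)" for f :: "'i \<Rightarrow> real"
  have T [measurable]: "T \<in> measurable ?M ?M" unfolding T_def by measurable
  have "scale_measure (ennreal (\<bar>c\<bar> ^ card E)) (distr ?M ?M T) = ?M"
  proof (rule PiM_eqI[OF E])
    fix A :: "'i \<Rightarrow> real set" assume A: "\<And>i. i \<in> E \<Longrightarrow> A i \<in> sets lborel"
    define A' where "A' i = (\<lambda>x. a i + c * x) -` A i" for i
    have A': "A' i \<in> sets lborel" if "i \<in> E" for i
    proof -
      have "(\<lambda>x. a i + c * x) -` A i \<in> sets borel"
      proof (rule measurable_sets_borel[where M = borel])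
        show "A i \<in> sets borel" using A[OF that] by simp
      qed measurable
      then show ?thesis by (simp add: A'_def)
    qed
    have one: "ennreal \<bar>c\<bar> * emeasure lborel (A' i) = emeasure lborel (A i)" if "i \<in> E" for i
    proof -
      have "emeasure lborel (A i) = (\<integral>\<^sup>+x. indicator (A i) x \<partial>lborel)" using A[OF that] by simp
      also have "\<dots> = ennreal \<bar>c\<bar> * (\<integral>\<^sup>+x. indicator (A i) (a i + c * x) \<partial>lborel)"
        by (rule nn_integral_real_affine) (use A[OF that] c in auto)
      also have "(\<integral>\<^sup>+x. indicator (A i) (a i + c * x) \<partial>lborel) = (\<integral>\<^sup>+x. indicator (A' i) x \<partial>lborel)"
        by (rule nn_integral_cong) (simp add: A'_def indicator_def)
      also have "\<dots> = emeasure lborel (A' i)" using A'[OF that] by simp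
      finally show ?thesis ..
    qed
    have PA: "Pi\<^sub>E E A \<in> sets ?M" by (rule sets_PiM_I_finite[OF E]) (use A in auto)
    have pre: "T -` Pi\<^sub>E E A \<inter> space ?M = Pi\<^sub>E E A'"
      by (auto simp: T_def A'_def space_PiM PiE_iff extensional_def)
    have "emeasure (scale_measure (ennreal (\<bar>c\<bar> ^ card E)) (distr ?M ?M T)) (Pi\<^sub>E E A)
        = ennreal (\<bar>c\<bar> ^ card E) * (\<Prod>i\<in>E. emeasure lborel (A' i))"
      using PA A' E by (simp add: emeasure_distr pre emeasure_PiM)
    also have "\<dots> = (\<Prod>i\<in>E. ennreal \<bar>c\<bar> * emeasure lborel (A' i))"
      by (simp add: prod.distrib ennreal_power)
    also have "\<dots> = (\<Prod>i\<in>E. emeasure lborel (A i))" by (intro prod.cong refl one)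
    finally show "emeasure (scale_measure (ennreal (\<bar>c\<bar> ^ card E)) (distr ?M ?M T)) (Pi\<^sub>E E A)
        = (\<Prod>i\<in>E. emeasure lborel (A i))" .
  qed simp
  then have "(\<integral>\<^sup>+f. h f \<partial>?M) = (\<integral>\<^sup>+f. h f \<partial>scale_measure (ennreal (\<bar>c\<bar> ^ card E)) (distr ?M ?M T))" by simp
  also have "\<dots> = ennreal (\<bar>c\<bar> ^ card E) * (\<integral>\<^sup>+f. h (T f) \<partial>?M)"
    by (simp add: nn_integral_scale_measure nn_integral_distr)
  finally have "ennreal (1 / \<bar>c\<bar> ^ card E) * (\<integral>\<^sup>+f. h f \<partial>?M)
      = (ennreal (1 / \<bar>c\<bar> ^ card E) * ennreal (\<bar>c\<bar> ^ card E)) * (\<integral>\<^sup>+f. h (T f) \<partial>?M)"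
    by (simp add: mult.assoc)
  also have "ennreal (1 / \<bar>c\<bar> ^ card E) * ennreal (\<bar>c\<bar> ^ card E) = 1"
    using c by (simp flip: ennreal_mult')
  finally have "(\<integral>\<^sup>+f. h (T f) \<partial>?M) = ennreal (1 / \<bar>c\<bar> ^ card E) * (\<integral>\<^sup>+f. h f \<partial>?M)"
    by (simp only: mult_1_left)
  then show ?thesis by (simp only: T_def)
qed

locale euclidean_subspace =
  fixes G :: "'a::euclidean_space set"
  assumes subspace: "subspace G"
begin

text \<open>The very choice made in \<open>subspace_lborel\<close>, so that \<open>\<mu>_eq\<close>
  holds by unfolding and independence of the basis is never an issue.\<close>

definition E :: "'a set" where "E = (SOME E. orthonormal_basis G E)"

definition \<mu> :: "'a measure" where "\<mu> = subspace_lborel G"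

abbreviation M where "M \<equiv> \<Pi>\<^sub>M e\<in>E. (lborel :: real measure)"

definition \<Phi> :: "('a \<Rightarrow> real) \<Rightarrow> 'a" where "\<Phi> f = (\<Sum>e\<in>E. f e *\<^sub>R e)"

lemma orthonormal: "orthonormal_basis G E"
proof -
  obtain B where "B \<subseteq> G" "pairwise orthogonal B" "\<And>x. x \<in> B \<Longrightarrow> norm x = 1" "span B = G"
    using orthonormal_basis_subspace[OF subspace] by metis
  then have "orthonormal_basis G B" by (simp add: orthonormal_basis_def)
  then show ?thesis unfolding E_def by (rule someI)
qed

lemma independent_E: "independent E"
  using orthonormal by (intro pairwise_orthogonal_independent) (auto simp: orthonormal_basis_def)

lemma finite_E: "finite E"
  using independent_E by (rule finiteI_independent)

lemma card_E: "card E = dim G"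
  using orthonormal independent_E by (metis dim_eq_card orthonormal_basis_def span_span)

lemma inner_E: "e \<in> E \<Longrightarrow> e' \<in> E \<Longrightarrow> e \<bullet> e' = (if e = e' then 1 else 0)"
  using orthonormal by (auto simp: orthonormal_basis_def pairwise_def orthogonal_def dot_square_norm)

lemma \<Phi>_inner: "e \<in> E \<Longrightarrow> \<Phi> f \<bullet> e = f e"
  unfolding \<Phi>_def inner_sum_left using finite_E
  by (simp add: inner_E if_distrib cong: if_cong)

lemma \<Phi>_in: "\<Phi> f \<in> G"
proof -
  have "\<Phi> f \<in> span E" unfolding \<Phi>_def by (intro span_sum span_scale span_base)
  then show ?thesis using orthonormal by (simp add: orthonormal_basis_def)
qed

lemma expansion:
  assumes "v \<in> G"
  shows "v = (\<Sum>e\<in>E. (v \<bullet> e) *\<^sub>R e)"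
proof -
  have "v \<in> span E" using assms orthonormal by (simp add: orthonormal_basis_def)
  then obtain f where v: "v = \<Phi> f" unfolding span_finite[OF finite_E] by (auto simp: \<Phi>_def)
  have "(\<Sum>e\<in>E. (v \<bullet> e) *\<^sub>R e) = (\<Sum>e\<in>E. f e *\<^sub>R e)" by (intro sum.cong refl) (simp add: v \<Phi>_inner)
  then show ?thesis by (simp add: v \<Phi>_def)
qed

lemma \<Phi>_measurable [measurable]: "\<Phi> \<in> borel_measurable M"
  unfolding \<Phi>_def by measurable

lemma \<mu>_eq: "\<mu> = distr M borel \<Phi>"
  unfolding \<mu>_def subspace_lborel_def Let_def E_def[symmetric] \<Phi>_def ..

lemma sets_\<mu> [measurable_cong]: "sets \<mu> = sets borel"
  by (simp add: \<mu>_eq)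

text \<open>In orthonormal coordinates, scaling followed by a translation within \<open>G\<close>
  acts on each coordinate separately.\<close>

lemma nn_integral_affine:
  assumes v: "v \<in> G" and c: "c \<noteq> 0" and h [measurable]: "h \<in> borel_measurable borel"
  shows "(\<integral>\<^sup>+x. h (v + c *\<^sub>R x) \<partial>\<mu>) = ennreal (1 / \<bar>c\<bar> ^ dim G) * (\<integral>\<^sup>+x. h x \<partial>\<mu>)"
proof -
  have "v + c *\<^sub>R \<Phi> f = \<Phi> (\<lambda>e\<in>E. v \<bullet> e + c * f e)" for f
  proof -
    have "v + c *\<^sub>R \<Phi> f = (\<Sum>e\<in>E. (v \<bullet> e) *\<^sub>R e) + c *\<^sub>R \<Phi> f" using expansion[OF v] by simp
    then show ?thesis by (simp add: \<Phi>_def scaleR_sum_right scaleR_add_left sum.distrib)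
  qed
  then have "(\<integral>\<^sup>+x. h (v + c *\<^sub>R x) \<partial>\<mu>) = (\<integral>\<^sup>+f. (\<lambda>f. h (\<Phi> f)) (\<lambda>e\<in>E. v \<bullet> e + c * f e) \<partial>M)"
    unfolding \<mu>_eq by (subst nn_integral_distr) simp_all
  also have "\<dots> = ennreal (1 / \<bar>c\<bar> ^ card E) * (\<integral>\<^sup>+f. h (\<Phi> f) \<partial>M)"
    by (rule nn_integral_PiM_lborel_affine[OF finite_E c]) measurable
  also have "(\<integral>\<^sup>+f. h (\<Phi> f) \<partial>M) = (\<integral>\<^sup>+x. h x \<partial>\<mu>)"
    unfolding \<mu>_eq by (subst nn_integral_distr) simp_all
  finally show ?thesis by (simp add: card_E)
qed

lemma emeasure_cball_finite: "emeasure \<mu> (cball 0 R) < \<infinity>"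
proof -
  interpret product_sigma_finite "\<lambda>_::'a. lborel :: real measure" ..
  have "emeasure \<mu> (cball 0 R) = emeasure M (\<Phi> -` cball 0 R \<inter> space M)"
    unfolding \<mu>_eq by (rule emeasure_distr) auto
  also have "\<dots> \<le> emeasure M (Pi\<^sub>E E (\<lambda>_. {-R..R}))"
  proof (rule emeasure_mono)
    show "Pi\<^sub>E E (\<lambda>_. {-R..R}) \<in> sets M" by (rule sets_PiM_I_finite[OF finite_E]) auto
    show "\<Phi> -` cball 0 R \<inter> space M \<subseteq> Pi\<^sub>E E (\<lambda>_. {-R..R})"
    proof
      fix f assume f: "f \<in> \<Phi> -` cball 0 R \<inter> space M"
      have "\<bar>f e\<bar> \<le> R" if "e \<in> E" for e
      proof -
        have "\<bar>f e\<bar> = \<bar>\<Phi> f \<bullet> e\<bar>" using \<Phi>_inner[OF that] by simp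
        also have "\<dots> \<le> norm (\<Phi> f) * norm e" by (rule Cauchy_Schwarz_ineq2)
        also have "norm e = 1" using orthonormal that by (simp add: orthonormal_basis_def)
        finally show ?thesis using f by simp
      qed
      then show "f \<in> Pi\<^sub>E E (\<lambda>_. {-R..R})" using f by (auto simp: space_PiM PiE_iff abs_le_iff minus_le_iff)
    qed
  qed
  also have "\<dots> = (\<Prod>e\<in>E. emeasure lborel {-R..R})"
    by (rule emeasure_PiM[OF finite_E]) auto
  also have "\<dots> < \<infinity>" by (cases "0 \<le> R") (auto simp: emeasure_lborel_Icc_eq ennreal_power power_0_left)
  finally show ?thesis .
qed

lemma AE_in_G: "AE x in \<mu>. x \<in> G"
proof -
  have "closed G" by (rule closed_subspace[OF subspace])
  then show ?thesis unfolding \<mu>_eq by (subst AE_distr_iff) (auto simp: \<Phi>_in)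
qed

lemma sigma_finite: "sigma_finite_measure \<mu>"
proof
  have "(\<Union>n::nat. cball 0 (real n)) = (UNIV :: 'a set)"
    using real_arch_simple by (auto simp: UNIV_eq_I)
  then show "\<exists>A. countable A \<and> A \<subseteq> sets \<mu> \<and> \<Union> A = space \<mu> \<and> (\<forall>a\<in>A. emeasure \<mu> a \<noteq> \<infinity>)"
    using emeasure_cball_finite by (intro exI[of _ "range (\<lambda>n::nat. cball 0 (real n))"])
      (auto simp: sets_\<mu> \<mu>_eq less_top[symmetric])
qed

text \<open>Doubling fixes \<open>{0}\<close> but divides its finite mass by
  \<open>2 ^ dim G\<close>.\<close>

lemma null_zero:
  assumes "dim G \<noteq> 0"
  shows "emeasure \<mu> {0} = 0"
proof -
  have "emeasure \<mu> {0} = (\<integral>\<^sup>+x. indicator {0} (0 + 2 *\<^sub>R x) \<partial>\<mu>)"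
  proof -
    have "emeasure \<mu> {0} = (\<integral>\<^sup>+x. indicator {0} x \<partial>\<mu>)" by (simp add: sets_\<mu>)
    also have "\<dots> = (\<integral>\<^sup>+x. indicator {0} (0 + 2 *\<^sub>R x) \<partial>\<mu>)"
      by (rule nn_integral_cong) (simp add: indicator_def)
    finally show ?thesis .
  qed
  also have "\<dots> = ennreal (1 / \<bar>2\<bar> ^ dim G) * (\<integral>\<^sup>+x. indicator {0} x \<partial>\<mu>)"
    by (rule nn_integral_affine) (auto intro: subspace_0[OF subspace])
  finally have e: "emeasure \<mu> {0} = ennreal (1 / 2 ^ dim G) * emeasure \<mu> {0}"
    by (simp add: sets_\<mu>)
  have "emeasure \<mu> {0} \<le> emeasure \<mu> (cball 0 1)" by (intro emeasure_mono) (auto simp: sets_\<mu>)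
  then have "emeasure \<mu> {0} < \<infinity>" using emeasure_cball_finite[of 1] by (rule le_less_trans)
  then obtain x where x: "emeasure \<mu> {0} = ennreal x" "x \<ge> 0" by (cases "emeasure \<mu> {0}") auto
  have "x = 1 / 2 ^ dim G * x" using e x by (simp flip: ennreal_mult')
  moreover have "(2::real) ^ dim G > 1" using assms by (intro one_less_power) linarith+
  ultimately have "x = 0" by (simp add: field_simps)
  then show ?thesis using x by simp
qed

lemma homogeneous:
  assumes "dim G \<noteq> 0"
  shows "homogeneous_measure \<mu> (\<lambda>(c::real) x. c *\<^sub>R x) (dim G)"
proof -
  interpret sigma_finite_measure \<mu> by (rule sigma_finite)
  show ?thesis
  proof unfold_locales
    show "(\<lambda>p::real \<times> 'a. fst p *\<^sub>R snd p) \<in> borel_measurable (borel \<Otimes>\<^sub>M borel)" by measurable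
    show "emeasure \<mu> {0} = 0" by (rule null_zero[OF assms])
  next
    fix h :: "'a \<Rightarrow> ennreal" and c :: real assume h: "h \<in> borel_measurable borel" "c \<noteq> 0"
    show "(\<integral>\<^sup>+x. h (c *\<^sub>R x) \<partial>\<mu>) = ennreal (1 / norm c ^ dim G) * (\<integral>\<^sup>+x. h x \<partial>\<mu>)"
      using nn_integral_affine[OF subspace_0[OF subspace] h(2,1)] by simp
  qed (simp_all add: sets_\<mu>)
qed

lemma emeasure_affine:
  assumes v: "v \<in> G" and c: "c \<noteq> 0" and S: "S \<in> sets borel"
  shows "emeasure \<mu> ((\<lambda>x. v + c *\<^sub>R x) -` S) = ennreal (1 / \<bar>c\<bar> ^ dim G) * emeasure \<mu> S"
proof -
  have m: "(\<lambda>x. v + c *\<^sub>R x) -` S \<in> sets borel" by (rule measurable_sets_borel[OF _ S]) measurable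
  have "emeasure \<mu> ((\<lambda>x. v + c *\<^sub>R x) -` S) = (\<integral>\<^sup>+x. indicator ((\<lambda>x. v + c *\<^sub>R x) -` S) x \<partial>\<mu>)"
    using m by (simp add: sets_\<mu>)
  also have "\<dots> = (\<integral>\<^sup>+x. indicator S (v + c *\<^sub>R x) \<partial>\<mu>)" by (rule nn_integral_cong) (simp add: indicator_def)
  also have "\<dots> = ennreal (1 / \<bar>c\<bar> ^ dim G) * (\<integral>\<^sup>+x. indicator S x \<partial>\<mu>)"
    by (rule nn_integral_affine[OF v c]) (use S in simp)
  finally show ?thesis using S by (simp add: sets_\<mu>)
qed

text \<open>The map \<open>x \<mapsto> v + c *\<^sub>R x\<close> is the homothety with center
  \<open>a\<close> and ratio \<open>r / R\<close>; it preserves \<open>G\<close> because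
  \<open>a\<close> lies in \<open>G\<close>.\<close>

lemma emeasure_cball_Int:
  assumes a: "a \<in> G" and r: "r > 0" and R: "R > 0"
  shows "emeasure \<mu> (cball a R \<inter> G) = ennreal ((R / r) ^ dim G) * emeasure \<mu> (cball a r \<inter> G)"
proof -
  define c where "c = r / R"
  have c: "c > 0" using r R by (simp add: c_def)
  define v where "v = a - c *\<^sub>R a"
  have v: "v \<in> G" unfolding v_def using a subspace by (intro subspace_diff subspace_scale)
  have G: "x \<in> G \<longleftrightarrow> v + c *\<^sub>R x \<in> G" for x
  proof
    assume "v + c *\<^sub>R x \<in> G"
    then have "(1 / c) *\<^sub>R ((v + c *\<^sub>R x) - v) \<in> G"
      using v subspace by (intro subspace_diff subspace_scale)
    then show "x \<in> G" using c by simp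
  next
    assume "x \<in> G"
    then show "v + c *\<^sub>R x \<in> G" using v subspace by (intro subspace_add subspace_scale)
  qed
  have d: "dist a (v + c *\<^sub>R x) \<le> r \<longleftrightarrow> dist a x \<le> R" for x
  proof -
    have "dist a (v + c *\<^sub>R x) = c * dist a x"
    proof -
      have "a - (v + c *\<^sub>R x) = c *\<^sub>R (a - x)" by (simp add: v_def scaleR_diff_right)
      then show ?thesis using c by (simp add: dist_norm)
    qed
    moreover have "r = c * R" using R by (simp add: c_def)
    ultimately have "dist a (v + c *\<^sub>R x) \<le> r \<longleftrightarrow> c * dist a x \<le> c * R" by (simp only:)
    then show ?thesis using c by (simp only: mult_le_cancel_left_pos)
  qed
  have pre: "(\<lambda>x. v + c *\<^sub>R x) -` (cball a r \<inter> G) = cball a R \<inter> G"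
    by (rule set_eqI) (simp only: vimage_eq Int_iff mem_cball d G[symmetric])
  have m: "cball a r \<inter> G \<in> sets borel" using closed_subspace[OF subspace] by auto
  have "emeasure \<mu> (cball a R \<inter> G) = ennreal (1 / \<bar>c\<bar> ^ dim G) * emeasure \<mu> (cball a r \<inter> G)"
    using emeasure_affine[OF v _ m, of c] c unfolding pre by simp
  moreover have "1 / \<bar>c\<bar> ^ dim G = (R / r) ^ dim G" using r R by (simp add: c_def power_divide)
  ultimately show ?thesis by (simp only:)
qed

lemma emeasure_\<mu>_bounded:
  assumes "S \<in> sets borel" "bounded S"
  shows "emeasure \<mu> S = ennreal (measure \<mu> S)"
proof -
  obtain R where R: "\<And>x. x \<in> S \<Longrightarrow> norm x \<le> R" using assms(2) by (auto simp: bounded_iff)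
  then have "S \<subseteq> cball 0 R" by auto
  then have "emeasure \<mu> S \<le> emeasure \<mu> (cball 0 R)" by (intro emeasure_mono) (auto simp: sets_\<mu>)
  then have "emeasure \<mu> S < \<infinity>" using emeasure_cball_finite by (rule le_less_trans)
  then have "emeasure \<mu> S \<noteq> top" unfolding infinity_ennreal_def by (rule less_imp_neq)
  then show ?thesis by (rule emeasure_eq_ennreal_measure)
qed

end

section \<open>Balls in generic subspaces\<close>

text \<open>Only the longer of the two arms of the interval at 0 is kept.\<close>

lemma nn_integral_interval_power_ge:
  assumes d: "d \<noteq> 0" and ab: "\<alpha> \<le> 0" "0 \<le> \<beta>"
  shows "ennreal (max (- \<alpha>) \<beta> ^ d / real d) \<le> (\<integral>\<^sup>+t. indicator {\<alpha>..\<beta>} t * ennreal (\<bar>t\<bar> ^ (d - 1)) \<partial>lborel)"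
proof (cases "- \<alpha> \<le> \<beta>")
  case True
  have "(\<integral>\<^sup>+t. ennreal (t ^ (d - 1)) * indicator {0..\<beta>} t \<partial>lborel) = ennreal (\<beta> ^ d / real d - 0 ^ d / real d)"
  proof (rule nn_integral_FTC_Icc[where F = "\<lambda>t. t ^ d / real d"])
    fix t :: real assume "t \<in> {0..\<beta>}"
    then show "0 \<le> t ^ (d - 1)" by simp
    have "DERIV (\<lambda>t. t ^ d / real d) t :> real d * t ^ (d - 1) / real d"
      using DERIV_cdivide[OF DERIV_pow[of d t], of "real d"] by simp
    then show "DERIV (\<lambda>t. t ^ d / real d) t :> t ^ (d - 1)" using d by simp
  qed (use ab in auto)
  then have "ennreal (\<beta> ^ d / real d) = (\<integral>\<^sup>+t. ennreal (t ^ (d - 1)) * indicator {0..\<beta>} t \<partial>lborel)"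
    using d by (simp add: power_0_left)
  also have "\<dots> \<le> (\<integral>\<^sup>+t. indicator {\<alpha>..\<beta>} t * ennreal (\<bar>t\<bar> ^ (d - 1)) \<partial>lborel)"
    using ab by (intro nn_integral_mono) (auto simp: indicator_def)
  finally show ?thesis using True by (simp add: max_def)
next
  case False
  have "(\<integral>\<^sup>+t. ennreal ((- t) ^ (d - 1)) * indicator {\<alpha>..0} t \<partial>lborel)
      = ennreal (- ((- 0) ^ d / real d) - - ((- \<alpha>) ^ d / real d))"
  proof (rule nn_integral_FTC_Icc[where F = "\<lambda>t. - ((- t) ^ d / real d)"])
    fix t :: real assume "t \<in> {\<alpha>..0}"
    then show "0 \<le> (- t) ^ (d - 1)" by simp
    have "DERIV (\<lambda>t. - ((- t) ^ d / real d)) t :> - (real d * (- t) ^ (d - 1) * (- 1) / real d)"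
      by (intro DERIV_minus DERIV_cdivide) (auto intro!: derivative_eq_intros)
    then show "DERIV (\<lambda>t. - ((- t) ^ d / real d)) t :> (- t) ^ (d - 1)" using d by simp
  qed (use ab in auto)
  then have "ennreal ((- \<alpha>) ^ d / real d) = (\<integral>\<^sup>+t. ennreal ((- t) ^ (d - 1)) * indicator {\<alpha>..0} t \<partial>lborel)"
    using d by (simp add: power_0_left)
  also have "\<dots> \<le> (\<integral>\<^sup>+t. indicator {\<alpha>..\<beta>} t * ennreal (\<bar>t\<bar> ^ (d - 1)) \<partial>lborel)"
    using ab by (intro nn_integral_mono) (auto simp: indicator_def)
  finally show ?thesis using False by (simp add: max_def)
qed

text \<open>With \<open>L\<close> the longer arm, the left side is at most
  \<open>L ^ (d - 1)\<close> times \<open>2 * e * L * exp (- U 0)\<close>, and the integral on the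
  right is at least \<open>L ^ d / d\<close>; the quotient is the factor
  \<open>2 * e * d\<close>.\<close>

lemma nn_integral_real_section_le:
  fixes E :: "real set"
  assumes U: "log_subharmonic U" and E: "E \<in> sets borel" "E \<subseteq> {\<alpha>..\<beta>}" and ab: "\<alpha> \<le> 0" "0 \<le> \<beta>"
    and UE: "\<And>t. t \<in> E \<Longrightarrow> U (of_real t) \<le> 0" and d: "d \<noteq> 0"
  shows "(\<integral>\<^sup>+t. indicator E t * ennreal (\<bar>t\<bar> ^ (d - 1)) \<partial>lborel)
    \<le> ennreal (2 * exp 1 * real d * exp (- U 0)) * (\<integral>\<^sup>+t. indicator {\<alpha>..\<beta>} t * ennreal (\<bar>t\<bar> ^ (d - 1)) \<partial>lborel)"
proof -
  define L where "L = max (- \<alpha>) \<beta>"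
  have L: "0 \<le> L" using ab by (simp add: L_def)
  have EL: "\<bar>t\<bar> \<le> L" if "t \<in> E" for t using that E(2) by (force simp: L_def)
  have "(\<integral>\<^sup>+t. indicator E t * ennreal (\<bar>t\<bar> ^ (d - 1)) \<partial>lborel) \<le> (\<integral>\<^sup>+t. ennreal (L ^ (d - 1)) * indicator E t \<partial>lborel)"
  proof (rule nn_integral_mono)
    fix t
    show "indicator E t * ennreal (\<bar>t\<bar> ^ (d - 1)) \<le> ennreal (L ^ (d - 1)) * indicator E t"
      using EL[of t] by (cases "t \<in> E") (simp_all add: ennreal_leI power_mono)
  qed
  also have "\<dots> = ennreal (L ^ (d - 1)) * emeasure lborel E"
    using E by (subst nn_integral_cmult_indicator) auto
  also have "\<dots> \<le> ennreal (L ^ (d - 1)) * ennreal (2 * exp 1 * L * exp (0 - U 0))"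
    by (intro mult_left_mono emeasure_real_section_le[OF U E(1) L]) (use UE EL in auto)
  also have "\<dots> = ennreal (2 * exp 1 * real d * exp (- U 0)) * ennreal (L ^ d / real d)"
  proof -
    have "L ^ d = L ^ (d - 1) * L" using d by (metis power_minus_mult not_gr_zero)
    then have "L ^ (d - 1) * (2 * exp 1 * L * exp (0 - U 0)) = 2 * exp 1 * real d * exp (- U 0) * (L ^ d / real d)"
      using d by simp
    then show ?thesis using L by (simp flip: ennreal_mult')
  qed
  also have "\<dots> \<le> ennreal (2 * exp 1 * real d * exp (- U 0)) * (\<integral>\<^sup>+t. indicator {\<alpha>..\<beta>} t * ennreal (\<bar>t\<bar> ^ (d - 1)) \<partial>lborel)"
    unfolding L_def by (intro mult_left_mono nn_integral_interval_power_ge[OF d ab]) simp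
  finally show ?thesis .
qed

lemma real_line_Int_cball:
  fixes y b :: "'a::euclidean_space"
  assumes y: "y \<noteq> 0" and b: "norm b \<le> r"
  obtains \<alpha> \<beta> where "\<alpha> \<le> 0" "0 \<le> \<beta>" "{t. norm (t *\<^sub>R y - b) \<le> r} = {\<alpha>..\<beta>}"
proof -
  let ?S = "{t. norm (t *\<^sub>R y - b) \<le> r}"
  have eq: "?S = (\<lambda>t. t *\<^sub>R y) -` cball b r"
    by (rule set_eqI) (simp only: mem_Collect_eq vimage_eq mem_cball dist_norm norm_minus_commute[of b])
  have "linear (\<lambda>t. t *\<^sub>R y)" by (rule linearI) (simp_all add: scaleR_add_left)
  then have "convex ?S" unfolding eq by (intro convex_linear_vimage) auto
  moreover have "compact ?S"
    unfolding compact_eq_bounded_closed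
  proof
    show "closed ?S" by (intro closed_Collect_le continuous_intros)
    have "\<bar>t\<bar> \<le> (r + norm b) / norm y" if "t \<in> ?S" for t
    proof -
      have "norm (t *\<^sub>R y) \<le> r + norm b" using that norm_triangle_sub[of "t *\<^sub>R y" b] by simp
      then show ?thesis using y by (simp add: pos_le_divide_eq)
    qed
    then show "bounded ?S" unfolding bounded_iff real_norm_def by blast
  qed
  ultimately obtain \<alpha> \<beta> where ab: "?S = {\<alpha>..\<beta>}"
    using connected_compact_interval_1[of ?S] convex_connected by blast
  have "0 \<in> ?S" using b by simp
  then have "\<alpha> \<le> 0" "0 \<le> \<beta>" unfolding ab by simp_all
  then show ?thesis using ab by (rule that)
qed

text \<open>\<open>U y\<close> stands for a function on the complex line through \<open>z\<close> in
  direction \<open>y\<close>, of which only the real points occur here. Thus no complex structure on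
  the space enters, and the lines are tied together only by the common value at
  \<open>z\<close>.\<close>

lemma (in euclidean_subspace) measure_le_log_subharmonic:
  assumes "dim G \<noteq> 0"
    and u: "\<And>y. log_subharmonic (U y)" "\<And>y t. z + t *\<^sub>R y \<in> K \<Longrightarrow> U y (of_real t) \<le> 0"
    and U0: "\<And>y. U y 0 = U0"
    and K: "K \<in> sets borel" "K \<subseteq> cball a r \<inter> G" and z: "z \<in> cball a r" "z \<in> G"
  shows "measure \<mu> K \<le> 2 * exp 1 * dim G * exp (- U0) * measure \<mu> (cball a r \<inter> G)"
proof -
  interpret H: homogeneous_measure \<mu> "\<lambda>(c::real) x. c *\<^sub>R x" "dim G" by (rule homogeneous[OF assms(1)])
  define C where "C = 2 * exp 1 * dim G * exp (- U0)"
  have C: "C \<ge> 0" by (simp add: C_def)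
  let ?B = "cball a r \<inter> G"
  have cG: "closed G" by (rule closed_subspace[OF subspace])
  have B: "?B \<in> sets borel" "bounded ?B" using cG by (auto intro: bounded_Int)
  let ?t = "\<lambda>S. (\<lambda>x. z + 1 *\<^sub>R x) -` S"
  have t: "?t S \<in> sets borel" if "S \<in> sets borel" for S by (rule measurable_sets_borel[OF _ that]) measurable
  have et: "emeasure \<mu> (?t S) = emeasure \<mu> S" if "S \<in> sets borel" for S
    using emeasure_affine[OF z(2) _ that, of 1] by simp
  have w: "AE c in lborel. H.weight c = ennreal (\<bar>c\<bar> ^ (dim G - 1))"
  proof (rule eventually_mono[OF AE_lborel_singleton[of 0]])
    fix c :: real assume c: "c \<noteq> 0"
    have "\<bar>c\<bar> ^ dim G = \<bar>c\<bar> ^ (dim G - 1) * \<bar>c\<bar>" using assms(1) by (metis power_minus_mult not_gr_zero)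
    then show "H.weight c = ennreal (\<bar>c\<bar> ^ (dim G - 1))"
      unfolding H.weight_def using c by simp
  qed
  have "emeasure \<mu> (?t K) \<le> ennreal C * emeasure \<mu> (?t ?B)"
  proof (rule H.emeasure_le_if_sections_le[OF t[OF K(1)] t[OF B(1)] AE_in_G])
    fix y assume y: "y \<in> G" "y \<noteq> 0"
    have "norm (a - z) \<le> r" using z by (simp add: dist_norm)
    then obtain \<alpha> \<beta> where ab: "\<alpha> \<le> 0" "0 \<le> \<beta>" "{t. norm (t *\<^sub>R y - (a - z)) \<le> r} = {\<alpha>..\<beta>}"
      by (rule real_line_Int_cball[OF y(2)])
    have BI: "c *\<^sub>R y \<in> ?t ?B \<longleftrightarrow> c \<in> {\<alpha>..\<beta>}" for c
    proof -
      have "z + 1 *\<^sub>R c *\<^sub>R y \<in> G" using y z subspace by (simp add: subspace_add subspace_scale)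
      moreover have "dist a (z + 1 *\<^sub>R c *\<^sub>R y) = norm (c *\<^sub>R y - (a - z))"
        by (simp add: dist_norm norm_minus_commute[of a] algebra_simps)
      ultimately show ?thesis unfolding ab(3)[symmetric] by simp
    qed
    define E where "E = (\<lambda>t. z + t *\<^sub>R y) -` K"
    have E: "E \<in> sets borel" unfolding E_def by (rule measurable_sets_borel[OF _ K(1)]) measurable
    have EK: "c *\<^sub>R y \<in> ?t K \<longleftrightarrow> c \<in> E" for c by (simp add: E_def)
    have sub: "E \<subseteq> {\<alpha>..\<beta>}"
    proof
      fix c assume "c \<in> E"
      then have "c *\<^sub>R y \<in> ?t ?B" using EK[of c] K(2) by blast
      then show "c \<in> {\<alpha>..\<beta>}" using BI[of c] by blast
    qed
    have UE: "U y (of_real s) \<le> 0" if "s \<in> E" for s using u(2) that by (simp add: E_def)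
    have "(\<integral>\<^sup>+c. indicator (?t K) (c *\<^sub>R y) * H.weight c \<partial>lborel) = (\<integral>\<^sup>+c. indicator E c * ennreal (\<bar>c\<bar> ^ (dim G - 1)) \<partial>lborel)"
      by (rule nn_integral_cong_AE, rule eventually_mono[OF w]) (simp only: indicator_def EK)
    also have "\<dots> \<le> ennreal C * (\<integral>\<^sup>+c. indicator {\<alpha>..\<beta>} c * ennreal (\<bar>c\<bar> ^ (dim G - 1)) \<partial>lborel)"
      using nn_integral_real_section_le[OF u(1) E sub ab(1,2) UE assms(1)] unfolding C_def U0 .
    also have "(\<integral>\<^sup>+c. indicator {\<alpha>..\<beta>} c * ennreal (\<bar>c\<bar> ^ (dim G - 1)) \<partial>lborel) = (\<integral>\<^sup>+c. indicator (?t ?B) (c *\<^sub>R y) * H.weight c \<partial>lborel)"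
      by (rule nn_integral_cong_AE, rule eventually_mono[OF w]) (simp only: indicator_def BI)
    finally show "(\<integral>\<^sup>+c. indicator (?t K) (c *\<^sub>R y) * H.weight c \<partial>lborel)
        \<le> ennreal C * (\<integral>\<^sup>+c. indicator (?t ?B) (c *\<^sub>R y) * H.weight c \<partial>lborel)" .
  qed
  then have "emeasure \<mu> K \<le> ennreal C * emeasure \<mu> ?B" by (simp only: et K(1) B(1))
  moreover have "emeasure \<mu> K = ennreal (measure \<mu> K)"
    by (rule emeasure_\<mu>_bounded[OF K(1) bounded_subset[OF B(2) K(2)]])
  moreover have "emeasure \<mu> ?B = ennreal (measure \<mu> ?B)" by (rule emeasure_\<mu>_bounded[OF B])
  ultimately show ?thesis using C by (simp add: C_def flip: ennreal_mult')
qed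

text \<open>In the upper half of the disc of radius \<open>\<delta>\<close>, \<open>Re (\<zeta>\<^sup>2 - 2 \<i> \<delta> \<zeta>) / \<delta>\<^sup>2\<close> is harmonic, nonnegative on
  the diameter and at least 1 on the arc, but small at \<open>\<i>\<close> if \<open>\<delta>\<close> is large.\<close>
lemma log_subharmonic_le_off_segment:
  assumes U: "log_subharmonic U" and \<delta>: "\<delta> \<ge> 1" and UM: "\<And>t. \<bar>t\<bar> \<le> \<delta> \<Longrightarrow> U (of_real t) \<le> M"
  shows "U \<i> \<le> M + 2 * ln (2 * exp 1) / \<delta>"
proof -
  \<comment> \<open>A bound for \<open>U - M\<close> on the whole disc: the section estimate is
    applied to the full segment of length \<open>2 * \<delta>\<close>, whose points are within
    \<open>2 * \<delta>\<close> of any point of the disc, so that \<open>\<delta>\<close>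
    cancels.\<close>
  define c where "c = ln (2 * exp 1 :: real)"
  have "1 \<le> 2 * (exp 1 :: real)" using exp_ge_add_one_self[of 1] by linarith
  then have c: "c \<ge> 0" unfolding c_def by (rule ln_ge_zero)
  have disc: "U \<zeta> \<le> M + c" if \<zeta>: "norm \<zeta> \<le> \<delta>" for \<zeta>
  proof -
    have "emeasure lborel {-\<delta>..\<delta>} \<le> ennreal (2 * exp 1 * (2 * \<delta>) * exp (M - U \<zeta>))"
    proof (rule emeasure_real_section_le[OF U])
      fix t assume t: "t \<in> {-\<delta>..\<delta>}"
      then have "\<bar>t\<bar> \<le> \<delta>" by auto
      then show "U (of_real t) \<le> M" "norm (\<zeta> - of_real t) \<le> 2 * \<delta>"
        using UM norm_triangle_ineq4[of \<zeta> "of_real t"] \<zeta> by auto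
    qed (use \<delta> in auto)
    then have "2 * \<delta> \<le> 2 * exp 1 * (2 * \<delta>) * exp (M - U \<zeta>)" using \<delta> by simp
    then have "1 \<le> (2 * exp 1) * exp (M - U \<zeta>)" using \<delta> by simp
    then have "exp (U \<zeta> - M) * 1 \<le> exp (U \<zeta> - M) * ((2 * exp 1) * exp (M - U \<zeta>))"
      by (intro mult_left_mono) auto
    also have "\<dots> = (exp (U \<zeta> - M) * exp (M - U \<zeta>)) * (2 * exp 1)" by (simp only: mult_ac)
    also have "\<dots> = exp c" by (simp add: c_def flip: exp_add)
    finally show ?thesis by simp
  qed
  define X where "X = cball 0 \<delta> \<inter> {\<zeta>. 0 \<le> Im \<zeta>}"
  have X: "compact X" unfolding X_def
    by (intro compact_Int_closed compact_cball closed_Collect_le continuous_intros)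
  define g where "g \<zeta> = of_real M + of_real (c / \<delta>\<^sup>2) * (\<zeta>\<^sup>2 - 2 * \<i> * of_real \<delta> * \<zeta>)" for \<zeta>
  have Reg: "Re (g \<zeta>) = M + c / \<delta>\<^sup>2 * ((Re \<zeta>)\<^sup>2 - (Im \<zeta>)\<^sup>2 + 2 * \<delta> * Im \<zeta>)" for \<zeta>
    by (simp add: g_def power2_eq_square)
  have c\<delta>: "0 \<le> c / \<delta>\<^sup>2" using c by simp
  have "U \<i> \<le> Re (g \<i>)"
  proof (rule log_subharmonic_maximum_principle[OF U X])
    show "continuous_on X (\<lambda>\<zeta>. Re (g \<zeta>))" unfolding g_def by (intro continuous_intros)
    show "\<i> \<in> X" using \<delta> by (simp add: X_def)
    fix a assume a: "a \<in> X"
    then have n: "norm a \<le> \<delta>" "0 \<le> Im a" by (auto simp: X_def)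
    have Im\<delta>: "Im a \<le> \<delta>" using n abs_Im_le_cmod[of a] by linarith
    consider "Im a = 0" | "norm a = \<delta>" | "norm a < \<delta>" "0 < Im a" using n by linarith
    then show "U a \<le> Re (g a) \<or> (\<exists>R>0. \<exists>h. ball a R \<subseteq> X \<and> h holomorphic_on ball a R \<and> (\<forall>z\<in>ball a R. Re (g z) = Re (h z)))"
    proof cases
      case 1
      then have "a = of_real (Re a)" by (simp add: complex_eq_iff)
      then have "U a \<le> M" using UM[of "Re a"] n abs_Re_le_cmod[of a] by (metis order_trans)
      moreover have "M \<le> Re (g a)" unfolding Reg using c 1 by simp
      ultimately show ?thesis by linarith
    next
      case 2
      then have s: "(Re a)\<^sup>2 + (Im a)\<^sup>2 = \<delta>\<^sup>2" by (simp flip: cmod_power2)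
      have "Im a * Im a \<le> \<delta> * Im a" using n Im\<delta> by (intro mult_right_mono) auto
      then have "\<delta>\<^sup>2 \<le> (Re a)\<^sup>2 - (Im a)\<^sup>2 + 2 * \<delta> * Im a" unfolding s[symmetric] by (simp add: power2_eq_square)
      then have "c / \<delta>\<^sup>2 * \<delta>\<^sup>2 \<le> c / \<delta>\<^sup>2 * ((Re a)\<^sup>2 - (Im a)\<^sup>2 + 2 * \<delta> * Im a)" using c\<delta> by (rule mult_left_mono)
      then have "M + c \<le> Re (g a)" unfolding Reg using \<delta> by simp
      then show ?thesis using disc[OF n(1)] by linarith
    next
      case 3
      have "open (ball 0 \<delta> \<inter> {\<zeta>. 0 < Im \<zeta>})" by (intro open_Int open_ball open_Collect_less continuous_intros)
      moreover have "a \<in> ball 0 \<delta> \<inter> {\<zeta>. 0 < Im \<zeta>}" using 3 by simp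
      ultimately obtain R where R: "R > 0" "ball a R \<subseteq> ball 0 \<delta> \<inter> {\<zeta>. 0 < Im \<zeta>}"
        by (meson open_contains_ball)
      have "ball a R \<subseteq> X"
      proof
        fix x assume "x \<in> ball a R"
        then have "x \<in> ball 0 \<delta> \<inter> {\<zeta>. 0 < Im \<zeta>}" using R(2) by (rule rev_subsetD)
        then show "x \<in> X" by (simp add: X_def)
      qed
      moreover have "g holomorphic_on ball a R" unfolding g_def by (intro holomorphic_intros)
      ultimately show ?thesis using R(1) by (intro disjI2 exI[of _ R] conjI exI[of _ g]) auto
    qed
  qed
  also have "Re (g \<i>) = M + c / \<delta>\<^sup>2 * (2 * \<delta> - 1)" by (simp add: Reg)
  also have "c / \<delta>\<^sup>2 * (2 * \<delta> - 1) \<le> c / \<delta>\<^sup>2 * (2 * \<delta>)" using c\<delta> by (intro mult_left_mono) auto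
  also have "c / \<delta>\<^sup>2 * (2 * \<delta>) = 2 * c / \<delta>" using \<delta> by (simp add: power2_eq_square)
  finally show ?thesis by (simp add: c_def)
qed

section \<open>Linear algebra of generic subspaces\<close>

lemma linear_J: "linear (J :: complex ^ 'n \<Rightarrow> complex ^ 'n)"
  unfolding J_def[abs_def] by (rule linear_vector_smult)

text \<open>A complex basis together with its multiples by \<i> spans over the reals.\<close>

lemma dim_complex_subspace_le:
  fixes H :: "(complex ^ 'n) set"
  shows "dim H \<le> 2 * vec.dim H"
proof -
  obtain B where B: "B \<subseteq> H" "vec.independent B" "H \<subseteq> vec.span B" "card B = vec.dim H"
    using vec.basis_exists by blast
  have fin: "finite B" using B(2) by (rule vec.finiteI_independent)
  have "vec.span B \<subseteq> span (B \<union> J ` B)"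
  proof
    fix x assume "x \<in> vec.span B"
    then obtain c where x: "x = (\<Sum>v\<in>B. c v *s v)" unfolding vec.span_finite[OF fin] by auto
    have "c v *s v = Re (c v) *\<^sub>R v + Im (c v) *\<^sub>R J v" for v
      by (simp add: vec_eq_iff J_def complex_eq_iff)
    then have "x = (\<Sum>v\<in>B. Re (c v) *\<^sub>R v + Im (c v) *\<^sub>R J v)" using x by simp
    then show "x \<in> span (B \<union> J ` B)"
      by (simp only:) (intro span_sum span_add span_scale span_base; blast)
  qed
  then have "dim H \<le> card (B \<union> J ` B)" using B(3) fin by (intro dim_le_card) auto
  also have "\<dots> \<le> card B + card (J ` B)" by (rule card_Un_le)
  also have "\<dots> \<le> 2 * card B" using card_image_le[OF fin, of J] by simp
  finally show ?thesis using B(4) by simp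
qed

text \<open>The dimension formula for the sum of \<open>G\<close> and its image under
  \<open>J\<close>, which have equal dimension and together span a space of real dimension
  \<open>2 * CARD('n)\<close>.\<close>

lemma generic_subspace_dim:
  fixes G :: "(complex ^ 'n) set"
  assumes "generic_subspace G"
  shows "dim G \<le> CARD('n) + complex_dim G" and "dim G \<noteq> 0"
proof -
  have G: "subspace G" "{x + y | x y. x \<in> G \<and> y \<in> J ` G} = UNIV"
    using assms by (auto simp: generic_subspace_def)
  have JG: "subspace (J ` G)" using linear_J G(1) by (rule linear_subspace_image)
  have "inj (J :: complex ^ 'n \<Rightarrow> complex ^ 'n)"
    by (rule injI) (simp add: J_def vec_eq_iff)
  then have dJ: "dim (J ` G) = dim G" using linear_J by (intro dim_image_eq) (auto intro: inj_on_subset)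
  have e: "2 * CARD('n) + dim (G \<inter> J ` G) = dim G + dim G"
    using dim_sums_Int[OF G(1) JG] unfolding G(2) dJ by (simp add: mult.commute)
  moreover have "dim (G \<inter> J ` G) \<le> 2 * complex_dim G"
    unfolding complex_dim_def by (rule dim_complex_subspace_le)
  ultimately show "dim G \<le> CARD('n) + complex_dim G" by linarith
  have "CARD('n) > 0" by simp
  with e show "dim G \<noteq> 0" by linarith
qed

text \<open>The decomposition need not be unique, so a linear right inverse of the sum map fixes
  one; boundedness makes both parts small for small \<open>v\<close>.\<close>

lemma generic_subspace_decomposition:
  fixes G :: "(complex ^ 'n) set"
  assumes "generic_subspace G"
  obtains p q where "bounded_linear p" "bounded_linear q" "\<And>v. p v \<in> G" "\<And>v. q v \<in> G" "\<And>v. v = p v + J (q v)"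
proof -
  have G: "subspace G" "{x + y | x y. x \<in> G \<and> y \<in> J ` G} = UNIV"
    using assms by (auto simp: generic_subspace_def)
  let ?f = "\<lambda>w :: (complex ^ 'n) \<times> (complex ^ 'n). fst w + J (snd w)"
  have "linear ?f" by (rule linearI) (simp_all add: linear_add[OF linear_J] linear_scale[OF linear_J] scaleR_add_right)
  then obtain g where g: "g ` UNIV \<subseteq> G \<times> G" "linear g" "\<And>v. v \<in> ?f ` (G \<times> G) \<Longrightarrow> ?f (g v) = v"
    using linear_exists_right_inverse_on[of ?f "G \<times> G"] subspace_Times[OF G(1) G(1)] by blast
  have surj: "v \<in> ?f ` (G \<times> G)" for v
  proof -
    have "v \<in> {x + y | x y. x \<in> G \<and> y \<in> J ` G}" unfolding G(2) by simp
    then obtain x y where "x \<in> G" "y \<in> G" "v = x + J y" by blast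
    then show ?thesis by (intro image_eqI[of _ _ "(x, y)"]) auto
  qed
  have bg: "bounded_linear g" using g(2) by (simp add: linear_conv_bounded_linear)
  show ?thesis
  proof (rule that[of "\<lambda>v. fst (g v)" "\<lambda>v. snd (g v)"])
    show "bounded_linear (\<lambda>v. fst (g v))" by (rule bounded_linear_compose[OF bounded_linear_fst bg])
    show "bounded_linear (\<lambda>v. snd (g v))" by (rule bounded_linear_compose[OF bounded_linear_snd bg])
    fix v
    have "g v \<in> G \<times> G" using g(1) by blast
    then show "fst (g v) \<in> G" "snd (g v) \<in> G" by (auto simp: mem_Times_iff)
    show "v = fst (g v) + J (snd (g v))" using g(3)[OF surj] by simp
  qed
qed

lemma vector_smult_of_real: "complex_of_real t *s y = t *\<^sub>R (y :: complex ^ 'n)"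
proof (subst vec_eq_iff, rule allI)
  fix i
  show "(complex_of_real t *s y) $ i = (t *\<^sub>R y) $ i"
    unfolding vector_scaleR_component by (simp add: scaleR_conv_of_real)
qed

section \<open>The estimate in a generic subspace\<close>

lemma measure_le_lelong_generic:
  fixes G :: "(complex ^ 'n) set"
  assumes G: "generic_subspace G" and u: "u \<in> lelong_class" "\<And>x. x \<in> K \<Longrightarrow> u x \<le> 0"
    and K: "K \<in> sets borel" "K \<subseteq> cball a r \<inter> G" and z: "z \<in> cball a r" "z \<in> G"
  shows "measure (subspace_lborel G) K
    \<le> 2 * exp 1 * dim G * exp (- pos_part u z) * measure (subspace_lborel G) (cball a r \<inter> G)"
proof -
  interpret S: euclidean_subspace G by standard (use G in \<open>simp add: generic_subspace_def\<close>)
  show ?thesis unfolding S.\<mu>_def[symmetric]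
  proof (rule S.measure_le_log_subharmonic[OF generic_subspace_dim(2)[OF G], where U = "\<lambda>y \<zeta>. pos_part u (z + \<zeta> *s y)"])
    show "log_subharmonic (\<lambda>\<zeta>. pos_part u (z + \<zeta> *s y))" for y by (rule log_subharmonic_line[OF u(1)])
    show "pos_part u (z + complex_of_real t *s y) \<le> 0" if "z + t *\<^sub>R y \<in> K" for y t
      using u(2)[OF that] by (simp add: vector_smult_of_real pos_part_eq_0)
  qed (use K z in simp_all)
qed

text \<open>On \<open>G\<close>, in a ball of radius \<open>R\<close> slightly above
  \<open>r\<close>, Lelong functions are bounded by \<open>M\<close>; the constant 8 would allow the
  larger bound \<open>N\<close>. The gap pays for leaving \<open>G\<close>, so that one fixed
  \<open>R\<close> suffices.\<close>

lemma measure_ratio_le_generic: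
  fixes G :: "(complex ^ 'n) set"
  assumes G: "generic_subspace G" and a: "a \<in> G" and r: "r > 0"
    and K: "K \<in> sets borel" "K \<subseteq> cball a r \<inter> G"
  shows "measure (subspace_lborel G) K / measure (subspace_lborel G) (cball a r \<inter> G)
    \<le> 8 * real (CARD('n) + complex_dim G) * rel_log_capacity (cball a r \<inter> G) K"
proof -
  interpret S: euclidean_subspace G by standard (use G in \<open>simp add: generic_subspace_def\<close>)
  define T where "T = rel_log_capacity (cball a r \<inter> G) K"
  define k where "k = measure (subspace_lborel G) K"
  define V where "V = measure (subspace_lborel G) (cball a r \<inter> G)"
  define d where "d = real (dim G)"
  have "a \<in> cball a r \<inter> G" using a r by simp
  then have ne: "cball a r \<inter> G \<noteq> {}" by blast
  have T0: "T \<ge> 0" unfolding T_def by (rule rel_log_capacity_nonneg[OF ne])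
  have d: "d > 0" "d \<le> real (CARD('n) + complex_dim G)"
    using generic_subspace_dim[OF G] unfolding d_def of_nat_le_iff by auto
  have kV0: "k \<ge> 0" "V \<ge> 0" by (simp_all add: k_def V_def)
  have "k / V \<le> 8 * d * T"
  \<comment> \<open>If \<open>V = 0\<close> the quotient is 0 by the convention for division, so
    positivity of the measure of balls in \<open>G\<close> is not at stake.\<close>
  proof (cases "k = 0 \<or> V = 0")
    case True
    then show ?thesis using d T0 by auto
  next
    case False
    then have k: "k > 0" and V: "V > 0" using kV0 by auto
    have "((\<lambda>R. 2 * exp 1 * (R / r) ^ dim G) \<longlongrightarrow> 2 * exp 1 * (r / r) ^ dim G) (at_right r)"
      using r by (intro tendsto_intros) simp
    moreover have "2 * exp 1 * (r / r) ^ dim G < 8" using exp_le r by simp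
    ultimately have "\<forall>\<^sub>F R in at_right r. 2 * exp 1 * (R / r) ^ dim G < 8" by (rule order_tendstoD(2))
    then have "\<forall>\<^sub>F R in at_right r. r < R \<and> 2 * exp 1 * (R / r) ^ dim G < 8"
      using eventually_at_right_less[of r] by (rule eventually_conj[rotated])
    then obtain R where R: "r < R" "2 * exp 1 * (R / r) ^ dim G < 8"
      using eventually_happens[of _ "at_right r"] trivial_limit_at_right_real by blast
    have VR: "measure (subspace_lborel G) (cball a R \<inter> G) = (R / r) ^ dim G * V"
    proof -
      have cG: "closed G" by (rule closed_subspace[OF S.subspace])
      have "ennreal (measure S.\<mu> (cball a R \<inter> G)) = ennreal ((R / r) ^ dim G) * ennreal (measure S.\<mu> (cball a r \<inter> G))"
        using S.emeasure_cball_Int[OF a r, of R] R r cG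
        by (simp add: S.emeasure_\<mu>_bounded bounded_Int)
      then show ?thesis using R r unfolding V_def S.\<mu>_def by (simp flip: ennreal_mult')
    qed
    define M where "M = ln (2 * exp 1 * (R / r) ^ dim G * (d * V / k))"
    define N where "N = ln (8 * (d * V / k))"
    have dVk: "d * V / k > 0" using d V k by simp
    have Rr: "(R / r) ^ dim G > 0" using R r by simp
    have pos: "2 * exp 1 * (R / r) ^ dim G * (d * V / k) > 0"
      by (rule mult_pos_pos[OF mult_pos_pos[OF _ Rr] dVk]) simp
    have MN: "M < N" unfolding M_def N_def
      using ln_less_cancel_iff[OF pos mult_pos_pos[OF _ dVk, of 8]] mult_strict_right_mono[OF R(2) dVk]
      by simp
    have real_bound: "pos_part u x \<le> M"
      if u: "u \<in> lelong_class" "\<forall>x\<in>K. u x \<le> 0" and x: "x \<in> cball a R" "x \<in> G" for u x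
    proof -
      have "K \<subseteq> cball a R \<inter> G" using K(2) R(1) by auto
      then have "k \<le> 2 * exp 1 * dim G * exp (- pos_part u x) * ((R / r) ^ dim G * V)"
        unfolding k_def VR[symmetric] using u by (intro measure_le_lelong_generic[OF G u(1) _ K(1) _ x]) auto
      then have "exp (pos_part u x) * k \<le> exp (pos_part u x) * (2 * exp 1 * d * exp (- pos_part u x) * ((R / r) ^ dim G * V))"
        by (intro mult_left_mono) (auto simp: d_def)
      also have "\<dots> = (exp (pos_part u x) * exp (- pos_part u x)) * (2 * exp 1 * (R / r) ^ dim G * (d * V))"
        by (simp only: mult_ac)
      also have "exp (pos_part u x) * exp (- pos_part u x) = 1" by (simp flip: exp_add)
      finally have "exp (pos_part u x) \<le> 2 * exp 1 * (R / r) ^ dim G * (d * V / k)"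
        using k by (simp add: pos_le_divide_eq)
      then have "ln (exp (pos_part u x)) \<le> M" unfolding M_def by (rule ln_mono) auto
      then show ?thesis by simp
    qed
    \<comment> \<open>Half-length of the segments used below, chosen so long that the loss
      \<open>2 * ln (2 * e) / \<delta>\<close> fits into \<open>N - M\<close>.\<close>
    define \<delta> where "\<delta> = max 1 (2 * ln (2 * exp 1) / (N - M))"
    have \<delta>: "\<delta> \<ge> 1" by (simp add: \<delta>_def)
    have "2 * ln (2 * exp 1) / (N - M) \<le> \<delta>" by (simp add: \<delta>_def)
    then have "2 * ln (2 * exp 1) \<le> \<delta> * (N - M)" using MN by (simp only: pos_divide_le_eq diff_gt_0_iff_gt)
    then have "2 * ln (2 * exp 1) / \<delta> \<le> N - M" using \<delta> by (simp add: pos_divide_le_eq mult.commute)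
    then have \<delta>N: "M + 2 * ln (2 * exp 1) / \<delta> \<le> N" by linarith
    obtain p q where p: "bounded_linear p" and q: "bounded_linear q"
      and pG: "\<And>v. p v \<in> G" and qG: "\<And>v. q v \<in> G" and pq: "\<And>v. v = p v + J (q v)"
      using generic_subspace_decomposition[OF G] by blast
    have "exp (- N) \<le> T"
      unfolding T_def
    proof (rule rel_log_capacity_ge[OF ne])
      fix z assume z: "z \<in> cball a r \<inter> G"
      \<comment> \<open>For \<open>w\<close> with \<open>?f w < R - r\<close>, all points
        \<open>x + t *\<^sub>R y\<close> with \<open>t\<close> between \<open>- \<delta>\<close> and
        \<open>\<delta>\<close> stay in the ball of radius \<open>R\<close>. By continuity this
        holds for all \<open>w\<close> near \<open>z\<close>.\<close>
      let ?f = "\<lambda>w. norm (p (w - z)) + \<delta> * norm (q (w - z))"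
      have "continuous_on UNIV ?f"
        by (intro continuous_intros bounded_linear.continuous_on[OF p] bounded_linear.continuous_on[OF q])
      then have "open {w. ?f w < R - r}" by (intro open_Collect_less continuous_on_const)
      moreover have "?f z < R - r" using R by (simp add: linear_simps(3)[OF p] linear_simps(3)[OF q])
      ultimately have "\<forall>\<^sub>F w in nhds z. w \<in> {w. ?f w < R - r}" by (intro eventually_nhds_in_open) auto
      then show "\<forall>\<^sub>F w in nhds z. \<forall>u\<in>lelong_class. (\<forall>x\<in>K. u x \<le> 0) \<longrightarrow> pos_part u w \<le> N"
      proof (rule eventually_mono, intro ballI impI)
        fix w u assume w: "w \<in> {w. ?f w < R - r}" and u: "u \<in> lelong_class" "\<forall>x\<in>K. u x \<le> 0"
        define x where "x = z + p (w - z)"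
        define y where "y = q (w - z)"
        have wxy: "w = x + \<i> *s y"
          using pq[of "w - z"] by (simp add: x_def y_def J_def algebra_simps)
        have "pos_part u (x + \<i> *s y) \<le> M + 2 * ln (2 * exp 1) / \<delta>"
        proof (rule log_subharmonic_le_off_segment[OF log_subharmonic_line[OF u(1), of x y] \<delta>])
          fix t :: real assume t: "\<bar>t\<bar> \<le> \<delta>"
          have eq: "x + complex_of_real t *s y = x + t *\<^sub>R y" by (simp only: vector_smult_of_real)
          have "x + t *\<^sub>R y \<in> G"
            unfolding x_def y_def using z pG qG S.subspace by (intro subspace_add subspace_scale) auto
          moreover have "norm (x + t *\<^sub>R y - a) \<le> R"
          proof -
            have "x + t *\<^sub>R y - a = (z - a) + p (w - z) + t *\<^sub>R q (w - z)" by (simp add: x_def y_def)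
            then have "norm (x + t *\<^sub>R y - a) \<le> norm (z - a) + norm (p (w - z)) + norm (t *\<^sub>R q (w - z))"
              using norm_triangle_ineq[of "z - a" "p (w - z)"] norm_triangle_ineq[of "z - a + p (w - z)" "t *\<^sub>R q (w - z)"]
              by (simp only:)
            also have "norm (t *\<^sub>R q (w - z)) \<le> \<delta> * norm (q (w - z))" using t by (simp add: mult_right_mono)
            also have "norm (z - a) \<le> r" using z by (simp add: dist_norm norm_minus_commute)
            finally show ?thesis using w by simp
          qed
          then have "x + t *\<^sub>R y \<in> cball a R" by (simp add: dist_norm norm_minus_commute)
          ultimately show "pos_part u (x + complex_of_real t *s y) \<le> M" unfolding eq using real_bound[OF u] by blast
        qed
        then show "pos_part u w \<le> N" using \<delta>N wxy by simp
      qed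
    qed
    moreover have "exp (- N) = k / (8 * (d * V))" using dVk by (simp add: N_def exp_minus)
    ultimately have "k / (8 * (d * V)) \<le> T" by (simp only:)
    then have "k \<le> T * (8 * (d * V))" using d V by (simp add: pos_divide_le_eq)
    then show ?thesis using V by (simp add: pos_divide_le_eq mult_ac)
  qed
  also have "8 * d * T \<le> 8 * real (CARD('n) + complex_dim G) * T"
    using d(2) T0 by (intro mult_right_mono mult_left_mono) auto
  finally show ?thesis by (simp add: k_def V_def T_def)
qed

theorem theorem3p1:
  shows "(\<forall>(a :: complex^'n) r K. r > 0 \<and> K \<in> sets borel \<and> K \<subseteq> cball a r \<longrightarrow>
            measure lborel K / measure lborel (cball a r)
              \<le> (4 ^ CARD('n) * (fact CARD('n))\<^sup>2 / fact (2 * CARD('n) - 1))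
                  * (rel_log_capacity (cball a r) K)\<^sup>2)
       \<and> (\<forall>(G :: (complex^'n) set) m. generic_subspace G \<and> complex_dim G = m \<and> m \<le> CARD('n) - 1 \<longrightarrow>
            (\<forall>a\<in>G. \<forall>r K. r > 0 \<and> K \<in> sets borel \<and> K \<subseteq> cball a r \<inter> G \<longrightarrow>
              measure (subspace_lborel G) K / measure (subspace_lborel G) (cball a r \<inter> G)
                \<le> 8 * real (CARD('n) + m) * rel_log_capacity (cball a r \<inter> G) K))"
proof (intro conjI allI impI ballI)
  fix a :: "complex ^ 'n" and r K
  assume "r > 0 \<and> K \<in> sets borel \<and> K \<subseteq> cball a r"
  then show "measure lborel K / measure lborel (cball a r)
      \<le> (4 ^ CARD('n) * (fact CARD('n))\<^sup>2 / fact (2 * CARD('n) - 1)) * (rel_log_capacity (cball a r) K)\<^sup>2"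
    using measure_ratio_le_ball[of r K a] by (simp only: ball_const_def)
next
  fix G :: "(complex ^ 'n) set" and m a r K
  assume "generic_subspace G \<and> complex_dim G = m \<and> m \<le> CARD('n) - 1" "a \<in> G"
    "r > 0 \<and> K \<in> sets borel \<and> K \<subseteq> cball a r \<inter> G"
  then show "measure (subspace_lborel G) K / measure (subspace_lborel G) (cball a r \<inter> G)
      \<le> 8 * real (CARD('n) + m) * rel_log_capacity (cball a r \<inter> G) K"
    using measure_ratio_le_generic[of G a r K] by blast
qed

end
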